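(* Let $\alpha,\beta>-1$ and let $N\ge 2$ be an even integer. Then $\mathcal R_N^{\alpha,\beta}$ is bounded on $L^1(d\mu_{\alpha,\beta})$ and on $L^\infty(0,\pi)$.
   Context: For $\alpha,\beta>-1$ let $d\mu_{\alpha,\beta}(\theta)=(\sin\frac\theta2)^{2\alpha+1}(\cos\frac\theta2)^{2\beta+1}d\theta$ on $(0,\pi)$ and $\tau_{\alpha,\beta}=\frac{\alpha+\beta+1}{2}$. Let $\mathcal P_n^{\alpha,\beta}(\theta)=c_n^{\alpha,\beta}P_n^{\alpha,\beta}(\cos\theta)$, $n\ge0$, where $P_n^{\alpha,\beta}$ are the classical Jacobi polynomials (Szegő's convention) and $c_n^{\alpha,\beta}>0$ are such that $\{\mathcal P_n^{\alpha,\beta}:n\ge0\}$ is an orthonormal basis of $L^2(d\mu_{\alpha,\beta})$. Let $\delta=\frac{d}{d\theta}$ and $\delta^*=-\frac{d}{d\theta}-(\alpha+\frac12)\cot\frac\theta2+(\beta+\frac12)\tan\frac\theta2$, and let $D^N=\underbrace{\ldots\delta\delta^*\delta\delta^*\delta}_{N\text{ factors}}$ (alternating, the rightmost factor being $\delta$). The operator $\mathcal R_N^{\alpha,\beta}$ is the bounded operator on $L^2(d\mu_{\alpha,\beta})$ given by the $L^2(d\mu_{\alpha,\beta})$-convergent series $$\mathcal R_N^{\alpha,\beta}f=\sum_{n=1}^\infty|n+\tau_{\alpha,\beta}|^{-N}\langle f,\mathcal P_n^{\alpha,\beta}\rangle_{d\mu_{\alpha,\beta}}\,D^N\mathcal P_n^{\alpha,\beta}.$$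 Since $\mu_{\alpha,\beta}$ is finite, $L^\infty(0,\pi)\subset L^2(d\mu_{\alpha,\beta})\subset L^1(d\mu_{\alpha,\beta})$. Boundedness on $L^1(d\mu_{\alpha,\beta})$ means that the operator extends from the dense subspace $L^2(d\mu_{\alpha,\beta})$ to a bounded operator on $L^1(d\mu_{\alpha,\beta})$; boundedness on $L^\infty(0,\pi)$ means that its restriction to $L^\infty(0,\pi)$ is a bounded operator on $L^\infty(0,\pi)$. *)

theory Defs
  imports "HOL-Probability.Essential_Supremum"
begin

section \<open>Function spaces and bounded operators\<close>

text \<open>
  Elements of the spaces are complex-valued functions, not classes modulo equality almost
  everywhere. Operators are accordingly required to be linear only almost everywhere; together
  with the norm bound this forces them to respect equality almost everywhere.
\<close>

definition L1_space :: "'a measure \<Rightarrow> ('a \<Rightarrow> complex) set" where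
  "L1_space M = {f. integrable M f}"

definition L1_norm :: "'a measure \<Rightarrow> ('a \<Rightarrow> complex) \<Rightarrow> real" where
  "L1_norm M f = (\<integral>x. norm (f x) \<partial>M)"

definition L2_space :: "'a measure \<Rightarrow> ('a \<Rightarrow> complex) set" where
  "L2_space M = {f \<in> borel_measurable M. integrable M (\<lambda>x. (norm (f x))\<^sup>2)}"

definition L2_norm :: "'a measure \<Rightarrow> ('a \<Rightarrow> complex) \<Rightarrow> real" where
  "L2_norm M f = sqrt (\<integral>x. (norm (f x))\<^sup>2 \<partial>M)"

definition L2_inner :: "'a measure \<Rightarrow> ('a \<Rightarrow> complex) \<Rightarrow> ('a \<Rightarrow> complex) \<Rightarrow> complex" where
  "L2_inner M f g = (\<integral>x. f x * cnj (g x) \<partial>M)"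

definition Linf_space :: "'a measure \<Rightarrow> ('a \<Rightarrow> complex) set" where
  "Linf_space M = {f \<in> borel_measurable M. esssup M (\<lambda>x. ereal (norm (f x))) < \<infinity>}"

text \<open>Meaningful on \<^term>\<open>Linf_space M\<close> only, since \<^term>\<open>real_of_ereal \<infinity> = 0\<close>.\<close>

definition Linf_norm :: "'a measure \<Rightarrow> ('a \<Rightarrow> complex) \<Rightarrow> real" where
  "Linf_norm M f = real_of_ereal (esssup M (\<lambda>x. ereal (norm (f x))))"

definition L2_sums ::
  "'a measure \<Rightarrow> (nat \<Rightarrow> 'a \<Rightarrow> complex) \<Rightarrow> ('a \<Rightarrow> complex) \<Rightarrow> bool" where
  "L2_sums M u g \<longleftrightarrow> (\<forall>n\<ge>1. u n \<in> L2_space M) \<and> g \<in> L2_space M \<and>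
     (\<lambda>m. L2_norm M (\<lambda>x. (\<Sum>n=1..m. u n x) - g x)) \<longlonglongrightarrow> 0"

definition bounded_operator_on ::
  "'a measure \<Rightarrow> ('a \<Rightarrow> complex) set \<Rightarrow> (('a \<Rightarrow> complex) \<Rightarrow> real) \<Rightarrow>
   (('a \<Rightarrow> complex) \<Rightarrow> ('a \<Rightarrow> complex)) \<Rightarrow> bool" where
  "bounded_operator_on M V nrm T \<longleftrightarrow>
     (\<forall>f\<in>V. T f \<in> V) \<and>
     (\<forall>f\<in>V. \<forall>g\<in>V. \<forall>a b. AE x in M. T (\<lambda>y. a * f y + b * g y) x = a * T f x + b * T g x) \<and>
     (\<exists>C. \<forall>f\<in>V. nrm (T f) \<le> C * nrm f)"

section \<open>Jacobi expansions\<close>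

definition leb_0_pi :: "real measure" where
  "leb_0_pi = restrict_space lborel {0<..<pi}"

definition jacobi_measure :: "real \<Rightarrow> real \<Rightarrow> real measure" where
  "jacobi_measure \<alpha> \<beta> = density leb_0_pi
     (\<lambda>\<theta>. ennreal (sin (\<theta>/2) powr (2*\<alpha> + 1) * cos (\<theta>/2) powr (2*\<beta> + 1)))"

definition jacobi_tau :: "real \<Rightarrow> real \<Rightarrow> real" where
  "jacobi_tau \<alpha> \<beta> = (\<alpha> + \<beta> + 1) / 2"

text \<open>
  Classical Jacobi polynomials in the normalisation of Szego's book, where the value at 1 is
  \<open>(n + \<alpha>) gchoose n\<close>. This is the hypergeometric representation (4.21.2) there,
  \<open>((n + \<alpha>) gchoose n) * F(-n, n + \<alpha> + \<beta> + 1; \<alpha> + 1; (1 - x)/2)\<close>, with denominators cancelled.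
\<close>

definition jacobi_poly :: "real \<Rightarrow> real \<Rightarrow> nat \<Rightarrow> real \<Rightarrow> real" where
  "jacobi_poly \<alpha> \<beta> n x =
     (\<Sum>k\<le>n. real (n choose k) * pochhammer (real n + \<alpha> + \<beta> + 1) k *
        pochhammer (\<alpha> + real k + 1) (n - k) * ((x - 1) / 2) ^ k) / fact n"

text \<open>
  The Jacobi polynomials are orthogonal, so the positive constant making the system orthonormal
  is the reciprocal of the norm.
\<close>

definition jacobi_const :: "real \<Rightarrow> real \<Rightarrow> nat \<Rightarrow> real" where
  "jacobi_const \<alpha> \<beta> n =
     1 / sqrt (\<integral>\<theta>. (jacobi_poly \<alpha> \<beta> n (cos \<theta>))\<^sup>2 \<partial>jacobi_measure \<alpha> \<beta>)"

definition jacobi_fun :: "real \<Rightarrow> real \<Rightarrow> nat \<Rightarrow> real \<Rightarrow> real" where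
  "jacobi_fun \<alpha> \<beta> n \<theta> = jacobi_const \<alpha> \<beta> n * jacobi_poly \<alpha> \<beta> n (cos \<theta>)"

definition jacobi_delta :: "(real \<Rightarrow> real) \<Rightarrow> real \<Rightarrow> real" where
  "jacobi_delta f \<theta> = deriv f \<theta>"

definition jacobi_delta_star :: "real \<Rightarrow> real \<Rightarrow> (real \<Rightarrow> real) \<Rightarrow> real \<Rightarrow> real" where
  "jacobi_delta_star \<alpha> \<beta> f \<theta> =
     - deriv f \<theta> - (\<alpha> + 1/2) * cot (\<theta>/2) * f \<theta> + (\<beta> + 1/2) * tan (\<theta>/2) * f \<theta>"

primrec jacobi_D :: "real \<Rightarrow> real \<Rightarrow> nat \<Rightarrow> (real \<Rightarrow> real) \<Rightarrow> real \<Rightarrow> real" where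
  "jacobi_D \<alpha> \<beta> 0 f = f"
| "jacobi_D \<alpha> \<beta> (Suc N) f =
     (if even N then jacobi_delta (jacobi_D \<alpha> \<beta> N f)
      else jacobi_delta_star \<alpha> \<beta> (jacobi_D \<alpha> \<beta> N f))"

definition riesz_term ::
  "real \<Rightarrow> real \<Rightarrow> nat \<Rightarrow> (real \<Rightarrow> complex) \<Rightarrow> nat \<Rightarrow> real \<Rightarrow> complex" where
  "riesz_term \<alpha> \<beta> N f n \<theta> =
     of_real (\<bar>real n + jacobi_tau \<alpha> \<beta>\<bar> powi (- int N)) *
     L2_inner (jacobi_measure \<alpha> \<beta>) f (\<lambda>\<phi>. of_real (jacobi_fun \<alpha> \<beta> n \<phi>)) *
     of_real (jacobi_D \<alpha> \<beta> N (jacobi_fun \<alpha> \<beta> n) \<theta>)"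

text \<open>
  The choice only picks a representative of the L2-sum modulo equality almost everywhere.
\<close>

definition riesz :: "real \<Rightarrow> real \<Rightarrow> nat \<Rightarrow> (real \<Rightarrow> complex) \<Rightarrow> real \<Rightarrow> complex" where
  "riesz \<alpha> \<beta> N f = (SOME g. L2_sums (jacobi_measure \<alpha> \<beta>) (riesz_term \<alpha> \<beta> N f) g)"

end

theory Submission
  imports Defs
begin

text \<open>
  Since \<open>\<delta>\<^sup>* \<delta> \<P>\<^sub>n = n (n + 2\<tau>) \<P>\<^sub>n = ((n + \<tau>)\<^sup>2 - \<tau>\<^sup>2) \<P>\<^sub>n\<close>, for \<open>N = 2k\<close> the operator multiplies the
  \<open>n\<close>-th coefficient by \<open>(1 - a\<^sub>n)\<^sup>k\<close>, where \<open>a\<^sub>n = \<tau>\<^sup>2 / (n + \<tau>)\<^sup>2\<close> are the multipliers of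
  \<open>\<tau>\<^sup>2 (\<delta>\<^sup>* \<delta> + \<tau>\<^sup>2)\<^sup>-\<^sup>1\<close>. By the maximum principle the latter is a contraction for the supremum norm on
  polynomials in \<open>cos \<theta>\<close>: at a maximum of \<open>u\<close>, endpoints included, \<open>\<delta>\<^sup>* \<delta> u \<ge> 0\<close>. So the operator has
  norm at most \<open>2\<^sup>k\<close> on polynomials; bounded functions are limits in \<open>L\<^sup>2\<close> of uniformly bounded
  polynomials, and the bound on \<open>L\<^sup>1\<close> follows from self-adjointness.
\<close>

section \<open>The space of square-integrable functions\<close>

text \<open>The maximum principle can stay inside polynomials because the Jacobi polynomials are
  eigenvectors: the resolvent equation for a finite expansion is solved by another finite expansion,
  so existence and regularity of solutions up to the endpoints come for free. Approximation does the
  rest. The obstacle is that \<open>riesz\<close> is a representative picked by \<open>SOME\<close>,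
  so linearity, self-adjointness and even the value on a finite expansion can only be read off from
  the convergence of the series, up to null sets. These deductions concern any multiplier of an
  orthonormal system over a finite measure and are made in locales, before the Jacobi polynomials
  appear. The series starts at n = 1; this fits because the multiplier vanishes at n = 0. The final
  constant is 2^k times 2: the second factor pays for approximating real and imaginary parts
  separately. The extension to L1 is written down as a series that converges almost everywhere, so
  that it is an explicit function rather than an abstract limit.\<close>

lemma L2_spaceI:
  "f \<in> borel_measurable M \<Longrightarrow> integrable M (\<lambda>x. (norm (f x))\<^sup>2) \<Longrightarrow> f \<in> L2_space M"
  by (simp add: L2_space_def)

lemma L2_space_measurable: "f \<in> L2_space M \<Longrightarrow> f \<in> borel_measurable M"
  by (simp add: L2_space_def)

lemma L2_space_integrable: "f \<in> L2_space M \<Longrightarrow> integrable M (\<lambda>x. (norm (f x))\<^sup>2)"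
  by (simp add: L2_space_def)

lemma L2_norm_nonneg [simp]: "0 \<le> L2_norm M f"
  by (simp add: L2_norm_def)

lemma L2_norm_power2: "(L2_norm M f)\<^sup>2 = (\<integral>x. (norm (f x))\<^sup>2 \<partial>M)"
  by (simp add: L2_norm_def)

lemma two_mult_le: "2 * (a * b) \<le> a\<^sup>2 + b\<^sup>2" for a b :: real
  using sum_squares_bound[of a b] by simp

lemma L2_mult_integrable:
  assumes "f \<in> L2_space M" "g \<in> L2_space M"
  shows "integrable M (\<lambda>x. norm (f x) * norm (g x))"
proof (rule Bochner_Integration.integrable_bound)
  note [measurable] = assms[THEN L2_space_measurable]
  show "integrable M (\<lambda>x. (norm (f x))\<^sup>2 + (norm (g x))\<^sup>2)"
    using assms by (intro Bochner_Integration.integrable_add L2_space_integrable)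
  show "(\<lambda>x. norm (f x) * norm (g x)) \<in> borel_measurable M" by measurable
  show "AE x in M. norm (norm (f x) * norm (g x)) \<le> norm ((norm (f x))\<^sup>2 + (norm (g x))\<^sup>2)"
  proof (rule AE_I2)
    fix x
    have "2 * (norm (f x) * norm (g x)) \<le> (norm (f x))\<^sup>2 + (norm (g x))\<^sup>2"
      by (rule two_mult_le)
    moreover have "0 \<le> norm (f x) * norm (g x)" by simp
    ultimately have "norm (f x) * norm (g x) \<le> (norm (f x))\<^sup>2 + (norm (g x))\<^sup>2"
      by linarith
    then show "norm (norm (f x) * norm (g x)) \<le> norm ((norm (f x))\<^sup>2 + (norm (g x))\<^sup>2)"
      by simp
  qed
qed

lemma L2_inner_integrable:
  assumes "f \<in> L2_space M" "g \<in> L2_space M"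
  shows "integrable M (\<lambda>x. f x * cnj (g x))"
proof (rule Bochner_Integration.integrable_bound[OF L2_mult_integrable[OF assms]])
  note [measurable] = assms[THEN L2_space_measurable]
  show "(\<lambda>x. f x * cnj (g x)) \<in> borel_measurable M"
    by (intro borel_measurable_times borel_measurable_continuous_on[of cnj] continuous_intros) auto
qed (simp add: norm_mult)

text \<open>The inequality is imported for extended nonnegative integrals; integrability of the
  product and of the squares turns all three of them into real integrals.\<close>

lemma L2_Cauchy_Schwarz:
  assumes "f \<in> L2_space M" "g \<in> L2_space M"
  shows "(\<integral>x. norm (f x) * norm (g x) \<partial>M) \<le> L2_norm M f * L2_norm M g"
proof -
  note [measurable] = assms[THEN L2_space_measurable]
  have "(\<integral>\<^sup>+x. ennreal (norm (f x)) * ennreal (norm (g x)) \<partial>M)\<^sup>2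
      \<le> (\<integral>\<^sup>+x. (ennreal (norm (f x)))\<^sup>2 \<partial>M) * (\<integral>\<^sup>+x. (ennreal (norm (g x)))\<^sup>2 \<partial>M)"
    by (rule Cauchy_Schwarz_nn_integral) measurable
  moreover have "(\<integral>\<^sup>+x. ennreal (norm (f x)) * ennreal (norm (g x)) \<partial>M)
      = ennreal (\<integral>x. norm (f x) * norm (g x) \<partial>M)"
    by (subst nn_integral_eq_integral[OF L2_mult_integrable[OF assms], symmetric])
       (auto simp: ennreal_mult)
  moreover have "(\<integral>\<^sup>+x. (ennreal (norm (h x)))\<^sup>2 \<partial>M) = ennreal (\<integral>x. (norm (h x))\<^sup>2 \<partial>M)"
    if "h \<in> L2_space M" for h :: "'a \<Rightarrow> complex"
    by (subst nn_integral_eq_integral[OF L2_space_integrable[OF that], symmetric])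
       (auto simp: ennreal_power)
  ultimately have "ennreal ((\<integral>x. norm (f x) * norm (g x) \<partial>M)\<^sup>2)
      \<le> ennreal ((\<integral>x. (norm (f x))\<^sup>2 \<partial>M) * (\<integral>x. (norm (g x))\<^sup>2 \<partial>M))"
    using assms by (simp add: ennreal_mult ennreal_power)
  then have "(\<integral>x. norm (f x) * norm (g x) \<partial>M)\<^sup>2
      \<le> (\<integral>x. (norm (f x))\<^sup>2 \<partial>M) * (\<integral>x. (norm (g x))\<^sup>2 \<partial>M)"
    by (subst (asm) ennreal_le_iff) simp_all
  then show ?thesis
    by (simp add: L2_norm_def real_sqrt_mult[symmetric] real_le_rsqrt)
qed

lemma norm_L2_inner_le:
  assumes "f \<in> L2_space M" "g \<in> L2_space M"
  shows "norm (L2_inner M f g) \<le> L2_norm M f * L2_norm M g"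
proof -
  have "norm (L2_inner M f g) \<le> (\<integral>x. norm (f x * cnj (g x)) \<partial>M)"
    unfolding L2_inner_def by (rule integral_norm_bound)
  also have "\<dots> \<le> L2_norm M f * L2_norm M g"
    using L2_Cauchy_Schwarz[OF assms] by (simp add: norm_mult)
  finally show ?thesis .
qed

lemma L2_space_zero [simp]: "(\<lambda>x. 0) \<in> L2_space M"
  by (simp add: L2_space_def)

lemma L2_space_cmult:
  assumes "f \<in> L2_space M"
  shows "(\<lambda>x. c * f x) \<in> L2_space M"
  using assms by (auto simp: L2_space_def norm_mult power_mult_distrib)

lemma L2_space_add:
  assumes "f \<in> L2_space M" "g \<in> L2_space M"
  shows "(\<lambda>x. f x + g x) \<in> L2_space M"
proof (rule L2_spaceI)
  note [measurable] = assms[THEN L2_space_measurable]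
  show "(\<lambda>x. f x + g x) \<in> borel_measurable M" by measurable
  show "integrable M (\<lambda>x. (norm (f x + g x))\<^sup>2)"
  proof (rule Bochner_Integration.integrable_bound)
    show "integrable M (\<lambda>x. (norm (f x))\<^sup>2 + (norm (g x))\<^sup>2 + 2 * (norm (f x) * norm (g x)))"
      using assms L2_mult_integrable[OF assms]
      by (intro Bochner_Integration.integrable_add L2_space_integrable
          Bochner_Integration.integrable_mult_right)
    show "(\<lambda>x. (norm (f x + g x))\<^sup>2) \<in> borel_measurable M" by measurable
    have "(norm (f x + g x))\<^sup>2 \<le> (norm (f x) + norm (g x))\<^sup>2" for x
      by (intro power_mono norm_triangle_ineq) simp
    then show "AE x in M. norm ((norm (f x + g x))\<^sup>2)
        \<le> norm ((norm (f x))\<^sup>2 + (norm (g x))\<^sup>2 + 2 * (norm (f x) * norm (g x)))"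
      by (auto simp: power2_sum abs_of_nonneg mult.assoc)
  qed
qed

lemma L2_space_diff:
  assumes "f \<in> L2_space M" "g \<in> L2_space M"
  shows "(\<lambda>x. f x - g x) \<in> L2_space M"
  using L2_space_add[OF assms(1) L2_space_cmult[OF assms(2), of "-1"]] by simp

lemma L2_space_sum:
  assumes "\<And>i. i \<in> A \<Longrightarrow> f i \<in> L2_space M"
  shows "(\<lambda>x. \<Sum>i\<in>A. f i x) \<in> L2_space M"
  using assms by (induction A rule: infinite_finite_induct) (auto intro: L2_space_add)

lemma L2_norm_triangle:
  assumes "f \<in> L2_space M" "g \<in> L2_space M"
  shows "L2_norm M (\<lambda>x. f x + g x) \<le> L2_norm M f + L2_norm M g"
proof (rule power2_le_imp_le)
  have "(L2_norm M (\<lambda>x. f x + g x))\<^sup>2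
      \<le> (\<integral>x. ((norm (f x))\<^sup>2 + (norm (g x))\<^sup>2) + 2 * (norm (f x) * norm (g x)) \<partial>M)"
    unfolding L2_norm_power2
  proof (rule integral_mono)
    show "integrable M (\<lambda>x. (norm (f x + g x))\<^sup>2)"
      using assms by (intro L2_space_integrable L2_space_add)
    show "integrable M (\<lambda>x. ((norm (f x))\<^sup>2 + (norm (g x))\<^sup>2) + 2 * (norm (f x) * norm (g x)))"
      using assms L2_mult_integrable[OF assms]
      by (intro Bochner_Integration.integrable_add L2_space_integrable
          Bochner_Integration.integrable_mult_right)
    show "(norm (f x + g x))\<^sup>2 \<le> ((norm (f x))\<^sup>2 + (norm (g x))\<^sup>2) + 2 * (norm (f x) * norm (g x))"
      for x
      using power_mono[OF norm_triangle_ineq[of "f x" "g x"], of 2]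
      by (simp add: power2_sum mult.assoc)
  qed
  also have "\<dots> = (L2_norm M f)\<^sup>2 + (L2_norm M g)\<^sup>2 + 2 * (\<integral>x. norm (f x) * norm (g x) \<partial>M)"
    using assms L2_mult_integrable[OF assms]
    by (simp add: L2_norm_power2 L2_space_integrable)
  also have "\<dots> \<le> (L2_norm M f + L2_norm M g)\<^sup>2"
    using L2_Cauchy_Schwarz[OF assms] by (simp add: power2_sum)
  finally show "(L2_norm M (\<lambda>x. f x + g x))\<^sup>2 \<le> (L2_norm M f + L2_norm M g)\<^sup>2" .
qed simp

lemma L2_norm_cmult: "L2_norm M (\<lambda>x. c * f x) = norm c * L2_norm M f"
  by (simp add: L2_norm_def norm_mult power_mult_distrib real_sqrt_mult)

lemma L2_norm_minus_commute: "L2_norm M (\<lambda>x. f x - g x) = L2_norm M (\<lambda>x. g x - f x)"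
  by (simp add: L2_norm_def norm_minus_commute)

lemma L2_norm_triangle_diff:
  assumes "f \<in> L2_space M" "g \<in> L2_space M" "h \<in> L2_space M"
  shows "L2_norm M (\<lambda>x. f x - h x) \<le> L2_norm M (\<lambda>x. f x - g x) + L2_norm M (\<lambda>x. g x - h x)"
  using L2_norm_triangle[OF L2_space_diff[OF assms(1,2)] L2_space_diff[OF assms(2,3)]] by simp

lemma L2_inner_add_left:
  assumes "f \<in> L2_space M" "g \<in> L2_space M" "h \<in> L2_space M"
  shows "L2_inner M (\<lambda>x. f x + g x) h = L2_inner M f h + L2_inner M g h"
  using assms by (simp add: L2_inner_def distrib_right L2_inner_integrable)

lemma L2_inner_diff_left:
  assumes "f \<in> L2_space M" "g \<in> L2_space M" "h \<in> L2_space M"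
  shows "L2_inner M (\<lambda>x. f x - g x) h = L2_inner M f h - L2_inner M g h"
  using assms by (simp add: L2_inner_def left_diff_distrib L2_inner_integrable)

lemma L2_inner_cmult_left: "L2_inner M (\<lambda>x. c * f x) h = c * L2_inner M f h"
  by (simp add: L2_inner_def mult.assoc)

lemma L2_inner_sum_left:
  assumes "\<And>i. i \<in> A \<Longrightarrow> f i \<in> L2_space M" "h \<in> L2_space M"
  shows "L2_inner M (\<lambda>x. \<Sum>i\<in>A. f i x) h = (\<Sum>i\<in>A. L2_inner M (f i) h)"
  using assms by (simp add: L2_inner_def sum_distrib_right L2_inner_integrable)

lemma L2_inner_cnj: "cnj (L2_inner M f g) = L2_inner M g f"
proof -
  have "cnj (L2_inner M f g) = (\<integral>x. cnj (f x * cnj (g x)) \<partial>M)"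
    unfolding L2_inner_def by (rule Bochner_Integration.integral_cnj[symmetric])
  then show ?thesis by (simp add: L2_inner_def mult.commute)
qed

lemma L2_inner_self: "L2_inner M f f = of_real ((L2_norm M f)\<^sup>2)"
  unfolding L2_norm_power2 L2_inner_def
  by (subst integral_complex_of_real[symmetric]) (simp only: complex_norm_square)

lemma L2_norm_eq_0_AE:
  assumes "f \<in> L2_space M" "L2_norm M f = 0"
  shows "AE x in M. f x = 0"
proof -
  have "(\<integral>x. (norm (f x))\<^sup>2 \<partial>M) = 0"
    using assms(2) L2_norm_power2[of M f] by simp
  then have "AE x in M. (norm (f x))\<^sup>2 = 0"
    by (subst (asm) integral_nonneg_eq_0_iff_AE[OF L2_space_integrable[OF assms(1)]]) auto
  then show ?thesis by auto
qed

text \<open>Tonelli: the integral of the series of norms is the finite sum of the integrals, so the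
  series is finite almost everywhere. It serves both the completeness of L2 and the L1
  extension.\<close>

lemma AE_summable_norm:
  fixes d :: "nat \<Rightarrow> 'a \<Rightarrow> 'b::{banach, second_countable_topology}"
  assumes d: "\<And>k. integrable M (d k)" and s: "summable (\<lambda>k. \<integral>x. norm (d k x) \<partial>M)"
  shows "AE x in M. summable (\<lambda>k. norm (d k x))"
proof -
  have [measurable]: "d k \<in> borel_measurable M" for k
    using d by (rule borel_measurable_integrable)
  have "(\<integral>\<^sup>+x. (\<Sum>k. ennreal (norm (d k x))) \<partial>M) = (\<Sum>k. \<integral>\<^sup>+x. ennreal (norm (d k x)) \<partial>M)"
    by (rule nn_integral_suminf) measurable
  also have "\<dots> = (\<Sum>k. ennreal (\<integral>x. norm (d k x) \<partial>M))"
    using d by (subst nn_integral_eq_integral) auto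
  also have "\<dots> = ennreal (\<Sum>k. \<integral>x. norm (d k x) \<partial>M)"
    using s by (intro suminf_ennreal2) auto
  finally have "(\<integral>\<^sup>+x. (\<Sum>k. ennreal (norm (d k x))) \<partial>M) \<noteq> \<infinity>" by simp
  then have "AE x in M. (\<Sum>k. ennreal (norm (d k x))) \<noteq> \<infinity>"
    by (intro nn_integral_PInf_AE) measurable
  then show ?thesis
    by eventually_elim (auto intro: summable_suminf_not_top)
qed

section \<open>Riesz-Fischer completeness over a finite measure\<close>

context finite_measure
begin

lemma bounded_L2:
  assumes "f \<in> borel_measurable M" "AE x in M. norm (f x) \<le> B"
  shows "f \<in> L2_space M"
proof (rule L2_spaceI[OF assms(1)])
  note [measurable] = assms(1)
  show "integrable M (\<lambda>x. (norm (f x))\<^sup>2)"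
  proof (rule integrable_const_bound[where B="B\<^sup>2"])
    show "AE x in M. norm ((norm (f x))\<^sup>2) \<le> B\<^sup>2"
      using assms(2) by eventually_elim (auto intro: power_mono)
  qed measurable
qed

lemma const_L2: "(\<lambda>x. c) \<in> L2_space M"
  by (simp add: L2_space_def)

lemma L2_integrable:
  assumes "f \<in> L2_space M"
  shows "integrable M f"
  using L2_mult_integrable[OF assms const_L2[of 1]] L2_space_measurable[OF assms]
  by (simp add: integrable_norm_iff)

lemma L1_norm_le_L2_norm:
  assumes "f \<in> L2_space M"
  shows "(\<integral>x. norm (f x) \<partial>M) \<le> L2_norm M f * sqrt (measure M (space M))"
  using L2_Cauchy_Schwarz[OF assms const_L2[of 1]] by (simp add: L2_norm_def)

text \<open>A subsequence with increments below (1/2)^k in L2, hence summable in L1 because the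
  measure is finite, converges almost everywhere. Fatou's lemma then bounds the L2 distance of
  \<open>s n\<close> to the pointwise limit.\<close>

lemma L2_complete:
  assumes s: "\<And>n. s n \<in> L2_space M"
    and Cauchy: "\<And>e. e > 0 \<Longrightarrow> \<exists>N. \<forall>m\<ge>N. \<forall>n\<ge>N. L2_norm M (\<lambda>x. s m x - s n x) < e"
  shows "\<exists>g\<in>L2_space M. (\<lambda>n. L2_norm M (\<lambda>x. s n x - g x)) \<longlonglongrightarrow> 0"
proof -
  have [measurable]: "s n \<in> borel_measurable M" for n
    using s by (rule L2_space_measurable)
  have "\<forall>k. \<exists>N. \<forall>m\<ge>N. \<forall>n\<ge>N. L2_norm M (\<lambda>x. s m x - s n x) < (1/2)^k"
    using Cauchy by simp
  then obtain N where N: "\<And>k m n. m \<ge> N k \<Longrightarrow> n \<ge> N k \<Longrightarrow> L2_norm M (\<lambda>x. s m x - s n x) < (1/2)^k"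
    by metis
  \<comment> \<open>Cumulative sums make \<open>R\<close> dominate every earlier threshold, so
    \<open>R (Suc k)\<close> and \<open>R k\<close> both lie beyond \<open>N k\<close>.\<close>
  define R where "R k = (\<Sum>i\<le>k. N i)" for k
  have RN: "N k \<le> R j" if "k \<le> j" for k j
    unfolding R_def using that by (intro member_le_sum) auto
  define d where "d k x = s (R (Suc k)) x - s (R k) x" for k x
  have dL2: "d k \<in> L2_space M" for k
    unfolding d_def using s by (intro L2_space_diff)
  have d_le: "(\<integral>x. norm (d k x) \<partial>M) \<le> (1/2)^k * sqrt (measure M (space M))" for k
  proof -
    have "L2_norm M (d k) \<le> (1/2)^k"
      unfolding d_def using N[of k "R (Suc k)" "R k"] RN[of k "Suc k"] RN[of k k] by simp
    then have "L2_norm M (d k) * sqrt (measure M (space M)) \<le> (1/2)^k * sqrt (measure M (space M))"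
      by (intro mult_right_mono) auto
    with L1_norm_le_L2_norm[OF dL2[of k]] show ?thesis by linarith
  qed
  have "summable (\<lambda>k. \<integral>x. norm (d k x) \<partial>M)"
  proof (rule summable_comparison_test')
    show "summable (\<lambda>k. (1/2::real)^k * sqrt (measure M (space M)))"
      by (intro summable_mult2 summable_geometric) simp
    show "norm (\<integral>x. norm (d k x) \<partial>M) \<le> (1/2)^k * sqrt (measure M (space M))" if "k \<ge> 0" for k
      using d_le[of k] by simp
  qed
  then have "AE x in M. summable (\<lambda>k. norm (d k x))"
    using dL2 by (intro AE_summable_norm L2_integrable)
  then have conv: "AE x in M. convergent (\<lambda>k. s (R k) x)"
  proof eventually_elim
    case (elim x)
    then have "summable (\<lambda>k. d k x)" by (rule summable_norm_cancel)
    then have "convergent (\<lambda>k. \<Sum>i<k. d i x)" by (simp add: summable_iff_convergent)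
    moreover have "(\<Sum>i<k. d i x) = s (R k) x - s (R 0) x" for k
      by (induction k) (auto simp: d_def)
    ultimately have "convergent (\<lambda>k. s (R k) x - s (R 0) x)" by simp
    then show ?case by (simp add: convergent_diff_const_right_iff)
  qed
  \<comment> \<open>Where the subsequence diverges \<open>lim\<close> is an arbitrary value; this
    happens only on a null set, and \<open>g\<close> is measurable regardless.\<close>
  define g where "g x = lim (\<lambda>k. s (R k) x)" for x
  have [measurable]: "g \<in> borel_measurable M"
    unfolding g_def by measurable
  have tail: "(\<integral>\<^sup>+x. ennreal ((norm (s n x - g x))\<^sup>2) \<partial>M) \<le> ennreal (((1/2)^K)\<^sup>2)"
    if n: "n \<ge> R K" for n K
  proof -
    have "(\<integral>\<^sup>+x. ennreal ((norm (s n x - g x))\<^sup>2) \<partial>M)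
        = (\<integral>\<^sup>+x. liminf (\<lambda>k. ennreal ((norm (s n x - s (R k) x))\<^sup>2)) \<partial>M)"
    proof (rule nn_integral_cong_AE)
      show "AE x in M. ennreal ((norm (s n x - g x))\<^sup>2)
          = liminf (\<lambda>k. ennreal ((norm (s n x - s (R k) x))\<^sup>2))"
        using conv
      proof eventually_elim
        case (elim x)
        then have "(\<lambda>k. s (R k) x) \<longlonglongrightarrow> g x"
          unfolding g_def by (simp add: convergent_LIMSEQ_iff)
        then have "(\<lambda>k. ennreal ((norm (s n x - s (R k) x))\<^sup>2)) \<longlonglongrightarrow> ennreal ((norm (s n x - g x))\<^sup>2)"
          by (intro tendsto_intros)
        then show ?case
          using lim_imp_Liminf[OF trivial_limit_sequentially] by metis
      qed
    qed
    also have "\<dots> \<le> liminf (\<lambda>k. \<integral>\<^sup>+x. ennreal ((norm (s n x - s (R k) x))\<^sup>2) \<partial>M)"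
      by (rule nn_integral_liminf) measurable
    also have "\<dots> \<le> ennreal (((1/2)^K)\<^sup>2)"
    proof (rule order_trans[OF Liminf_le_Limsup Limsup_bounded])
      show "\<forall>\<^sub>F k in sequentially.
          (\<integral>\<^sup>+x. ennreal ((norm (s n x - s (R k) x))\<^sup>2) \<partial>M) \<le> ennreal (((1/2)^K)\<^sup>2)"
        using eventually_ge_at_top[of K]
      proof eventually_elim
        case (elim k)
        have "L2_norm M (\<lambda>x. s n x - s (R k) x) \<le> (1/2)^K"
          using N[of K n "R k"] RN[of K K] RN[OF elim] n by simp
        then have "(L2_norm M (\<lambda>x. s n x - s (R k) x))\<^sup>2 \<le> ((1/2)^K)\<^sup>2"
          by (intro power_mono) auto
        then show ?case
          by (subst nn_integral_eq_integral)
             (auto simp: L2_norm_power2 intro!: L2_space_integrable L2_space_diff s ennreal_leI)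
      qed
    qed simp
    finally show ?thesis .
  qed
  have diffL2: "(\<lambda>x. s n x - g x) \<in> L2_space M" if "n \<ge> R 0" for n
  proof (rule L2_spaceI)
    have "(\<integral>\<^sup>+x. ennreal ((norm (s n x - g x))\<^sup>2) \<partial>M) < \<infinity>"
      by (rule le_less_trans[OF tail[OF that]]) simp
    then show "integrable M (\<lambda>x. (norm (s n x - g x))\<^sup>2)"
      by (intro integrableI_bounded) auto
  qed measurable
  have gL2: "g \<in> L2_space M"
    using L2_space_diff[OF s diffL2[OF order_refl], of "R 0"] by simp
  have "(\<lambda>n. L2_norm M (\<lambda>x. s n x - g x)) \<longlonglongrightarrow> 0"
  proof (rule LIMSEQ_I)
    fix e :: real assume "e > 0"
    then obtain K where K: "(1/2::real)^K < e"
      using real_arch_pow_inv[of e "1/2"] by auto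
    show "\<exists>no. \<forall>n\<ge>no. norm (L2_norm M (\<lambda>x. s n x - g x) - 0) < e"
    proof (intro exI allI impI)
      fix n assume n: "n \<ge> R K"
      have "ennreal ((L2_norm M (\<lambda>x. s n x - g x))\<^sup>2) \<le> ennreal (((1/2)^K)\<^sup>2)"
        using tail[OF n] unfolding L2_norm_power2
        by (subst (asm) nn_integral_eq_integral)
           (auto intro!: L2_space_integrable L2_space_diff s gL2)
      then have "(L2_norm M (\<lambda>x. s n x - g x))\<^sup>2 \<le> ((1/2)^K)\<^sup>2"
        by (subst (asm) ennreal_le_iff) simp_all
      then have "L2_norm M (\<lambda>x. s n x - g x) \<le> (1/2)^K"
        by (rule power2_le_imp_le) simp
      with K show "norm (L2_norm M (\<lambda>x. s n x - g x) - 0) < e" by simp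
    qed
  qed
  with gL2 show ?thesis by blast
qed

end

section \<open>Multipliers of orthonormal expansions\<close>

text \<open>The triangle inequality through the partial sums. This is how an operator known only as
  some sum of its series acquires linearity and explicit values.\<close>

lemma L2_sums_uniqueD:
  assumes "L2_sums M u g" "L2_sums M u h"
  shows "AE x in M. g x = h x"
proof -
  define s where "s n x = (\<Sum>i=1..n. u i x)" for n :: nat and x
  have s: "s n \<in> L2_space M" for n
    unfolding s_def using assms(1) by (intro L2_space_sum) (auto simp: L2_sums_def)
  have g: "g \<in> L2_space M" and h: "h \<in> L2_space M"
    using assms by (auto simp: L2_sums_def)
  have "L2_norm M (\<lambda>x. g x - h x)
      \<le> L2_norm M (\<lambda>x. s n x - g x) + L2_norm M (\<lambda>x. s n x - h x)" for n
    using L2_norm_triangle_diff[OF g s h] by (simp add: L2_norm_minus_commute[of M g])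
  moreover have "(\<lambda>n. L2_norm M (\<lambda>x. s n x - g x) + L2_norm M (\<lambda>x. s n x - h x)) \<longlonglongrightarrow> 0 + 0"
    using assms by (intro tendsto_add) (auto simp: L2_sums_def s_def)
  ultimately have "L2_norm M (\<lambda>x. g x - h x) \<le> 0 + 0"
    by (intro LIMSEQ_le_const) auto
  then have "L2_norm M (\<lambda>x. g x - h x) = 0"
    by (simp add: antisym)
  from L2_norm_eq_0_AE[OF L2_space_diff[OF g h] this] show ?thesis by auto
qed

lemma L2_sums_linear:
  assumes "L2_sums M u g" "L2_sums M v h"
  shows "L2_sums M (\<lambda>n x. a * u n x + b * v n x) (\<lambda>x. a * g x + b * h x)"
  unfolding L2_sums_def
proof (intro conjI allI impI)
  have g: "g \<in> L2_space M" and h: "h \<in> L2_space M"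
    and u: "\<And>n. n \<ge> 1 \<Longrightarrow> u n \<in> L2_space M" and v: "\<And>n. n \<ge> 1 \<Longrightarrow> v n \<in> L2_space M"
    using assms by (auto simp: L2_sums_def)
  show "(\<lambda>x. a * g x + b * h x) \<in> L2_space M"
    by (intro L2_space_add L2_space_cmult g h)
  show "(\<lambda>x. a * u n x + b * v n x) \<in> L2_space M" if "1 \<le> n" for n
    by (intro L2_space_add L2_space_cmult u v that)
  define s where "s = (\<lambda>(n::nat) x. (\<Sum>i=1..n. u i x) - g x)"
  define t where "t = (\<lambda>(n::nat) x. (\<Sum>i=1..n. v i x) - h x)"
  have s: "s n \<in> L2_space M" and t: "t n \<in> L2_space M" for n
    unfolding s_def t_def using u v g h by (auto intro!: L2_space_diff L2_space_sum)
  show "(\<lambda>n. L2_norm M (\<lambda>x. (\<Sum>i=1..n. a * u i x + b * v i x) - (a * g x + b * h x))) \<longlonglongrightarrow> 0"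
  proof (rule tendsto_sandwich[where f="\<lambda>_. 0", OF always_eventually always_eventually])
    have "(\<lambda>n. norm a * L2_norm M (s n) + norm b * L2_norm M (t n)) \<longlonglongrightarrow> norm a * 0 + norm b * 0"
      using assms by (intro tendsto_add tendsto_mult tendsto_const) (auto simp: L2_sums_def s_def t_def)
    then show "(\<lambda>n. norm a * L2_norm M (s n) + norm b * L2_norm M (t n)) \<longlonglongrightarrow> 0"
      by simp
    show "\<forall>n. L2_norm M (\<lambda>x. (\<Sum>i=1..n. a * u i x + b * v i x) - (a * g x + b * h x))
        \<le> norm a * L2_norm M (s n) + norm b * L2_norm M (t n)"
    proof
      fix n
      have "(\<lambda>x. (\<Sum>i=1..n. a * u i x + b * v i x) - (a * g x + b * h x))
          = (\<lambda>x. a * s n x + b * t n x)"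
        by (simp add: s_def t_def sum.distrib sum_distrib_left algebra_simps)
      with L2_norm_triangle[OF L2_space_cmult[OF s, of a] L2_space_cmult[OF t, of b]]
      show "L2_norm M (\<lambda>x. (\<Sum>i=1..n. a * u i x + b * v i x) - (a * g x + b * h x))
          \<le> norm a * L2_norm M (s n) + norm b * L2_norm M (t n)"
        by (simp add: L2_norm_cmult)
    qed
  qed (auto intro: always_eventually)
qed

lemma L2_inner_tendsto_left:
  assumes "\<And>n. s n \<in> L2_space M" "g \<in> L2_space M" "h \<in> L2_space M"
    and "(\<lambda>n. L2_norm M (\<lambda>x. s n x - g x)) \<longlonglongrightarrow> 0"
  shows "(\<lambda>n. L2_inner M (s n) h) \<longlonglongrightarrow> L2_inner M g h"
proof (rule LIM_zero_cancel, rule Lim_null_comparison[OF always_eventually])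
  show "\<forall>n. norm (L2_inner M (s n) h - L2_inner M g h) \<le> L2_norm M (\<lambda>x. s n x - g x) * L2_norm M h"
    using norm_L2_inner_le[OF L2_space_diff[OF assms(1) assms(2)] assms(3)] assms(1-3)
    by (simp add: L2_inner_diff_left[symmetric])
  show "(\<lambda>n. L2_norm M (\<lambda>x. s n x - g x) * L2_norm M h) \<longlonglongrightarrow> 0"
    using tendsto_mult_left_zero[OF assms(4)] by simp
qed

text \<open>L2 convergence on a finite measure gives L1 convergence, hence a subsequence converging
  almost everywhere, along which the pointwise bounds pass to the limit.\<close>

lemma (in finite_measure) L2_tendsto_AE_bound:
  assumes p: "\<And>n. p n \<in> L2_space M" and g: "g \<in> L2_space M"
    and lim: "(\<lambda>n. L2_norm M (\<lambda>x. p n x - g x)) \<longlonglongrightarrow> 0"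
    and bound: "\<And>n. AE x in M. norm (p n x) \<le> b n" and b: "b \<longlonglongrightarrow> B"
  shows "AE x in M. norm (g x) \<le> B"
proof -
  have "(\<lambda>n. \<integral>x. norm (p n x - g x) \<partial>M) \<longlonglongrightarrow> 0"
  proof (rule tendsto_sandwich[where f="\<lambda>_. 0", OF always_eventually always_eventually])
    show "(\<lambda>n. L2_norm M (\<lambda>x. p n x - g x) * sqrt (measure M (space M))) \<longlonglongrightarrow> 0"
      using tendsto_mult_left_zero[OF lim] by simp
    show "\<forall>n. (\<integral>x. norm (p n x - g x) \<partial>M) \<le> L2_norm M (\<lambda>x. p n x - g x) * sqrt (measure M (space M))"
      using p g by (auto intro!: L1_norm_le_L2_norm L2_space_diff)
  qed auto
  then obtain r where r: "strict_mono r" "AE x in M. (\<lambda>n. p (r n) x - g x) \<longlonglongrightarrow> 0"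
    using tendsto_L1_AE_subseq[of M "\<lambda>n x. p n x - g x"] p g
    by (auto intro!: L2_integrable L2_space_diff)
  have "AE x in M. \<forall>n. norm (p n x) \<le> b n"
    using bound by (simp add: AE_all_countable)
  with r(2) show ?thesis
  proof eventually_elim
    case (elim x)
    have "(\<lambda>n. norm (p (r n) x)) \<longlonglongrightarrow> norm (g x)"
      using elim(1) by (intro tendsto_norm) (simp add: LIM_zero_iff)
    moreover have "(\<lambda>n. b (r n)) \<longlonglongrightarrow> B"
      using LIMSEQ_subseq_LIMSEQ[OF b r(1)] by (simp add: o_def)
    ultimately show ?case
      using elim(2) by (intro LIMSEQ_le) auto
  qed
qed

text \<open>Bounded \<open>e n\<close> lie in L2 since the measure is finite; real
  \<open>m n\<close> of modulus at most 1 make the operator a self-adjoint contraction. Density of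
  finite expansions is supplied later, by the assumption \<open>approx\<close> of
  \<open>sup_bounded_multiplier\<close>.\<close>

locale orthonormal_multiplier = finite_measure M
  for M :: "'a measure" and e :: "nat \<Rightarrow> 'a \<Rightarrow> real" and m :: "nat \<Rightarrow> real" +
  assumes e_measurable [measurable]: "e n \<in> borel_measurable M"
    and e_bounded: "\<exists>B. \<forall>x\<in>space M. \<bar>e n x\<bar> \<le> B"
    and orthonormal: "(\<integral>x. e i x * e j x \<partial>M) = (if i = j then 1 else 0)"
    and m_le_1: "\<bar>m n\<bar> \<le> 1"
begin

definition E :: "nat \<Rightarrow> 'a \<Rightarrow> complex" where
  "E n x = of_real (e n x)"

abbreviation coef :: "('a \<Rightarrow> complex) \<Rightarrow> nat \<Rightarrow> complex" where
  "coef f n \<equiv> L2_inner M f (E n)"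

definition mterm :: "('a \<Rightarrow> complex) \<Rightarrow> nat \<Rightarrow> 'a \<Rightarrow> complex" where
  "mterm f n x = of_real (m n) * coef f n * E n x"

lemma E_L2 [simp, intro]: "E n \<in> L2_space M"
proof -
  obtain B where "\<forall>x\<in>space M. \<bar>e n x\<bar> \<le> B" using e_bounded by blast
  then show ?thesis
    unfolding E_def by (intro bounded_L2[where B=B] borel_measurable_of_real AE_I2) auto
qed

lemma coef_E: "coef (E i) j = (if i = j then 1 else 0)"
proof -
  have "coef (E i) j = of_real (\<integral>x. e i x * e j x \<partial>M)"
    unfolding L2_inner_def E_def by (subst integral_complex_of_real[symmetric]) simp
  then show ?thesis by (simp add: orthonormal)
qed

definition comb :: "nat set \<Rightarrow> (nat \<Rightarrow> complex) \<Rightarrow> 'a \<Rightarrow> complex" where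
  "comb A c x = (\<Sum>i\<in>A. c i * E i x)"

lemma comb_L2 [simp, intro]: "comb A c \<in> L2_space M"
  unfolding comb_def by (intro L2_space_sum L2_space_cmult E_L2)

lemma coef_comb:
  assumes "finite A"
  shows "coef (comb A c) n = (if n \<in> A then c n else 0)"
  unfolding comb_def
  by (subst L2_inner_sum_left)
     (auto simp: L2_space_cmult L2_inner_cmult_left coef_E assms if_distrib cong: if_cong)

lemma inner_comb_left: "L2_inner M (comb A c) g = (\<Sum>i\<in>A. c i * L2_inner M (E i) g)"
  if "g \<in> L2_space M"
  unfolding comb_def using that
  by (subst L2_inner_sum_left) (auto simp: L2_space_cmult L2_inner_cmult_left)

lemma norm_comb:
  assumes "finite A"
  shows "(L2_norm M (comb A c))\<^sup>2 = (\<Sum>i\<in>A. (norm (c i))\<^sup>2)"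
proof -
  have "complex_of_real ((L2_norm M (comb A c))\<^sup>2) = (\<Sum>i\<in>A. c i * L2_inner M (E i) (comb A c))"
    unfolding L2_inner_self[symmetric] by (rule inner_comb_left) simp
  also have "\<dots> = (\<Sum>i\<in>A. c i * cnj (coef (comb A c) i))"
    by (simp add: L2_inner_cnj)
  also have "\<dots> = (\<Sum>i\<in>A. of_real ((norm (c i))\<^sup>2))"
    by (intro sum.cong refl) (simp only: coef_comb[OF assms] complex_norm_square if_True)
  also have "\<dots> = of_real (\<Sum>i\<in>A. (norm (c i))\<^sup>2)" by simp
  finally show ?thesis by (simp only: of_real_eq_iff)
qed

text \<open>With g the orthogonal projection of f onto the span of the \<open>E i\<close>, f - g is
  orthogonal to g, so its squared norm is the difference of the two sides.\<close>

lemma Bessel: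
  assumes f: "f \<in> L2_space M" and A: "finite A"
  shows "(\<Sum>i\<in>A. (norm (coef f i))\<^sup>2) \<le> (L2_norm M f)\<^sup>2"
proof -
  define S where "S = (\<Sum>i\<in>A. (norm (coef f i))\<^sup>2)"
  define g where "g = comb A (coef f)"
  have gL2: "g \<in> L2_space M" by (simp add: g_def)
  have gf: "L2_inner M g f = of_real S"
  proof -
    have "L2_inner M g f = (\<Sum>i\<in>A. coef f i * cnj (coef f i))"
      unfolding g_def using f by (simp add: inner_comb_left L2_inner_cnj)
    also have "\<dots> = of_real S"
      unfolding S_def of_real_sum by (simp only: complex_norm_square)
    finally show ?thesis .
  qed
  have fg: "L2_inner M f g = of_real S"
    using arg_cong[OF gf, of cnj] by (simp add: L2_inner_cnj)
  define h where "h = (\<lambda>x. f x - g x)"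
  have hL2: "h \<in> L2_space M" unfolding h_def using f gL2 by (rule L2_space_diff)
  have gg: "L2_inner M g g = of_real S"
    unfolding L2_inner_self unfolding g_def norm_comb[OF A] S_def ..
  have fh: "L2_inner M h f = of_real ((L2_norm M f)\<^sup>2 - S)"
    unfolding h_def using f gL2 gf by (subst L2_inner_diff_left) (auto simp: L2_inner_self)
  have gh: "L2_inner M h g = 0"
    unfolding h_def using f gL2 fg gg by (subst L2_inner_diff_left) auto
  have "of_real ((L2_norm M h)\<^sup>2) = L2_inner M h h" by (simp add: L2_inner_self)
  also have "\<dots> = L2_inner M f h - L2_inner M g h"
    using f gL2 hL2 L2_inner_diff_left[of f M g h] by (simp add: h_def)
  also have "\<dots> = cnj (L2_inner M h f) - cnj (L2_inner M h g)" by (simp add: L2_inner_cnj)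
  also have "\<dots> = of_real ((L2_norm M f)\<^sup>2 - S)" by (simp add: fh gh)
  finally have "(L2_norm M h)\<^sup>2 = (L2_norm M f)\<^sup>2 - S" by (simp only: of_real_eq_iff)
  then show ?thesis unfolding S_def[symmetric] by (metis diff_ge_0_iff_ge zero_le_power2)
qed

lemma sum_mterm: "(\<lambda>x. \<Sum>i\<in>A. mterm f i x) = comb A (\<lambda>i. of_real (m i) * coef f i)"
  by (simp add: fun_eq_iff mterm_def comb_def)

lemma mult_le: "norm (of_real (m i) * z :: complex) \<le> norm z"
  using mult_right_mono[OF m_le_1[of i], of "norm z"] by (simp add: norm_mult)

lemma norm_sum_mterm_le:
  assumes "finite A"
  shows "(L2_norm M (\<lambda>x. \<Sum>i\<in>A. mterm f i x))\<^sup>2 \<le> (\<Sum>i\<in>A. (norm (coef f i))\<^sup>2)"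
  unfolding sum_mterm norm_comb[OF assms] by (intro sum_mono power_mono mult_le) simp

text \<open>By Bessel the squared coefficients are summable; a block of the series has squared norm
  at most the matching block of that sum, so the partial sums are Cauchy.\<close>

lemma L2_sums_exist:
  assumes f: "f \<in> L2_space M"
  shows "\<exists>g. L2_sums M (mterm f) g"
proof -
  define s where "s n x = (\<Sum>i=1..n. mterm f i x)" for n x
  have s: "s n \<in> L2_space M" for n
    unfolding s_def sum_mterm by (rule comb_L2)
  have "summable (\<lambda>i. (norm (coef f i))\<^sup>2)"
    by (rule summableI_nonneg_bounded[of _ "(L2_norm M f)\<^sup>2"]) (auto intro: Bessel f)
  then have tails: "\<exists>N. \<forall>m\<ge>N. \<forall>n. norm (\<Sum>i\<in>{m..<n}. (norm (coef f i))\<^sup>2) < e" if "e > 0" for e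
    using that unfolding summable_Cauchy by blast
  have diff: "(L2_norm M (\<lambda>x. s n x - s k x))\<^sup>2 \<le> norm (\<Sum>i\<in>{Suc k..<Suc n}. (norm (coef f i))\<^sup>2)"
    if "k \<le> n" for k n
  proof -
    have "{1..n} = {1..k} \<union> {Suc k..n}" using that by auto
    then have "(\<Sum>i=1..n. mterm f i x) = (\<Sum>i=1..k. mterm f i x) + (\<Sum>i=Suc k..n. mterm f i x)" for x
      by (simp add: sum.union_disjoint)
    then have "(\<lambda>x. s n x - s k x) = (\<lambda>x. \<Sum>i=Suc k..n. mterm f i x)"
      by (simp add: s_def fun_eq_iff)
    then show ?thesis
      using norm_sum_mterm_le[of "{Suc k..n}" f]
      by (simp add: atLeastLessThanSuc_atLeastAtMost abs_of_nonneg sum_nonneg)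
  qed
  have "\<exists>g\<in>L2_space M. (\<lambda>n. L2_norm M (\<lambda>x. s n x - g x)) \<longlonglongrightarrow> 0"
  proof (rule L2_complete[OF s])
    fix e :: real assume e: "e > 0"
    then obtain N where N: "\<And>m n. m \<ge> N \<Longrightarrow> norm (\<Sum>i\<in>{m..<n}. (norm (coef f i))\<^sup>2) < e\<^sup>2"
      using tails[of "e\<^sup>2"] by auto
    have lt: "L2_norm M (\<lambda>x. s n x - s k x) < e" if "N \<le> k" "k \<le> n" for k n
    proof (rule power2_less_imp_less)
      show "(L2_norm M (\<lambda>x. s n x - s k x))\<^sup>2 < e\<^sup>2"
        using le_less_trans[OF diff N, of k n] that by simp
    qed (use e in simp)
    have "L2_norm M (\<lambda>x. s i x - s j x) < e" if "i \<ge> N" "j \<ge> N" for i j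
      using lt[of i j] lt[of j i] that L2_norm_minus_commute[of M "s i" "s j"]
      by (cases "i \<le> j") auto
    then show "\<exists>N. \<forall>i\<ge>N. \<forall>j\<ge>N. L2_norm M (\<lambda>x. s i x - s j x) < e" by blast
  qed
  then obtain g where "g \<in> L2_space M" "(\<lambda>n. L2_norm M (\<lambda>x. s n x - g x)) \<longlonglongrightarrow> 0"
    by blast
  then have "L2_sums M (mterm f) g"
    unfolding L2_sums_def s_def mterm_def by (auto intro: L2_space_cmult)
  then show ?thesis by blast
qed

end

section \<open>Extension from square-integrable to integrable functions\<close>

lemma L1_norm_nonneg [simp]: "0 \<le> L1_norm M f"
  by (simp add: L1_norm_def)

lemma L1_norm_triangle:
  assumes "integrable M f" "integrable M g"
  shows "L1_norm M (\<lambda>x. f x + g x) \<le> L1_norm M f + L1_norm M g"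
proof -
  have "L1_norm M (\<lambda>x. f x + g x) \<le> (\<integral>x. norm (f x) + norm (g x) \<partial>M)"
    unfolding L1_norm_def using assms by (intro integral_mono) (auto intro: norm_triangle_ineq)
  then show ?thesis using assms by (simp add: L1_norm_def)
qed

lemma L1_norm_triangle_diff:
  assumes "integrable M f" "integrable M g" "integrable M h"
  shows "L1_norm M (\<lambda>x. f x - h x) \<le> L1_norm M (\<lambda>x. f x - g x) + L1_norm M (\<lambda>x. g x - h x)"
  using L1_norm_triangle[of M "\<lambda>x. f x - g x" "\<lambda>x. g x - h x"] assms by simp

lemma L1_norm_minus_commute: "L1_norm M (\<lambda>x. f x - g x) = L1_norm M (\<lambda>x. g x - f x)"
  by (simp add: L1_norm_def norm_minus_commute)

lemma L1_norm_cmult: "L1_norm M (\<lambda>x. c * f x) = norm c * L1_norm M f"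
  by (simp add: L1_norm_def norm_mult)

lemma L1_norm_cong_AE:
  assumes "f \<in> borel_measurable M" "g \<in> borel_measurable M" "AE x in M. f x = g x"
  shows "L1_norm M f = L1_norm M g"
  unfolding L1_norm_def using assms by (intro integral_cong_AE) auto

lemma L1_norm_eq_0_AE:
  assumes "integrable M f" "L1_norm M f = 0"
  shows "AE x in M. f x = 0"
  using assms integral_nonneg_eq_0_iff_AE[OF integrable_norm[OF assms(1)]]
  by (simp add: L1_norm_def)

lemma L1_limit_unique:
  assumes u: "\<And>k. integrable M (u k)" and g: "integrable M g" and h: "integrable M h"
    and "(\<lambda>k. L1_norm M (\<lambda>x. u k x - g x)) \<longlonglongrightarrow> 0" "(\<lambda>k. L1_norm M (\<lambda>x. u k x - h x)) \<longlonglongrightarrow> 0"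
  shows "AE x in M. g x = h x"
proof -
  have "L1_norm M (\<lambda>x. g x - h x)
      \<le> L1_norm M (\<lambda>x. u n x - g x) + L1_norm M (\<lambda>x. u n x - h x)" for n
    using L1_norm_triangle_diff[OF g u h] by (simp add: L1_norm_minus_commute[of M g])
  moreover have "(\<lambda>n. L1_norm M (\<lambda>x. u n x - g x) + L1_norm M (\<lambda>x. u n x - h x)) \<longlonglongrightarrow> 0 + 0"
    using assms by (intro tendsto_add)
  ultimately have "L1_norm M (\<lambda>x. g x - h x) \<le> 0 + 0"
    by (intro LIMSEQ_le_const) auto
  then have "L1_norm M (\<lambda>x. g x - h x) = 0"
    by (simp add: antisym)
  with L1_norm_eq_0_AE[of M "\<lambda>x. g x - h x"] g h show ?thesis by auto
qed

text \<open>Abstract extension of an operator from L2 to L1. Linearity is assumed only almost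
  everywhere, so finite sums and differences have to be handled up to null sets.\<close>

locale L1_bounded_on_L2 = finite_measure M
  for M :: "'a measure" +
  fixes R :: "('a \<Rightarrow> complex) \<Rightarrow> 'a \<Rightarrow> complex" and C :: real
  assumes R_L2: "f \<in> L2_space M \<Longrightarrow> R f \<in> L2_space M"
    and R_linear: "f \<in> L2_space M \<Longrightarrow> g \<in> L2_space M \<Longrightarrow>
      AE x in M. R (\<lambda>y. a * f y + b * g y) x = a * R f x + b * R g x"
    and R_L1_norm: "f \<in> L2_space M \<Longrightarrow> L1_norm M (R f) \<le> C * L1_norm M f"
    and C_nonneg: "0 \<le> C"
begin

text \<open>Cuts \<open>f\<close> into the shells j <= |f| < j + 1. Every shell is bounded, hence in
  L2 where \<open>R\<close> is controlled, and the shells have disjoint supports.\<close>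

definition level :: "('a \<Rightarrow> complex) \<Rightarrow> nat \<Rightarrow> 'a \<Rightarrow> complex" where
  "level f j x = (if nat \<lfloor>norm (f x)\<rfloor> = j then f x else 0)"

definition trunc :: "('a \<Rightarrow> complex) \<Rightarrow> nat \<Rightarrow> 'a \<Rightarrow> complex" where
  "trunc f k x = (\<Sum>j<k. level f j x)"

text \<open>For integrable \<open>f\<close> the series converges absolutely almost everywhere, because the L1 norms
  of the level pieces add up to that of \<open>f\<close>.\<close>

definition T :: "('a \<Rightarrow> complex) \<Rightarrow> 'a \<Rightarrow> complex" where
  "T f x = (\<Sum>j. R (level f j) x)"

lemma trunc_eq: "trunc f k x = (if nat \<lfloor>norm (f x)\<rfloor> < k then f x else 0)"
  unfolding trunc_def level_def by (simp add: sum.delta')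

lemma level_L2:
  assumes [measurable]: "f \<in> borel_measurable M"
  shows "level f j \<in> L2_space M"
proof (rule bounded_L2)
  show "level f j \<in> borel_measurable M" unfolding level_def by measurable
  have "norm (level f j x) \<le> real j + 1" for x
    unfolding level_def using real_of_int_floor_add_one_gt[of "norm (f x)"]
    by (cases "nat \<lfloor>norm (f x)\<rfloor> = j") (auto simp: of_nat_nat)
  then show "AE x in M. norm (level f j x) \<le> real j + 1" by simp
qed

lemma trunc_L2: "f \<in> borel_measurable M \<Longrightarrow> trunc f k \<in> L2_space M"
  unfolding trunc_def by (intro L2_space_sum level_L2)

lemma trunc_tendsto:
  assumes f: "integrable M f"
  shows "(\<lambda>k. L1_norm M (\<lambda>x. trunc f k x - f x)) \<longlonglongrightarrow> 0"
proof -
  have [measurable]: "f \<in> borel_measurable M" "trunc f k \<in> borel_measurable M" for k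
    using f trunc_L2[THEN L2_space_measurable] by auto
  have "(\<lambda>k. \<integral>x. norm (trunc f k x - f x) \<partial>M) \<longlonglongrightarrow> (\<integral>x. 0 \<partial>M)"
  proof (rule integral_dominated_convergence[where w="\<lambda>x. norm (f x)"])
    show "AE x in M. (\<lambda>k. norm (trunc f k x - f x)) \<longlonglongrightarrow> 0"
    proof (rule AE_I2, rule tendsto_eventually)
      fix x
      show "\<forall>\<^sub>F k in sequentially. norm (trunc f k x - f x) = 0"
        using eventually_gt_at_top[of "nat \<lfloor>norm (f x)\<rfloor>"]
        by eventually_elim (simp add: trunc_eq)
    qed
    show "AE x in M. norm (norm (trunc f k x - f x)) \<le> norm (f x)" for k
      by (simp add: trunc_eq)
  qed (use f in auto)
  then show ?thesis by (simp add: L1_norm_def)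
qed

lemma R_sum:
  fixes n :: nat
  assumes "\<And>i. i < n \<Longrightarrow> f i \<in> L2_space M"
  shows "AE x in M. R (\<lambda>x. \<Sum>i<n. f i x) x = (\<Sum>i<n. R (f i) x)"
  using assms
proof (induction n)
  case 0
  show ?case using R_linear[of "\<lambda>x. 0" "\<lambda>x. 0" 0 0] by simp
next
  case (Suc n)
  have "AE x in M. R (\<lambda>x. 1 * (\<Sum>i<n. f i x) + 1 * f n x) x = 1 * R (\<lambda>x. \<Sum>i<n. f i x) x + 1 * R (f n) x"
    using Suc.prems by (intro R_linear L2_space_sum) auto
  then show ?case using Suc.IH[OF Suc.prems] by (auto simp: less_Suc_eq)
qed

lemma R_integrable: "f \<in> L2_space M \<Longrightarrow> integrable M (R f)"
  by (intro L2_integrable R_L2)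

lemma T_trunc:
  assumes f: "integrable M f"
  shows "integrable M (T f)" and "(\<lambda>k. L1_norm M (\<lambda>x. R (trunc f k) x - T f x)) \<longlonglongrightarrow> 0"
proof -
  have [measurable]: "f \<in> borel_measurable M" using f by auto
  define r where "r j = R (level f j)" for j
  have r: "integrable M (r j)" for j
    unfolding r_def by (intro R_integrable level_L2) auto
  have lev: "integrable M (level f j)" for j
    by (intro L2_integrable level_L2) auto
  have "summable (\<lambda>j. L1_norm M (level f j))"
  proof (rule summableI_nonneg_bounded)
    fix n
    have "(\<Sum>j<n. L1_norm M (level f j)) = (\<integral>x. (\<Sum>j<n. norm (level f j x)) \<partial>M)"
      unfolding L1_norm_def using lev by (subst Bochner_Integration.integral_sum) auto
    also have "\<dots> \<le> (\<integral>x. norm (f x) \<partial>M)"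
    proof (rule integral_mono)
      show "integrable M (\<lambda>x. \<Sum>j<n. norm (level f j x))" using lev by auto
      show "(\<Sum>j<n. norm (level f j x)) \<le> norm (f x)" for x
      proof -
        have "(\<Sum>j<n. norm (level f j x)) = (\<Sum>j<n. if nat \<lfloor>norm (f x)\<rfloor> = j then norm (f x) else 0)"
          unfolding level_def by (intro sum.cong) auto
        then show ?thesis by (simp add: sum.delta')
      qed
    qed (use f in auto)
    finally show "(\<Sum>j<n. L1_norm M (level f j)) \<le> L1_norm M f" by (simp add: L1_norm_def)
  qed simp
  then have sum: "summable (\<lambda>j. \<integral>x. norm (r j x) \<partial>M)"
  proof (rule summable_comparison_test'[OF summable_mult[of _ C]])
    show "norm (\<integral>x. norm (r j x) \<partial>M) \<le> C * L1_norm M (level f j)" for j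
      using R_L1_norm[OF level_L2[of f j]] by (simp add: r_def L1_norm_def)
  qed
  have ae: "AE x in M. summable (\<lambda>j. norm (r j x))"
    by (rule AE_summable_norm[OF r sum])
  have T_eq: "T f = (\<lambda>x. \<Sum>j. r j x)" by (simp add: T_def r_def fun_eq_iff)
  show T: "integrable M (T f)"
    unfolding T_eq by (rule integrable_suminf[OF r ae sum])
  have w: "integrable M (\<lambda>x. \<Sum>j. norm (r j x))"
    by (rule integrable_suminf) (use r ae sum in auto)
  have [measurable]: "r j \<in> borel_measurable M" "T f \<in> borel_measurable M" for j
    using r T by auto
  have "(\<lambda>k. \<integral>x. norm ((\<Sum>j<k. r j x) - T f x) \<partial>M) \<longlonglongrightarrow> (\<integral>x. 0 \<partial>M)"
  \<comment> \<open>Majorant: one copy of the sum of norms for the partial sum, one for its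
    limit.\<close>
  proof (rule integral_dominated_convergence[where w="\<lambda>x. 2 * (\<Sum>j. norm (r j x))"])
    show "AE x in M. (\<lambda>k. norm ((\<Sum>j<k. r j x) - T f x)) \<longlonglongrightarrow> 0"
      using ae
    proof eventually_elim
      case (elim x)
      then have "(\<lambda>j. r j x) sums T f x"
        unfolding T_eq by (rule summable_sums[OF summable_norm_cancel])
      then show ?case unfolding sums_def by (intro tendsto_norm_zero LIM_zero)
    qed
    show "AE x in M. norm (norm ((\<Sum>j<k. r j x) - T f x)) \<le> 2 * (\<Sum>j. norm (r j x))" for k
      using ae
    proof eventually_elim
      case (elim x)
      have "norm (\<Sum>j<k. r j x) \<le> (\<Sum>j<k. norm (r j x))" by (rule norm_sum)
      also have "\<dots> \<le> (\<Sum>j. norm (r j x))" by (rule sum_le_suminf[OF elim]) auto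
      finally have "norm (\<Sum>j<k. r j x) \<le> (\<Sum>j. norm (r j x))" .
      moreover have "norm (T f x) \<le> (\<Sum>j. norm (r j x))"
        unfolding T_eq by (rule summable_norm[OF elim])
      ultimately show ?case
        using norm_triangle_ineq4[of "\<Sum>j<k. r j x" "T f x"] by simp
    qed
  qed (use w in auto)
  moreover have "L1_norm M (\<lambda>x. R (trunc f k) x - T f x) = (\<integral>x. norm ((\<Sum>j<k. r j x) - T f x) \<partial>M)" for k
    unfolding L1_norm_def
  proof (rule integral_cong_AE)
    have [measurable]: "R (trunc f k) \<in> borel_measurable M"
      by (rule L2_space_measurable[OF R_L2[OF trunc_L2]]) measurable
    show "(\<lambda>x. norm (R (trunc f k) x - T f x)) \<in> borel_measurable M" by measurable
    show "(\<lambda>x. norm ((\<Sum>j<k. r j x) - T f x)) \<in> borel_measurable M" by measurable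
    have "trunc f k = (\<lambda>x. \<Sum>j<k. level f j x)" by (simp add: trunc_def fun_eq_iff)
    then have "AE x in M. R (trunc f k) x = (\<Sum>j<k. r j x)"
      using R_sum[of k "level f"] level_L2[of f] by (simp add: r_def)
    then show "AE x in M. norm (R (trunc f k) x - T f x) = norm ((\<Sum>j<k. r j x) - T f x)"
      by eventually_elim simp
  qed
  ultimately show "(\<lambda>k. L1_norm M (\<lambda>x. R (trunc f k) x - T f x)) \<longlonglongrightarrow> 0" by simp
qed

lemma R_diff_L1_norm:
  assumes f: "f \<in> L2_space M" and g: "g \<in> L2_space M"
  shows "L1_norm M (\<lambda>x. R f x - R g x) \<le> C * L1_norm M (\<lambda>x. f x - g x)"
proof -
  have "AE x in M. R (\<lambda>y. 1 * f y + (-1) * g y) x = 1 * R f x + (-1) * R g x"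
    by (rule R_linear[OF f g])
  then have "L1_norm M (\<lambda>x. R f x - R g x) = L1_norm M (R (\<lambda>x. f x - g x))"
    using f g by (intro L1_norm_cong_AE) (auto intro!: L2_space_measurable L2_space_diff R_L2)
  also have "\<dots> \<le> C * L1_norm M (\<lambda>x. f x - g x)"
    by (intro R_L1_norm L2_space_diff f g)
  finally show ?thesis .
qed

text \<open>Any L2 sequence tending to f in L1, not just the truncations, computes
  \<open>T f\<close>: by linearity and the L1 bound its images stay close to those of the
  truncations. Agreement with \<open>R\<close> and linearity of \<open>T\<close> are read off by
  choosing the sequence.\<close>

lemma T_tendsto:
  assumes f: "integrable M f" and h: "\<And>k. h k \<in> L2_space M"
    and lim: "(\<lambda>k. L1_norm M (\<lambda>x. h k x - f x)) \<longlonglongrightarrow> 0"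
  shows "(\<lambda>k. L1_norm M (\<lambda>x. R (h k) x - T f x)) \<longlonglongrightarrow> 0"
proof (rule tendsto_sandwich[where f="\<lambda>_. 0", OF always_eventually always_eventually])
  let ?u = "\<lambda>k. C * (L1_norm M (\<lambda>x. h k x - f x) + L1_norm M (\<lambda>x. trunc f k x - f x))
      + L1_norm M (\<lambda>x. R (trunc f k) x - T f x)"
  have tr: "trunc f k \<in> L2_space M" for k using f by (intro trunc_L2) auto
  have "?u \<longlonglongrightarrow> C * (0 + 0) + 0"
    by (intro tendsto_intros lim trunc_tendsto T_trunc f)
  then show "?u \<longlonglongrightarrow> 0" by simp
  show "\<forall>k. L1_norm M (\<lambda>x. R (h k) x - T f x) \<le> ?u k"
  proof
    fix k
    have "L1_norm M (\<lambda>x. R (h k) x - T f x)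
        \<le> L1_norm M (\<lambda>x. R (h k) x - R (trunc f k) x) + L1_norm M (\<lambda>x. R (trunc f k) x - T f x)"
      using h tr f by (intro L1_norm_triangle_diff R_integrable T_trunc)
    moreover have "L1_norm M (\<lambda>x. R (h k) x - R (trunc f k) x) \<le> C * L1_norm M (\<lambda>x. h k x - trunc f k x)"
      using h tr by (rule R_diff_L1_norm)
    moreover have "L1_norm M (\<lambda>x. h k x - trunc f k x)
        \<le> L1_norm M (\<lambda>x. h k x - f x) + L1_norm M (\<lambda>x. trunc f k x - f x)"
      using L1_norm_triangle_diff[OF L2_integrable[OF h] f L2_integrable[OF tr], of k k]
      by (simp add: L1_norm_minus_commute[of M f])
    moreover from calculation have "C * L1_norm M (\<lambda>x. h k x - trunc f k x)
        \<le> C * (L1_norm M (\<lambda>x. h k x - f x) + L1_norm M (\<lambda>x. trunc f k x - f x))"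
      using calculation by (intro mult_left_mono C_nonneg) simp
    ultimately show "L1_norm M (\<lambda>x. R (h k) x - T f x) \<le> ?u k"
      by linarith
  qed
qed auto

lemma T_eq_R:
  assumes f: "f \<in> L2_space M"
  shows "AE x in M. T f x = R f x"
proof (rule L1_limit_unique[where u="\<lambda>k. R f"])
  \<comment> \<open>Here the approximating sequence is constantly \<open>f\<close>.\<close>
  show "(\<lambda>k. L1_norm M (\<lambda>x. R f x - T f x)) \<longlonglongrightarrow> 0"
    by (rule T_tendsto) (use f L2_integrable[OF f] in \<open>auto simp: L1_norm_def\<close>)
qed (use R_integrable[OF f] T_trunc(1)[OF L2_integrable[OF f]] in \<open>auto simp: L1_norm_def\<close>)

lemma T_linear:
  assumes f: "integrable M f" and g: "integrable M g"
  shows "AE x in M. T (\<lambda>y. a * f y + b * g y) x = a * T f x + b * T g x"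
proof -
  \<comment> \<open>Truncation is not linear, so the combination of the truncations is used in place
    of the truncation of the combination.\<close>
  define h where "h k x = a * trunc f k x + b * trunc g k x" for k x
  have fL2: "trunc f k \<in> L2_space M" and gL2: "trunc g k \<in> L2_space M" for k
    using f g by (auto intro!: trunc_L2)
  have hL2: "h k \<in> L2_space M" for k
    unfolding h_def using fL2 gL2 by (intro L2_space_add L2_space_cmult)
  define S where "S = (\<lambda>x. a * T f x + b * T g x)"
  have Tf: "integrable M (T f)" and Tg: "integrable M (T g)" using T_trunc f g by auto
  have lin: "L1_norm M (\<lambda>x. (a * u x + b * v x) - (a * s x + b * t x))
      \<le> norm a * L1_norm M (\<lambda>x. u x - s x) + norm b * L1_norm M (\<lambda>x. v x - t x)"
    if "integrable M u" "integrable M v" "integrable M s" "integrable M t" for u v s t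
  proof -
    have "(\<lambda>x. (a * u x + b * v x) - (a * s x + b * t x)) = (\<lambda>x. a * (u x - s x) + b * (v x - t x))"
      by (simp add: algebra_simps)
    with L1_norm_triangle[of M "\<lambda>x. a * (u x - s x)" "\<lambda>x. b * (v x - t x)"] that
    show ?thesis by (simp add: L1_norm_cmult)
  qed
  have lim0: "(\<lambda>k. norm a * p k + norm b * q k) \<longlonglongrightarrow> 0" if "p \<longlonglongrightarrow> 0" "q \<longlonglongrightarrow> 0" for p q :: "nat \<Rightarrow> real"
    using tendsto_add[OF tendsto_mult_right_zero[OF that(1)] tendsto_mult_right_zero[OF that(2)]]
    by simp
  have "AE x in M. T (\<lambda>y. a * f y + b * g y) x = S x"
  proof (rule L1_limit_unique[where u="\<lambda>k. R (h k)"])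
    show "integrable M (R (h k))" for k by (rule R_integrable[OF hL2])
    show "integrable M (T (\<lambda>y. a * f y + b * g y))" using f g by (intro T_trunc) auto
    show "integrable M S" unfolding S_def using Tf Tg by auto
    show "(\<lambda>k. L1_norm M (\<lambda>x. R (h k) x - T (\<lambda>y. a * f y + b * g y) x)) \<longlonglongrightarrow> 0"
    proof (rule T_tendsto[OF _ hL2])
      show "integrable M (\<lambda>y. a * f y + b * g y)" using f g by auto
      show "(\<lambda>k. L1_norm M (\<lambda>x. h k x - (a * f x + b * g x))) \<longlonglongrightarrow> 0"
        unfolding h_def
        by (rule tendsto_sandwich[where f="\<lambda>_. 0", OF always_eventually always_eventually
              tendsto_const lim0[OF trunc_tendsto[OF f] trunc_tendsto[OF g]]])
           (auto intro!: lin L2_integrable fL2 gL2 f g)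
    qed
    have eq: "L1_norm M (\<lambda>x. R (h k) x - S x) = L1_norm M (\<lambda>x. (a * R (trunc f k) x + b * R (trunc g k) x) - S x)" for k
    proof (rule L1_norm_cong_AE)
      have [measurable]: "S \<in> borel_measurable M" "R (h k) \<in> borel_measurable M"
        "R (trunc f k) \<in> borel_measurable M" "R (trunc g k) \<in> borel_measurable M"
        using Tf Tg by (auto simp: S_def intro!: L2_space_measurable R_L2 hL2 fL2 gL2)
      show "(\<lambda>x. R (h k) x - S x) \<in> borel_measurable M" by measurable
      show "(\<lambda>x. (a * R (trunc f k) x + b * R (trunc g k) x) - S x) \<in> borel_measurable M" by measurable
      show "AE x in M. R (h k) x - S x = (a * R (trunc f k) x + b * R (trunc g k) x) - S x"
        using R_linear[OF fL2[of k] gL2[of k], of a b] unfolding h_def by eventually_elim simp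
    qed
    show "(\<lambda>k. L1_norm M (\<lambda>x. R (h k) x - S x)) \<longlonglongrightarrow> 0"
      unfolding eq unfolding S_def
      by (rule tendsto_sandwich[where f="\<lambda>_. 0", OF always_eventually always_eventually
            tendsto_const lim0[OF T_trunc(2)[OF f] T_trunc(2)[OF g]]])
         (auto intro!: lin R_integrable fL2 gL2 Tf Tg)
  qed
  then show ?thesis by (simp add: S_def)
qed

lemma T_L1_norm:
  assumes f: "integrable M f"
  shows "L1_norm M (T f) \<le> C * L1_norm M f"
proof (rule LIMSEQ_le_const)
  have tr: "trunc f k \<in> L2_space M" for k using f by (intro trunc_L2) auto
  have "(\<lambda>k. L1_norm M (\<lambda>x. R (trunc f k) x - T f x) + C * L1_norm M f) \<longlonglongrightarrow> 0 + C * L1_norm M f"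
    by (intro tendsto_intros T_trunc f)
  then show "(\<lambda>k. L1_norm M (\<lambda>x. R (trunc f k) x - T f x) + C * L1_norm M f) \<longlonglongrightarrow> C * L1_norm M f"
    by simp
  have "L1_norm M (T f) \<le> L1_norm M (\<lambda>x. R (trunc f k) x - T f x) + C * L1_norm M f" for k
  proof -
    have "L1_norm M (T f) \<le> L1_norm M (\<lambda>x. T f x - R (trunc f k) x) + L1_norm M (R (trunc f k))"
      using L1_norm_triangle[of M "\<lambda>x. T f x - R (trunc f k) x" "R (trunc f k)"]
        T_trunc(1)[OF f] R_integrable[OF tr] by simp
    also have "L1_norm M (R (trunc f k)) \<le> C * L1_norm M (trunc f k)"
      by (rule R_L1_norm[OF tr])
    also have "C * L1_norm M (trunc f k) \<le> C * L1_norm M f"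
    proof (intro mult_left_mono C_nonneg)
      show "L1_norm M (trunc f k) \<le> L1_norm M f"
        unfolding L1_norm_def using integrable_norm[OF L2_integrable[OF tr]] integrable_norm[OF f]
        by (rule integral_mono) (simp add: trunc_eq)
    qed
    finally show ?thesis by (simp add: L1_norm_minus_commute)
  qed
  then show "\<exists>N. \<forall>n\<ge>N. L1_norm M (T f) \<le> L1_norm M (\<lambda>x. R (trunc f n) x - T f x) + C * L1_norm M f"
    by blast
qed

theorem bounded_L1_extension:
  "\<exists>T. bounded_operator_on M (L1_space M) (L1_norm M) T \<and>
    (\<forall>f\<in>L2_space M. AE x in M. T f x = R f x)"
  using T_trunc(1) T_linear T_L1_norm T_eq_R
  unfolding bounded_operator_on_def L1_space_def by blast

end

section \<open>Multipliers that are bounded in the supremum norm on finite expansions\<close>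

text \<open>\<open>R\<close> is fixed only through the series of its values, which starts at n = 1;
  \<open>m_0\<close> makes the missing term equal to 0. \<open>approx\<close> joins the two facts
  needed about a bounded f: finite expansions near f in L2, and a uniform bound on their
  images.\<close>

locale sup_bounded_multiplier = orthonormal_multiplier M e m
  for M :: "'a measure" and e m +
  fixes R :: "('a \<Rightarrow> complex) \<Rightarrow> 'a \<Rightarrow> complex" and C :: real
  assumes R_sums: "f \<in> L2_space M \<Longrightarrow> L2_sums M (mterm f) (R f)"
    and m_0: "m 0 = 0"
    and C_nonneg: "0 \<le> C"
    and approx: "f \<in> borel_measurable M \<Longrightarrow> AE x in M. norm (f x) \<le> B \<Longrightarrow> 0 \<le> B \<Longrightarrow> 0 < \<epsilon> \<Longrightarrow>
      \<exists>d c. L2_norm M (\<lambda>x. comb {..d} c x - f x) \<le> \<epsilon> \<and>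
        (AE x in M. norm (comb {..d} (\<lambda>i. of_real (m i) * c i) x) \<le> C * (B + \<epsilon>))"
begin

lemma R_L2: "f \<in> L2_space M \<Longrightarrow> R f \<in> L2_space M"
  using R_sums by (auto simp: L2_sums_def)

lemma R_linear:
  assumes f: "f \<in> L2_space M" and g: "g \<in> L2_space M"
  shows "AE x in M. R (\<lambda>y. a * f y + b * g y) x = a * R f x + b * R g x"
proof (rule L2_sums_uniqueD)
  let ?h = "\<lambda>y. a * f y + b * g y"
  show "L2_sums M (mterm ?h) (R ?h)"
    by (intro R_sums L2_space_add L2_space_cmult f g)
  have "coef ?h n = a * coef f n + b * coef g n" for n
    using f g by (simp add: L2_inner_add_left L2_space_cmult L2_inner_cmult_left)
  then have "mterm ?h = (\<lambda>n x. a * mterm f n x + b * mterm g n x)"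
    by (simp add: mterm_def fun_eq_iff algebra_simps)
  then show "L2_sums M (mterm ?h) (\<lambda>x. a * R f x + b * R g x)"
    using L2_sums_linear[OF R_sums[OF f] R_sums[OF g], of a b] by simp
qed

lemma mterm_L2: "mterm f n \<in> L2_space M"
  using L2_space_cmult[OF E_L2] by (simp add: mterm_def[abs_def])

lemma partial_sum_L2: "(\<lambda>x. \<Sum>i=1..n. mterm f i x) \<in> L2_space M"
  unfolding sum_mterm by (rule comb_L2)

lemma partial_sum_tendsto:
  "f \<in> L2_space M \<Longrightarrow> (\<lambda>n. L2_norm M (\<lambda>x. (\<Sum>i=1..n. mterm f i x) - R f x)) \<longlonglongrightarrow> 0"
  using R_sums by (simp add: L2_sums_def)

text \<open>Bessel bounds each partial sum by the norm of f, and the partial sums tend to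
  \<open>R f\<close>.\<close>

lemma R_norm_le:
  assumes f: "f \<in> L2_space M"
  shows "L2_norm M (R f) \<le> L2_norm M f"
proof (rule LIMSEQ_le_const)
  let ?s = "\<lambda>n x. \<Sum>i=1..n. mterm f i x"
  have "(\<lambda>n. L2_norm M (\<lambda>x. ?s n x - R f x) + L2_norm M f) \<longlonglongrightarrow> 0 + L2_norm M f"
    by (intro tendsto_intros partial_sum_tendsto f)
  then show "(\<lambda>n. L2_norm M (\<lambda>x. ?s n x - R f x) + L2_norm M f) \<longlonglongrightarrow> L2_norm M f"
    by simp
  have "L2_norm M (R f) \<le> L2_norm M (\<lambda>x. ?s n x - R f x) + L2_norm M f" for n
  proof -
    have s: "?s n \<in> L2_space M" by (rule partial_sum_L2)
    have "(L2_norm M (?s n))\<^sup>2 \<le> (L2_norm M f)\<^sup>2"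
      by (rule order_trans[OF norm_sum_mterm_le Bessel[OF f]]) auto
    then have "L2_norm M (?s n) \<le> L2_norm M f" by (rule power2_le_imp_le) simp
    moreover have "L2_norm M (R f) \<le> L2_norm M (\<lambda>x. R f x - ?s n x) + L2_norm M (?s n)"
      using L2_norm_triangle[OF L2_space_diff[OF R_L2[OF f] s] s] by simp
    ultimately show ?thesis by (simp add: L2_norm_minus_commute[of M "R f"])
  qed
  then show "\<exists>N. \<forall>n\<ge>N. L2_norm M (R f) \<le> L2_norm M (\<lambda>x. ?s n x - R f x) + L2_norm M f"
    by blast
qed

lemma R_comb:
  "AE x in M. R (comb {..d} c) x = comb {..d} (\<lambda>i. of_real (m i) * c i) x"
proof (rule L2_sums_uniqueD[OF R_sums])
  let ?h = "comb {..d} (\<lambda>i. of_real (m i) * c i)"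
  have "(\<Sum>i=1..n. mterm (comb {..d} c) i x) = ?h x" if "n \<ge> d" for n x
  proof -
    \<comment> \<open>The term i = 0 may be added since \<open>m 0 = 0\<close>; the terms beyond
      \<open>d\<close> vanish by orthonormality.\<close>
    have "(\<Sum>i=1..n. mterm (comb {..d} c) i x) = (\<Sum>i\<le>n. mterm (comb {..d} c) i x)"
      by (intro sum.mono_neutral_left) (auto simp: mterm_def m_0 not_le Suc_le_eq)
    also have "\<dots> = ?h x"
      unfolding comb_def[of _ "\<lambda>i. of_real (m i) * c i"] using that
      by (intro sum.mono_neutral_cong_right) (auto simp: mterm_def coef_comb)
    finally show ?thesis .
  qed
  then have "\<forall>\<^sub>F n in sequentially. L2_norm M (\<lambda>x. (\<Sum>i=1..n. mterm (comb {..d} c) i x) - ?h x) = 0"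
    by (intro eventually_sequentiallyI[of d]) (simp add: L2_norm_def)
  then have "(\<lambda>n. L2_norm M (\<lambda>x. (\<Sum>i=1..n. mterm (comb {..d} c) i x) - ?h x)) \<longlonglongrightarrow> 0"
    by (rule tendsto_eventually)
  then show "L2_sums M (mterm (comb {..d} c)) ?h"
    unfolding L2_sums_def by (simp add: mterm_L2)
qed simp

lemma R_diff_norm_le:
  assumes f: "f \<in> L2_space M" and g: "g \<in> L2_space M"
  shows "L2_norm M (\<lambda>x. R f x - R g x) \<le> L2_norm M (\<lambda>x. f x - g x)"
proof -
  have "AE x in M. R (\<lambda>y. 1 * f y + (-1) * g y) x = 1 * R f x + (-1) * R g x"
    by (rule R_linear[OF f g])
  then have "L2_norm M (\<lambda>x. R f x - R g x) = L2_norm M (R (\<lambda>x. f x - g x))"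
    unfolding L2_norm_def using f g R_L2[OF f] R_L2[OF g] R_L2[OF L2_space_diff[OF f g]]
    by (intro arg_cong[where f=sqrt] integral_cong_AE) (auto dest!: L2_space_measurable)
  also have "\<dots> \<le> L2_norm M (\<lambda>x. f x - g x)"
    by (intro R_norm_le L2_space_diff f g)
  finally show ?thesis .
qed

text \<open>\<open>R\<close> is a contraction in L2, so the images of expansions approximating f
  within 1/(n + 1) converge to \<open>R f\<close> in L2, and their almost everywhere bounds tend to
  C * B.\<close>

lemma R_sup_le:
  assumes f: "f \<in> borel_measurable M" and B: "AE x in M. norm (f x) \<le> B" "0 \<le> B"
  shows "AE x in M. norm (R f x) \<le> C * B"
proof -
  have fL2: "f \<in> L2_space M" by (rule bounded_L2[OF f B(1)])
  define P where "P n d c \<longleftrightarrow> L2_norm M (\<lambda>x. comb {..d} c x - f x) \<le> inverse (real (Suc n)) \<and>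
      (AE x in M. norm (comb {..d} (\<lambda>i. of_real (m i) * c i) x) \<le> C * (B + inverse (real (Suc n))))"
    for n d c
  have "\<exists>d c. P n d c" for n
    unfolding P_def by (rule approx[OF f B]) simp
  then obtain d c where dc: "\<And>n. P n (d n) (c n)" by metis
  show ?thesis
  proof (rule L2_tendsto_AE_bound)
    show "R (comb {..d n} (c n)) \<in> L2_space M" for n by (intro R_L2 comb_L2)
    show "R f \<in> L2_space M" by (rule R_L2[OF fL2])
    show "(\<lambda>n. L2_norm M (\<lambda>x. R (comb {..d n} (c n)) x - R f x)) \<longlonglongrightarrow> 0"
    proof (rule tendsto_sandwich[where f="\<lambda>_. 0", OF always_eventually always_eventually
          tendsto_const LIMSEQ_inverse_real_of_nat])
      show "\<forall>n. L2_norm M (\<lambda>x. R (comb {..d n} (c n)) x - R f x) \<le> inverse (real (Suc n))"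
        using order_trans[OF R_diff_norm_le[OF comb_L2 fL2]] dc[unfolded P_def] by blast
    qed auto
    show "AE x in M. norm (R (comb {..d n} (c n)) x) \<le> C * (B + inverse (real (Suc n)))" for n
      using dc[of n, unfolded P_def, THEN conjunct2] R_comb[of "d n" "c n"]
      by eventually_elim simp
    have "(\<lambda>n. C * (B + inverse (real (Suc n)))) \<longlonglongrightarrow> C * (B + 0)"
      by (intro tendsto_intros LIMSEQ_inverse_real_of_nat)
    then show "(\<lambda>n. C * (B + inverse (real (Suc n)))) \<longlonglongrightarrow> C * B" by simp
  qed
qed

text \<open>True for partial sums because the multipliers are real; both sides are limits of such
  inner products.\<close>

lemma R_selfadjoint:
  assumes f: "f \<in> L2_space M" and h: "h \<in> L2_space M"
  shows "L2_inner M (R f) h = L2_inner M f (R h)"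
proof (rule LIMSEQ_unique)
  let ?s = "\<lambda>f n x. \<Sum>i=1..n. mterm f i x"
  show "(\<lambda>n. L2_inner M (?s f n) h) \<longlonglongrightarrow> L2_inner M (R f) h"
    by (intro L2_inner_tendsto_left partial_sum_L2 R_L2 f h partial_sum_tendsto)
  have "(\<lambda>n. cnj (L2_inner M (?s h n) f)) \<longlonglongrightarrow> cnj (L2_inner M (R h) f)"
    by (intro tendsto_cnj L2_inner_tendsto_left partial_sum_L2 R_L2 f h partial_sum_tendsto)
  moreover have "cnj (L2_inner M (?s h n) f) = L2_inner M (?s f n) h" for n
  proof -
    have "L2_inner M (E i) h = cnj (coef h i)" "L2_inner M (E i) f = cnj (coef f i)" for i
      by (simp_all add: L2_inner_cnj)
    then show ?thesis
      unfolding sum_mterm inner_comb_left[OF f] inner_comb_left[OF h] by (simp add: mult_ac)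
  qed
  ultimately show "(\<lambda>n. L2_inner M (?s f n) h) \<longlonglongrightarrow> L2_inner M f (R h)"
    by (simp add: L2_inner_cnj)
qed

text \<open>Duality: testing \<open>R f\<close> against its own sign h, with |h| <= 1, moves the
  operator onto h, where the supremum bound applies.\<close>

lemma R_L1_norm:
  assumes f: "f \<in> L2_space M"
  shows "L1_norm M (R f) \<le> C * L1_norm M f"
proof -
  define h where "h = (\<lambda>x. sgn (R f x))"
  have Rf: "R f \<in> L2_space M" by (rule R_L2[OF f])
  note [measurable] = L2_space_measurable[OF Rf]
  have hm [measurable]: "h \<in> borel_measurable M" unfolding h_def sgn_div_norm by measurable
  have hb: "AE x in M. norm (h x) \<le> 1" by (simp add: h_def norm_sgn)
  have h: "h \<in> L2_space M" by (rule bounded_L2[OF hm hb])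
  have Rh: "AE x in M. norm (R h x) \<le> C"
    using R_sup_le[OF hm hb] by simp
  have "R f x * cnj (h x) = complex_of_real (norm (R f x))" for x
  proof -
    have "R f x * cnj (h x) = (R f x * cnj (R f x)) / of_real (norm (R f x))"
      by (simp add: h_def sgn_div_norm scaleR_conv_of_real field_simps)
    also have "\<dots> = of_real (norm (R f x))"
      by (simp add: complex_norm_square[symmetric] power2_eq_square)
    finally show ?thesis .
  qed
  then have "complex_of_real (L1_norm M (R f)) = L2_inner M (R f) h"
    by (simp add: L2_inner_def L1_norm_def)
  then have "L1_norm M (R f) = norm (L2_inner M f (R h))"
    using R_selfadjoint[OF f h] norm_of_real[of "L1_norm M (R f)", where 'a=complex] by simp
  also have "\<dots> \<le> (\<integral>x. norm (f x * cnj (R h x)) \<partial>M)"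
    unfolding L2_inner_def by (rule integral_norm_bound)
  also have "\<dots> \<le> (\<integral>x. C * norm (f x) \<partial>M)"
  proof (rule integral_mono_AE)
    show "integrable M (\<lambda>x. norm (f x * cnj (R h x)))"
      by (intro integrable_norm L2_inner_integrable f R_L2 h)
    show "integrable M (\<lambda>x. C * norm (f x))" using L2_integrable[OF f] by auto
    show "AE x in M. norm (f x * cnj (R h x)) \<le> C * norm (f x)"
      using Rh
    proof eventually_elim
      case (elim x)
      then show ?case using mult_right_mono[OF elim, of "norm (f x)"] by (simp add: norm_mult mult.commute)
    qed
  qed
  also have "\<dots> = C * L1_norm M f" by (simp add: L1_norm_def)
  finally show ?thesis .
qed

sublocale L1_bounded_on_L2 M R C
  by unfold_locales (use R_L2 R_linear R_L1_norm C_nonneg in auto)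

end

section \<open>The Jacobi operator on polynomials\<close>

text \<open>Polynomials are taken in the variable \<open>y = (cos \<theta> - 1) / 2\<close>, which ranges over \<open>[-1, 0]\<close>;
  \<open>jop\<close> is the operator \<open>\<delta>\<^sup>* \<delta>\<close> in this variable.\<close>

definition jop :: "real \<Rightarrow> real \<Rightarrow> real poly \<Rightarrow> real poly" where
  "jop \<alpha> \<beta> q = [:0, 1, 1:] * pderiv (pderiv q) + [:\<alpha> + 1, \<alpha> + \<beta> + 2:] * pderiv q"

lemma poly_jop:
  "poly (jop \<alpha> \<beta> q) y = y * (1 + y) * poly (pderiv (pderiv q)) y
     + (\<alpha> + 1 + (\<alpha> + \<beta> + 2) * y) * poly (pderiv q) y"
  by (simp add: jop_def algebra_simps)

lemma jop_smult: "jop \<alpha> \<beta> (smult c q) = smult c (jop \<alpha> \<beta> q)"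
  by (simp add: jop_def pderiv_smult smult_add_right)

text \<open>On monomials the operator has only a diagonal and one neighbouring entry. The diagonal
  shows the eigenvalues, and the equation for an eigenvector becomes a two-term recursion between
  coefficients.\<close>

lemma coeff_jop:
  "coeff (jop \<alpha> \<beta> q) k = real k * (real k + \<alpha> + \<beta> + 1) * coeff q k
     + (real k + 1) * (real k + \<alpha> + 1) * coeff q (Suc k)"
proof (cases k)
  case 0
  then show ?thesis by (simp add: jop_def coeff_pderiv algebra_simps)
next
  case (Suc j)
  then show ?thesis
    by (cases j) (simp_all add: jop_def coeff_pderiv coeff_pCons algebra_simps)
qed

lemma jop_add: "jop \<alpha> \<beta> (p + q) = jop \<alpha> \<beta> p + jop \<alpha> \<beta> q"
  by (rule poly_eqI) (simp add: coeff_jop algebra_simps)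

lemma jop_0 [simp]: "jop \<alpha> \<beta> 0 = 0"
  by (simp add: jop_def)

lemma jop_sum: "jop \<alpha> \<beta> (\<Sum>i\<in>A. f i) = (\<Sum>i\<in>A. jop \<alpha> \<beta> (f i))"
  by (induction A rule: infinite_finite_induct) (auto simp: jop_add)

section \<open>Jacobi polynomials as eigenvectors of the operator\<close>

definition jacobi_coeff :: "real \<Rightarrow> real \<Rightarrow> nat \<Rightarrow> nat \<Rightarrow> real" where
  "jacobi_coeff \<alpha> \<beta> n k = real (n choose k) * pochhammer (real n + \<alpha> + \<beta> + 1) k *
     pochhammer (\<alpha> + real k + 1) (n - k) / fact n"

definition jpoly :: "real \<Rightarrow> real \<Rightarrow> nat \<Rightarrow> real poly" where
  "jpoly \<alpha> \<beta> n = (\<Sum>k\<le>n. monom (jacobi_coeff \<alpha> \<beta> n k) k)"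

lemma poly_jpoly: "poly (jpoly \<alpha> \<beta> n) ((x - 1) / 2) = jacobi_poly \<alpha> \<beta> n x"
  by (simp add: jpoly_def jacobi_poly_def poly_sum poly_monom jacobi_coeff_def sum_divide_distrib)

lemma coeff_jpoly: "coeff (jpoly \<alpha> \<beta> n) k = jacobi_coeff \<alpha> \<beta> n k"
  by (simp add: jpoly_def coeff_sum jacobi_coeff_def)

text \<open>The recursion that \<open>coeff_jop\<close> demands of an eigenvector, because n (n + c)
  - k (k + c) = (n - k) (n + k + c) with c = \<alpha> + \<beta> + 1. For k >= n both sides vanish,
  by the binomial coefficients and the factor n - k.\<close>

lemma jacobi_coeff_Suc:
  "(real k + 1) * (real k + \<alpha> + 1) * jacobi_coeff \<alpha> \<beta> n (Suc k)
     = (real n - real k) * (real n + real k + \<alpha> + \<beta> + 1) * jacobi_coeff \<alpha> \<beta> n k"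
proof (cases "k < n")
  case True
  then obtain j where j: "n - k = Suc j" "n - Suc k = j"
    by (metis Suc_diff_Suc)
  have "Suc k * (n choose Suc k) = (n - k) * (n choose k)"
    by (simp only: binomial_absorption binomial_absorb_comp)
  then have "real (Suc k * (n choose Suc k)) = real ((n - k) * (n choose k))" by presburger
  then have 1: "(real k + 1) * real (n choose Suc k) = (real n - real k) * real (n choose k)"
    using True by (simp add: of_nat_diff algebra_simps)
  have 2: "pochhammer (real n + \<alpha> + \<beta> + 1) (Suc k)
      = (real n + real k + \<alpha> + \<beta> + 1) * pochhammer (real n + \<alpha> + \<beta> + 1) k"
    by (simp add: pochhammer_Suc algebra_simps)
  have 3: "pochhammer (\<alpha> + real k + 1) (Suc j)
      = (real k + \<alpha> + 1) * pochhammer (\<alpha> + real (Suc k) + 1) j"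
    by (simp add: pochhammer_rec algebra_simps)
  have "(real k + 1) * (real k + \<alpha> + 1) * jacobi_coeff \<alpha> \<beta> n (Suc k)
      = ((real k + 1) * real (n choose Suc k)) * pochhammer (real n + \<alpha> + \<beta> + 1) (Suc k)
        * ((real k + \<alpha> + 1) * pochhammer (\<alpha> + real (Suc k) + 1) j) / fact n"
    by (simp add: jacobi_coeff_def j)
  also have "\<dots> = (real n - real k) * (real n + real k + \<alpha> + \<beta> + 1) * jacobi_coeff \<alpha> \<beta> n k"
    unfolding 1 2 3[symmetric] by (simp add: jacobi_coeff_def j)
  finally show ?thesis .
next
  case False
  then have "k = n \<or> n < k" by auto
  then show ?thesis by (auto simp: jacobi_coeff_def binomial_eq_0)
qed

lemma jop_jpoly:
  "jop \<alpha> \<beta> (jpoly \<alpha> \<beta> n) = smult (real n * (real n + \<alpha> + \<beta> + 1)) (jpoly \<alpha> \<beta> n)"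
  by (rule poly_eqI)
     (simp add: coeff_jop coeff_jpoly jacobi_coeff_Suc; simp add: algebra_simps)

lemma degree_jpoly:
  assumes "\<alpha> > -1" "\<beta> > -1"
  shows "degree (jpoly \<alpha> \<beta> n) = n" "lead_coeff (jpoly \<alpha> \<beta> n) > 0"
proof -
  \<comment> \<open>For n = 0 the base \<alpha> + \<beta> + 1 may be negative, but the product is
    empty; for n >= 1 the base is positive.\<close>
  have "pochhammer (real n + \<alpha> + \<beta> + 1) n > 0"
    using assms by (cases n) (auto intro!: pochhammer_pos)
  then have pos: "coeff (jpoly \<alpha> \<beta> n) n > 0"
    by (simp add: coeff_jpoly jacobi_coeff_def)
  have "degree (jpoly \<alpha> \<beta> n) \<le> n"
    by (rule degree_le) (simp add: coeff_jpoly jacobi_coeff_def)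
  with pos show "degree (jpoly \<alpha> \<beta> n) = n"
    by (intro antisym le_degree) auto
  with pos show "lead_coeff (jpoly \<alpha> \<beta> n) > 0" by simp
qed

text \<open>Elimination of the leading coefficient, possible because the i-th polynomial has degree
  exactly i.\<close>

lemma jpoly_span:
  assumes "\<alpha> > -1" "\<beta> > -1"
    and "degree q \<le> d"
  shows "\<exists>c. q = (\<Sum>i\<le>d. smult (c i) (jpoly \<alpha> \<beta> i))"
proof -
  \<comment> \<open>Stated with vanishing coefficients instead of the degree, so that d = 0 forces q
    = 0 and the induction can start there.\<close>
  have "\<exists>c. q = (\<Sum>i<d. smult (c i) (jpoly \<alpha> \<beta> i))" if "\<And>i. i \<ge> d \<Longrightarrow> coeff q i = 0" for d
    using that
  proof (induction d arbitrary: q)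
    case 0
    then have "q = 0" by (intro poly_eqI) simp
    then show ?case by simp
  next
    case (Suc d)
    define a where "a = coeff q d / coeff (jpoly \<alpha> \<beta> d) d"
    define r where "r = q - smult a (jpoly \<alpha> \<beta> d)"
    have nz: "coeff (jpoly \<alpha> \<beta> d) d \<noteq> 0"
      using degree_jpoly[OF assms(1,2), of d] by simp
    have "coeff r i = 0" if "i \<ge> d" for i
    proof (cases "i = d")
      case True
      then show ?thesis using nz by (simp add: r_def a_def)
    next
      case False
      with that Suc.prems[of i] show ?thesis
        by (simp add: r_def coeff_jpoly jacobi_coeff_def)
    qed
    from Suc.IH[OF this] obtain c where c: "r = (\<Sum>i<d. smult (c i) (jpoly \<alpha> \<beta> i))" by blast
    have "q = (\<Sum>i<Suc d. smult ((c(d := a)) i) (jpoly \<alpha> \<beta> i))"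
    proof -
      have "(\<Sum>i<d. smult ((c(d := a)) i) (jpoly \<alpha> \<beta> i)) = r"
        unfolding c by (intro sum.cong) auto
      then show ?thesis by (simp add: r_def)
    qed
    then show ?case by blast
  qed
  from this[of "Suc d"] \<open>degree q \<le> d\<close> show ?thesis
    by (simp add: coeff_eq_0 lessThan_Suc_atMost)
qed

subsection \<open>Maximum principle\<close>

lemma poly_local_max_second_deriv:
  fixes q :: "real poly"
  assumes z: "a < z" "z < b" and max: "\<And>y. a \<le> y \<Longrightarrow> y \<le> b \<Longrightarrow> poly q y \<le> poly q z"
  shows "poly (pderiv q) z = 0" "poly (pderiv (pderiv q)) z \<le> 0"
proof -
  show 0: "poly (pderiv q) z = 0"
  proof (rule DERIV_local_max[OF poly_DERIV])
    show "0 < min (z - a) (b - z)" using z by simp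
    show "\<forall>y. \<bar>z - y\<bar> < min (z - a) (b - z) \<longrightarrow> poly q y \<le> poly q z"
      by (auto intro!: max)
  qed
  show "poly (pderiv (pderiv q)) z \<le> 0"
  proof (rule ccontr)
    \<comment> \<open>A positive second derivative would make q' positive just to the right of z,
      and by the mean value theorem q would exceed its maximum there.\<close>
    assume "\<not> poly (pderiv (pderiv q)) z \<le> 0"
    then obtain d where d: "d > 0" "\<And>h. h > 0 \<Longrightarrow> h < d \<Longrightarrow> poly (pderiv q) z < poly (pderiv q) (z + h)"
      using DERIV_pos_inc_right[OF poly_DERIV, of "pderiv q" z] by auto
    define h where "h = min (d / 2) (b - z)"
    have h: "0 < h" "h < d" "z + h \<le> b" using d(1) z by (auto simp: h_def)
    have "\<exists>y. y > z \<and> y < z + h \<and> poly q (z + h) - poly q z = (z + h - z) * poly (pderiv q) y"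
      using h by (intro MVT2 poly_DERIV) auto
    then obtain y where y: "z < y" "y < z + h" "poly q (z + h) - poly q z = h * poly (pderiv q) y"
      by auto
    have "poly (pderiv q) y > 0" using d(2)[of "y - z"] y h 0 by simp
    with y(3) h(1) have "poly q (z + h) > poly q z"
      using mult_pos_pos[of h "poly (pderiv q) y"] by linarith
    with max[of "z + h"] z h show False by simp
  qed
qed

text \<open>Inside, y (1 + y) < 0 meets q'' <= 0 and q' = 0. At the endpoints this coefficient
  vanishes, and the first-order one is \<alpha> + 1 > 0 at 0 and -(\<beta> + 1) < 0 at -1, matching
  the one-sided signs q'(0) >= 0 and q'(-1) <= 0 at a maximum.\<close>

lemma jop_nonneg_at_max:
  assumes ab: "\<alpha> > -1" "\<beta> > -1"
    and z: "z \<in> {-1..0}" and max: "\<And>y. y \<in> {-1..0} \<Longrightarrow> poly q y \<le> poly q z"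
  shows "poly (jop \<alpha> \<beta> q) z \<ge> 0"
proof -
  consider "z = 0" | "z = -1" | "-1 < z" "z < 0" using z by force
  then show ?thesis
  proof cases
    case 1
    have "poly (pderiv q) 0 \<ge> 0"
    proof (rule ccontr)
      assume "\<not> poly (pderiv q) 0 \<ge> 0"
      then obtain d where d: "d > 0" "\<And>h. h > 0 \<Longrightarrow> h < d \<Longrightarrow> poly q 0 < poly q (0 - h)"
        using DERIV_neg_dec_left[OF poly_DERIV, of q 0] by auto
      define h where "h = min (d / 2) 1"
      have "0 < h" "h < d" "h \<le> 1" using d(1) by (auto simp: h_def)
      with d(2)[of h] max[of "- h"] show False by (simp add: 1)
    qed
    then show ?thesis using ab by (simp add: poly_jop 1)
  next
    case 2
    have "poly (pderiv q) (-1) \<le> 0"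
    proof (rule ccontr)
      assume "\<not> poly (pderiv q) (-1) \<le> 0"
      then obtain d where d: "d > 0" "\<And>h. h > 0 \<Longrightarrow> h < d \<Longrightarrow> poly q (-1) < poly q (-1 + h)"
        using DERIV_pos_inc_right[OF poly_DERIV, of q "-1"] by auto
      define h where "h = min (d / 2) 1"
      have "0 < h" "h < d" "h \<le> 1" using d(1) by (auto simp: h_def)
      with d(2)[of h] max[of "-1 + h"] show False by (simp add: 2)
    qed
    then have "(\<beta> + 1) * poly (pderiv q) (-1) \<le> 0"
      using ab by (intro mult_nonneg_nonpos) auto
    then show ?thesis by (simp add: poly_jop 2 algebra_simps)
  next
    case 3
    have d: "poly (pderiv q) z = 0" "poly (pderiv (pderiv q)) z \<le> 0"
      using poly_local_max_second_deriv[OF 3, of q] max by auto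
    have "z * (1 + z) \<le> 0" using 3 by (intro mult_nonpos_nonneg) auto
    with d show ?thesis by (simp add: poly_jop mult_nonpos_nonpos)
  qed
qed

text \<open>At a maximum point z of q the operator term is nonnegative, so s q is bounded everywhere
  by the value of s q + \<open>jop\<close> q at z.\<close>

lemma resolvent_max_principle:
  assumes ab: "\<alpha> > -1" "\<beta> > -1" and s: "s > 0"
    and le: "\<And>y. y \<in> {-1..0} \<Longrightarrow> poly (smult s q + jop \<alpha> \<beta> q) y \<le> B"
    and y: "y \<in> {-1..0}"
  shows "s * poly q y \<le> B"
proof -
  have "\<exists>z\<in>{-1..0}. \<forall>y\<in>{-1..0}. poly q y \<le> poly q z"
    by (rule continuous_attains_sup) (auto intro!: continuous_intros)
  then obtain z where z: "z \<in> {-1..0}" "\<And>y. y \<in> {-1..0} \<Longrightarrow> poly q y \<le> poly q z" by blast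
  have "s * poly q y \<le> s * poly q z" using s z(2)[OF y] by simp
  also have "\<dots> \<le> s * poly q z + poly (jop \<alpha> \<beta> q) z"
    using jop_nonneg_at_max[OF ab z] by simp
  also have "\<dots> \<le> B" using le[OF z(1)] by simp
  finally show ?thesis .
qed

section \<open>Resolvent multipliers on finite expansions\<close>

abbreviation jacobi_eigenvalue :: "real \<Rightarrow> real \<Rightarrow> nat \<Rightarrow> real" where
  "jacobi_eigenvalue \<alpha> \<beta> n \<equiv> real n * (real n + \<alpha> + \<beta> + 1)"

lemma jacobi_eigenvalue_pos:
  assumes "\<alpha> > -1" "\<beta> > -1" "n > 0"
  shows "jacobi_eigenvalue \<alpha> \<beta> n > 0"
  using assms by (intro mult_pos_pos) auto

lemma jacobi_eigenvalue_nonneg: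
  assumes "\<alpha> > -1" "\<beta> > -1"
  shows "jacobi_eigenvalue \<alpha> \<beta> n \<ge> 0"
  using jacobi_eigenvalue_pos[OF assms, of n] by (cases "n = 0") auto

lemma resolvent_upper_bound:
  assumes ab: "\<alpha> > -1" "\<beta> > -1" and s: "s > 0"
    and le: "\<And>y. y \<in> {-1..0} \<Longrightarrow> (\<Sum>i\<le>d. c i * poly (jpoly \<alpha> \<beta> i) y) \<le> B"
    and y: "y \<in> {-1..0}"
  shows "(\<Sum>i\<le>d. s / (jacobi_eigenvalue \<alpha> \<beta> i + s) * c i * poly (jpoly \<alpha> \<beta> i) y) \<le> B"
proof -
  define l where "l i = jacobi_eigenvalue \<alpha> \<beta> i" for i
  have l: "l i + s \<noteq> 0" for i
    using jacobi_eigenvalue_nonneg[OF ab, of i] s by (simp add: l_def)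
  \<comment> \<open>The solution of s q + \<open>jop\<close> q = (the given expansion), found
    coefficient by coefficient from the eigenvalues.\<close>
  define q where "q = (\<Sum>i\<le>d. smult (c i / (l i + s)) (jpoly \<alpha> \<beta> i))"
  have "smult s q = (\<Sum>i\<le>d. smult (s * (c i / (l i + s))) (jpoly \<alpha> \<beta> i))"
    unfolding q_def by (induction d) (simp_all add: smult_add_right)
  moreover have "jop \<alpha> \<beta> q = (\<Sum>i\<le>d. smult (c i / (l i + s) * l i) (jpoly \<alpha> \<beta> i))"
    by (simp add: q_def jop_sum jop_smult jop_jpoly l_def)
  ultimately have "smult s q + jop \<alpha> \<beta> q
      = (\<Sum>i\<le>d. smult (s * (c i / (l i + s)) + c i / (l i + s) * l i) (jpoly \<alpha> \<beta> i))"
    by (simp only: sum.distrib[symmetric] smult_add_left)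
  also have "\<dots> = (\<Sum>i\<le>d. smult (c i) (jpoly \<alpha> \<beta> i))"
  proof (intro sum.cong refl arg_cong2[where f=smult])
    have *: "s * r + r * l i = r * (l i + s)" for r i by (simp add: algebra_simps)
    show "s * (c i / (l i + s)) + c i / (l i + s) * l i = c i" for i
      unfolding * using l[of i] by simp
  qed
  finally have "s * poly q y \<le> B"
    using le by (intro resolvent_max_principle[OF ab s _ y]) (simp add: poly_sum)
  then show ?thesis
    by (simp add: q_def poly_sum sum_distrib_left l_def mult.assoc)
qed

text \<open>Rotating the coefficients reduces the complex statement to the real one.\<close>

lemma resolvent_contraction:
  fixes c :: "nat \<Rightarrow> complex"
  assumes ab: "\<alpha> > -1" "\<beta> > -1" and s: "s > 0"
    and le: "\<And>y. y \<in> {-1..0} \<Longrightarrow> norm (\<Sum>i\<le>d. c i * of_real (poly (jpoly \<alpha> \<beta> i) y)) \<le> B"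
    and y: "y \<in> {-1..0}"
  shows "norm (\<Sum>i\<le>d. of_real (s / (jacobi_eigenvalue \<alpha> \<beta> i + s)) * c i * of_real (poly (jpoly \<alpha> \<beta> i) y)) \<le> B"
proof -
  define w where "w = (\<Sum>i\<le>d. of_real (s / (jacobi_eigenvalue \<alpha> \<beta> i + s)) * c i * of_real (poly (jpoly \<alpha> \<beta> i) y))"
  \<comment> \<open>The rotation that makes u w equal to |w|. Since \<open>sgn 0 = 0\<close>, only
    modulus at most 1 is claimed, which also covers w = 0.\<close>
  define u where "u = cnj (sgn w)"
  have u: "norm u \<le> 1" by (simp add: u_def norm_sgn)
  have uw: "Re (u * w) = norm w"
  proof -
    have "u * w = (w * cnj w) / of_real (norm w)"
      by (simp add: u_def sgn_div_norm scaleR_conv_of_real field_simps)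
    also have "\<dots> = of_real (norm w)"
      by (simp add: complex_norm_square[symmetric] power2_eq_square)
    finally show ?thesis by simp
  qed
  have "(\<Sum>i\<le>d. s / (jacobi_eigenvalue \<alpha> \<beta> i + s) * Re (u * c i) * poly (jpoly \<alpha> \<beta> i) y) \<le> B"
  proof (rule resolvent_upper_bound[OF ab s _ y])
    fix t assume t: "t \<in> {-1..0::real}"
    have "(\<Sum>i\<le>d. Re (u * c i) * poly (jpoly \<alpha> \<beta> i) t)
        = Re (u * (\<Sum>i\<le>d. c i * of_real (poly (jpoly \<alpha> \<beta> i) t)))"
      by (simp add: sum_distrib_left mult.assoc[symmetric])
    also have "\<dots> \<le> norm (u * (\<Sum>i\<le>d. c i * of_real (poly (jpoly \<alpha> \<beta> i) t)))"
      by (rule complex_Re_le_cmod)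
    also have "\<dots> \<le> 1 * B"
      unfolding norm_mult using u le[OF t] by (intro mult_mono) auto
    finally show "(\<Sum>i\<le>d. Re (u * c i) * poly (jpoly \<alpha> \<beta> i) t) \<le> B" by simp
  qed
  also have "(\<Sum>i\<le>d. s / (jacobi_eigenvalue \<alpha> \<beta> i + s) * Re (u * c i) * poly (jpoly \<alpha> \<beta> i) y) = Re (u * w)"
    unfolding w_def sum_distrib_left Re_sum
  proof (intro sum.cong refl)
    have "a * Re (u * z) * b = Re (u * (of_real a * z * of_real b))" for a b z
      by (simp add: algebra_simps)
    then show "s / (jacobi_eigenvalue \<alpha> \<beta> i + s) * Re (u * c i) * poly (jpoly \<alpha> \<beta> i) y
       = Re (u * (of_real (s / (jacobi_eigenvalue \<alpha> \<beta> i + s)) * c i * of_real (poly (jpoly \<alpha> \<beta> i) y)))"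
      for i .
  qed
  finally show ?thesis unfolding w_def[symmetric] using uw by simp
qed

text \<open>The value at \<open>i = 0\<close> covers \<open>\<tau> = 0\<close>, where the operator is the projection onto
  constants, obtained as the limit \<open>s \<rightarrow> 0\<close> of the resolvents.\<close>

definition inv_mult :: "real \<Rightarrow> real \<Rightarrow> nat \<Rightarrow> real" where
  "inv_mult \<alpha> \<beta> i = (if i = 0 then 1 else (jacobi_tau \<alpha> \<beta> / (real i + jacobi_tau \<alpha> \<beta>))\<^sup>2)"

text \<open>Completing the square, as \<alpha> + \<beta> + 1 is twice \<tau>. It shows that the
  resolvent parameter to use is s = \<tau>^2.\<close>

lemma eigenvalue_plus_tau:
  "jacobi_eigenvalue \<alpha> \<beta> i + (jacobi_tau \<alpha> \<beta>)\<^sup>2 = (real i + jacobi_tau \<alpha> \<beta>)\<^sup>2"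
  by (simp add: jacobi_tau_def power2_eq_square field_simps)

lemma inv_mult_contraction:
  fixes c :: "nat \<Rightarrow> complex"
  assumes ab: "\<alpha> > -1" "\<beta> > -1"
    and le: "\<And>y. y \<in> {-1..0} \<Longrightarrow> norm (\<Sum>i\<le>d. c i * of_real (poly (jpoly \<alpha> \<beta> i) y)) \<le> B"
    and y: "y \<in> {-1..0}"
  shows "norm (\<Sum>i\<le>d. of_real (inv_mult \<alpha> \<beta> i) * c i * of_real (poly (jpoly \<alpha> \<beta> i) y)) \<le> B"
proof (cases "jacobi_tau \<alpha> \<beta> = 0")
  case False
  have "inv_mult \<alpha> \<beta> i = (jacobi_tau \<alpha> \<beta>)\<^sup>2 / (jacobi_eigenvalue \<alpha> \<beta> i + (jacobi_tau \<alpha> \<beta>)\<^sup>2)" for i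
    unfolding eigenvalue_plus_tau using False by (simp add: inv_mult_def power_divide)
  then show ?thesis
    using resolvent_contraction[OF ab _ le y, of "(jacobi_tau \<alpha> \<beta>)\<^sup>2"] False by simp
next
  case True
  define s where "s n = inverse (real (Suc n))" for n
  have s: "s \<longlonglongrightarrow> 0" unfolding s_def by (rule LIMSEQ_inverse_real_of_nat)
  have lim: "(\<lambda>n. s n / (jacobi_eigenvalue \<alpha> \<beta> i + s n)) \<longlonglongrightarrow> inv_mult \<alpha> \<beta> i" for i
  proof (cases "i = 0")
    case True
    then show ?thesis by (simp add: inv_mult_def s_def)
  next
    case False
    then have pos: "jacobi_eigenvalue \<alpha> \<beta> i > 0" by (intro jacobi_eigenvalue_pos ab) auto
    have "(\<lambda>n. s n / (l + s n)) \<longlonglongrightarrow> 0 / (l + 0)" if "l > 0" for l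
      using that by (intro tendsto_intros s) auto
    from this[OF pos] show ?thesis using False True by (simp add: inv_mult_def)
  qed
  show ?thesis
  proof (rule LIMSEQ_le_const2)
    show "(\<lambda>n. norm (\<Sum>i\<le>d. of_real (s n / (jacobi_eigenvalue \<alpha> \<beta> i + s n)) * c i * of_real (poly (jpoly \<alpha> \<beta> i) y)))
      \<longlonglongrightarrow> norm (\<Sum>i\<le>d. of_real (inv_mult \<alpha> \<beta> i) * c i * of_real (poly (jpoly \<alpha> \<beta> i) y))"
      by (intro tendsto_intros lim)
    show "\<exists>N. \<forall>n\<ge>N. norm (\<Sum>i\<le>d. of_real (s n / (jacobi_eigenvalue \<alpha> \<beta> i + s n)) * c i * of_real (poly (jpoly \<alpha> \<beta> i) y)) \<le> B"
      using resolvent_contraction[OF ab _ le y, of "s n" for n] by (auto simp: s_def)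
  qed
qed

text \<open>Each factor 1 - \<open>inv_mult\<close> is the identity minus a contraction, so one step
  at most doubles the bound; the earlier factors are absorbed into the coefficients.\<close>

lemma riesz_mult_bound:
  fixes c :: "nat \<Rightarrow> complex"
  assumes ab: "\<alpha> > -1" "\<beta> > -1"
    and le: "\<And>y. y \<in> {-1..0} \<Longrightarrow> norm (\<Sum>i\<le>d. c i * of_real (poly (jpoly \<alpha> \<beta> i) y)) \<le> B"
    and y: "y \<in> {-1..0}"
  shows "norm (\<Sum>i\<le>d. of_real ((1 - inv_mult \<alpha> \<beta> i) ^ k) * c i * of_real (poly (jpoly \<alpha> \<beta> i) y)) \<le> 2 ^ k * B"
  using y
proof (induction k arbitrary: y)
  case 0
  then show ?case using le by simp
next
  case (Suc k)
  define c' where "c' i = of_real ((1 - inv_mult \<alpha> \<beta> i) ^ k) * c i" for i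
  have "(\<Sum>i\<le>d. of_real ((1 - inv_mult \<alpha> \<beta> i) ^ Suc k) * c i * of_real (poly (jpoly \<alpha> \<beta> i) y))
    = (\<Sum>i\<le>d. c' i * of_real (poly (jpoly \<alpha> \<beta> i) y))
      - (\<Sum>i\<le>d. of_real (inv_mult \<alpha> \<beta> i) * c' i * of_real (poly (jpoly \<alpha> \<beta> i) y))"
    unfolding sum_subtractf[symmetric] c'_def
    by (intro sum.cong refl) (simp add: algebra_simps)
  also have "norm \<dots> \<le> 2 ^ k * B + 2 ^ k * B"
  proof (rule order_trans[OF norm_triangle_ineq4 add_mono])
    show "norm (\<Sum>i\<le>d. c' i * of_real (poly (jpoly \<alpha> \<beta> i) y)) \<le> 2 ^ k * B"
      unfolding c'_def by (rule Suc.IH[OF Suc.prems])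
    show "norm (\<Sum>i\<le>d. of_real (inv_mult \<alpha> \<beta> i) * c' i * of_real (poly (jpoly \<alpha> \<beta> i) y)) \<le> 2 ^ k * B"
      using Suc.IH by (intro inv_mult_contraction[OF ab _ Suc.prems]) (simp add: c'_def)
  qed
  also have "2 ^ k * B + 2 ^ k * B = 2 ^ Suc k * B" by simp
  finally show ?case .
qed

text \<open>For n > 0 the base n + \<tau> is positive since \<tau> > -1/2, and completing the square
  gives the quotient. At n = 0 the eigenvalue 0 and the value 1 of \<open>inv_mult\<close> make both
  sides 0, as k > 0, whatever the inverse power of |\<tau>| is.\<close>

lemma riesz_multiplier:
  assumes ab: "\<alpha> > -1" "\<beta> > -1" and "k > 0"
  shows "\<bar>real n + jacobi_tau \<alpha> \<beta>\<bar> powi (- int (2 * k)) * jacobi_eigenvalue \<alpha> \<beta> n ^ k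
    = (1 - inv_mult \<alpha> \<beta> n) ^ k"
proof (cases "n = 0")
  case True
  then show ?thesis using assms by (simp add: inv_mult_def)
next
  case False
  define t where "t = jacobi_tau \<alpha> \<beta>"
  have "real n + t > 0" using False ab by (simp add: t_def jacobi_tau_def field_simps; linarith)
  then have nz: "(real n + t)\<^sup>2 \<noteq> 0" by simp
  have "\<bar>real n + t\<bar> powi (- int (2 * k)) = 1 / ((real n + t)\<^sup>2) ^ k"
    by (simp only: power_int_minus power_int_of_nat power_mult power2_abs inverse_eq_divide)
  moreover have "jacobi_eigenvalue \<alpha> \<beta> n = (real n + t)\<^sup>2 - t\<^sup>2"
    using eigenvalue_plus_tau[of n \<alpha> \<beta>] by (simp add: t_def)
  moreover have "1 - inv_mult \<alpha> \<beta> n = ((real n + t)\<^sup>2 - t\<^sup>2) / (real n + t)\<^sup>2"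
    using nz False by (simp add: inv_mult_def t_def[symmetric] power_divide diff_divide_distrib)
  ultimately show ?thesis by (simp add: t_def[symmetric] power_divide)
qed

text \<open>Nonnegative eigenvalues give \<tau>^2 <= (n + \<tau>)^2, also for negative \<tau>. This
  keeps the multipliers 1 - \<open>inv_mult\<close> in [0, 1].\<close>

lemma inv_mult_range:
  assumes ab: "\<alpha> > -1" "\<beta> > -1"
  shows "0 \<le> inv_mult \<alpha> \<beta> n" "inv_mult \<alpha> \<beta> n \<le> 1"
proof -
  show "0 \<le> inv_mult \<alpha> \<beta> n" by (simp add: inv_mult_def)
  show "inv_mult \<alpha> \<beta> n \<le> 1"
  proof (cases "n = 0")
    case False
    have "(jacobi_tau \<alpha> \<beta>)\<^sup>2 \<le> (real n + jacobi_tau \<alpha> \<beta>)\<^sup>2"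
      unfolding eigenvalue_plus_tau[symmetric] using jacobi_eigenvalue_nonneg[OF ab, of n] by simp
    then show ?thesis using False by (simp add: inv_mult_def power_divide divide_le_eq_1)
  qed (simp add: inv_mult_def)
qed

section \<open>The Jacobi measure\<close>

definition jweight :: "real \<Rightarrow> real \<Rightarrow> real \<Rightarrow> real" where
  "jweight \<alpha> \<beta> \<theta> = sin (\<theta>/2) powr (2*\<alpha> + 1) * cos (\<theta>/2) powr (2*\<beta> + 1)"

definition yvar :: "real \<Rightarrow> real" where
  "yvar \<theta> = (cos \<theta> - 1) / 2"

lemma yvar_range: "yvar \<theta> \<in> {-1..0}"
  by (simp add: yvar_def) (use cos_ge_minus_one[of \<theta>] in linarith)

lemma yvar_sin: "yvar \<theta> = - (sin (\<theta>/2))\<^sup>2"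
  using cos_double_sin[of "\<theta>/2"] by (simp add: yvar_def)

lemma yvar_cos: "1 + yvar \<theta> = (cos (\<theta>/2))\<^sup>2"
  using cos_double_cos[of "\<theta>/2"] by (simp add: yvar_def field_simps)

lemma yvar_has_derivative: "(yvar has_real_derivative - (sin (\<theta>/2) * cos (\<theta>/2))) (at \<theta>)"
proof -
  have "(yvar has_real_derivative - sin \<theta> / 2) (at \<theta>)"
    unfolding yvar_def by (auto intro!: derivative_eq_intros)
  also have "- sin \<theta> / 2 = - (sin (\<theta>/2) * cos (\<theta>/2))"
    using sin_double[of "\<theta>/2"] by simp
  finally show ?thesis .
qed

lemma continuous_yvar: "continuous_on A yvar"
  unfolding yvar_def by (intro continuous_intros) auto

lemma half_angle_pos:
  assumes "0 < \<theta>" "\<theta> < pi"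
  shows "sin (\<theta>/2) > 0" "cos (\<theta>/2) > 0"
  using assms by (auto intro!: sin_gt_zero cos_gt_zero)

lemma half_angle_nonneg:
  assumes "0 \<le> \<theta>" "\<theta> \<le> pi"
  shows "sin (\<theta>/2) \<ge> 0" "cos (\<theta>/2) \<ge> 0"
  using assms by (auto intro!: sin_ge_zero cos_ge_zero)

lemma jweight_measurable [measurable]: "jweight \<alpha> \<beta> \<in> borel_measurable borel"
  unfolding jweight_def[abs_def] by measurable

lemma yvar_measurable [measurable]: "yvar \<in> borel_measurable borel"
  unfolding yvar_def[abs_def] by measurable

lemma poly_measurable [measurable]: "poly (q :: real poly) \<in> borel_measurable borel"
  by (intro borel_measurable_continuous_onI continuous_intros)

lemma jweight_pos: "0 < \<theta> \<Longrightarrow> \<theta> < pi \<Longrightarrow> jweight \<alpha> \<beta> \<theta> > 0"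
  using half_angle_pos[of \<theta>] by (simp add: jweight_def)

lemma space_leb_0_pi [simp]: "space leb_0_pi = {0<..<pi}"
  by (simp add: leb_0_pi_def space_restrict_space)

lemma space_jacobi [simp]: "space (jacobi_measure \<alpha> \<beta>) = {0<..<pi}"
  by (simp add: jacobi_measure_def)

lemma sets_jacobi: "sets (jacobi_measure \<alpha> \<beta>) = sets leb_0_pi"
  by (simp add: jacobi_measure_def)

lemma measurable_jacobi: "borel_measurable (jacobi_measure \<alpha> \<beta>) = borel_measurable leb_0_pi"
  by (rule measurable_cong_sets[OF sets_jacobi refl])

lemma jacobi_measure_eq: "jacobi_measure \<alpha> \<beta> = density leb_0_pi (\<lambda>\<theta>. ennreal (jweight \<alpha> \<beta> \<theta>))"
  by (simp add: jacobi_measure_def jweight_def)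

lemma borel_leb_0_pi: "f \<in> borel_measurable borel \<Longrightarrow> f \<in> borel_measurable leb_0_pi"
  unfolding leb_0_pi_def by (rule measurable_restrict_space1) simp

lemma borel_jacobi: "f \<in> borel_measurable borel \<Longrightarrow> f \<in> borel_measurable (jacobi_measure \<alpha> \<beta>)"
  unfolding measurable_jacobi by (rule borel_leb_0_pi)

lemma AE_leb_0_pi: "(AE \<theta> in leb_0_pi. P \<theta>) \<longleftrightarrow> (AE \<theta> in lborel. \<theta> \<in> {0<..<pi} \<longrightarrow> P \<theta>)"
  unfolding leb_0_pi_def by (rule AE_restrict_space_iff) simp

text \<open>The weight is strictly positive on the open interval, so both measures have the same
  null sets; this lets essential bounds pass between them.\<close>

lemma AE_jacobi: "(AE \<theta> in jacobi_measure \<alpha> \<beta>. P \<theta>) \<longleftrightarrow> (AE \<theta> in leb_0_pi. P \<theta>)"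
  unfolding jacobi_measure_eq
  by (subst AE_density)
     (auto intro!: AE_cong borel_leb_0_pi simp: jweight_pos)

lemma integrable_jacobi:
  fixes f :: "real \<Rightarrow> real"
  assumes "f \<in> borel_measurable leb_0_pi"
  shows "integrable (jacobi_measure \<alpha> \<beta>) f
    \<longleftrightarrow> set_integrable lborel {0<..<pi} (\<lambda>\<theta>. jweight \<alpha> \<beta> \<theta> * f \<theta>)"
proof -
  have "integrable (jacobi_measure \<alpha> \<beta>) f \<longleftrightarrow> integrable leb_0_pi (\<lambda>\<theta>. jweight \<alpha> \<beta> \<theta> *\<^sub>R f \<theta>)"
    unfolding jacobi_measure_eq
    by (rule integrable_density)
       (auto intro!: assms borel_leb_0_pi AE_I2 simp: jweight_pos less_imp_le)
  then show ?thesis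
    by (simp add: leb_0_pi_def integrable_restrict_space set_integrable_def)
qed

lemma integral_jacobi:
  fixes f :: "real \<Rightarrow> real"
  assumes "f \<in> borel_measurable leb_0_pi"
  shows "(\<integral>\<theta>. f \<theta> \<partial>jacobi_measure \<alpha> \<beta>) = (LINT \<theta>:{0<..<pi}|lborel. jweight \<alpha> \<beta> \<theta> * f \<theta>)"
proof -
  have "(\<integral>\<theta>. f \<theta> \<partial>jacobi_measure \<alpha> \<beta>) = (\<integral>\<theta>. jweight \<alpha> \<beta> \<theta> *\<^sub>R f \<theta> \<partial>leb_0_pi)"
    unfolding jacobi_measure_eq
    by (rule integral_density)
       (auto intro!: assms borel_leb_0_pi AE_I2 simp: jweight_pos less_imp_le)
  then show ?thesis
    by (simp add: leb_0_pi_def integral_restrict_space set_lebesgue_integral_def)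
qed

section \<open>Integrability of the weight up to the endpoints\<close>

lemma set_integrable_powr_sin:
  assumes "\<alpha> > -1"
  shows "set_integrable lborel {0<..<pi} (\<lambda>\<theta>. sin (\<theta>/2) powr (2*\<alpha> + 1) * cos (\<theta>/2))"
proof -
  \<comment> \<open>The extra cosine makes the integrand an exact derivative; as 2\<alpha> + 2 > 0,
    the antiderivative is continuous up to the endpoints.\<close>
  define F where "F \<theta> = sin (\<theta>/2) powr (2*\<alpha> + 2) / (\<alpha> + 1)" for \<theta>
  have cont: "continuous_on {0..pi} F"
    unfolding F_def using assms half_angle_nonneg
    by (intro continuous_on_divide continuous_on_powr' continuous_intros) auto
  have "set_integrable lborel (einterval (ereal 0) (ereal pi)) (\<lambda>\<theta>. sin (\<theta>/2) powr (2*\<alpha> + 1) * cos (\<theta>/2))"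
  proof (rule interval_integral_FTC_nonneg)
    show "((F \<circ> real_of_ereal) \<longlongrightarrow> F 0) (at_right (ereal 0))"
      unfolding ereal_tendsto_simps using cont by (rule continuous_on_Icc_at_rightD) simp
    show "((F \<circ> real_of_ereal) \<longlongrightarrow> F pi) (at_left (ereal pi))"
      unfolding ereal_tendsto_simps using cont by (rule continuous_on_Icc_at_leftD) simp
    fix \<theta> assume "ereal 0 < ereal \<theta>" "ereal \<theta> < ereal pi"
    then have pos: "sin (\<theta>/2) > 0" using half_angle_pos[of \<theta>] by simp
    have "((\<lambda>\<theta>. sin (\<theta>/2) powr (2*\<alpha> + 2)) has_real_derivative
        (2*\<alpha> + 2) * sin (\<theta>/2) powr (2*\<alpha> + 2 - of_nat 1) * (cos (\<theta>/2) * (1/2))) (at \<theta>)"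
      by (rule DERIV_fun_powr) (auto intro!: derivative_eq_intros pos)
    from DERIV_cdivide[OF this, of "\<alpha> + 1"]
    show "(F has_real_derivative sin (\<theta>/2) powr (2*\<alpha> + 1) * cos (\<theta>/2)) (at \<theta>)"
      unfolding F_def by (rule DERIV_cong) (use assms in \<open>simp add: field_simps\<close>)
    show "isCont (\<lambda>\<theta>. sin (\<theta>/2) powr (2*\<alpha> + 1) * cos (\<theta>/2)) \<theta>"
      using pos by (intro continuous_intros) auto
  next
    show "AE \<theta> in lborel. ereal 0 < ereal \<theta> \<longrightarrow> ereal \<theta> < ereal pi \<longrightarrow> 0 \<le> sin (\<theta>/2) powr (2*\<alpha> + 1) * cos (\<theta>/2)"
      using half_angle_pos by (auto intro!: AE_I2 simp: less_imp_le)
  qed simp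
  then show ?thesis by simp
qed

lemma set_integrable_powr_cos:
  assumes "\<beta> > -1"
  shows "set_integrable lborel {0<..<pi} (\<lambda>\<theta>. cos (\<theta>/2) powr (2*\<beta> + 1) * sin (\<theta>/2))"
proof -
  define F where "F \<theta> = - (cos (\<theta>/2) powr (2*\<beta> + 2)) / (\<beta> + 1)" for \<theta>
  have cont: "continuous_on {0..pi} F"
    unfolding F_def using assms half_angle_nonneg
    by (intro continuous_on_divide continuous_on_minus continuous_on_powr' continuous_intros) auto
  have "set_integrable lborel (einterval (ereal 0) (ereal pi)) (\<lambda>\<theta>. cos (\<theta>/2) powr (2*\<beta> + 1) * sin (\<theta>/2))"
  proof (rule interval_integral_FTC_nonneg)
    show "((F \<circ> real_of_ereal) \<longlongrightarrow> F 0) (at_right (ereal 0))"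
      unfolding ereal_tendsto_simps using cont by (rule continuous_on_Icc_at_rightD) simp
    show "((F \<circ> real_of_ereal) \<longlongrightarrow> F pi) (at_left (ereal pi))"
      unfolding ereal_tendsto_simps using cont by (rule continuous_on_Icc_at_leftD) simp
    fix \<theta> assume "ereal 0 < ereal \<theta>" "ereal \<theta> < ereal pi"
    then have pos: "cos (\<theta>/2) > 0" using half_angle_pos[of \<theta>] by simp
    have "((\<lambda>\<theta>. cos (\<theta>/2) powr (2*\<beta> + 2)) has_real_derivative
        (2*\<beta> + 2) * cos (\<theta>/2) powr (2*\<beta> + 2 - of_nat 1) * (- sin (\<theta>/2) * (1/2))) (at \<theta>)"
      by (rule DERIV_fun_powr) (auto intro!: derivative_eq_intros pos)
    from DERIV_cdivide[OF DERIV_minus[OF this], of "\<beta> + 1"]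
    show "(F has_real_derivative cos (\<theta>/2) powr (2*\<beta> + 1) * sin (\<theta>/2)) (at \<theta>)"
      unfolding F_def by (rule DERIV_cong) (use assms in \<open>simp add: field_simps\<close>)
    show "isCont (\<lambda>\<theta>. cos (\<theta>/2) powr (2*\<beta> + 1) * sin (\<theta>/2)) \<theta>"
      using pos by (intro continuous_intros) auto
  next
    show "AE \<theta> in lborel. ereal 0 < ereal \<theta> \<longrightarrow> ereal \<theta> < ereal pi \<longrightarrow> 0 \<le> cos (\<theta>/2) powr (2*\<beta> + 1) * sin (\<theta>/2)"
      using half_angle_pos by (auto intro!: AE_I2 simp: less_imp_le)
  qed simp
  then show ?thesis by simp
qed

text \<open>Multiplying the weight by \<open>sin\<^sup>2 + cos\<^sup>2\<close> separates the two endpoint singularities.\<close>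

lemma jweight_le:
  assumes ab: "\<alpha> > -1" "\<beta> > -1" and "0 < \<theta>" "\<theta> < pi"
  shows "jweight \<alpha> \<beta> \<theta> \<le> sin (\<theta>/2) powr (2*\<alpha> + 1) * cos (\<theta>/2) + cos (\<theta>/2) powr (2*\<beta> + 1) * sin (\<theta>/2)"
proof -
  define s c where "s = sin (\<theta>/2)" and "c = cos (\<theta>/2)"
  have pos: "s > 0" "c > 0" using half_angle_pos assms(3,4) by (auto simp: s_def c_def)
  have le1: "s \<le> 1" "c \<le> 1" by (auto simp: s_def c_def)
  \<comment> \<open>The exponent 2\<gamma> + 3 exceeds 1 and x <= 1, so the square reduces a
    possibly singular power to at most x itself.\<close>
  have *: "x\<^sup>2 * x powr (2*\<gamma> + 1) \<le> x" if "x > 0" "x \<le> 1" "\<gamma> > -1" for x \<gamma> :: real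
  proof -
    have "x\<^sup>2 * x powr (2*\<gamma> + 1) = x powr (2 + (2*\<gamma> + 1))"
      using that by (simp only: powr_add) (simp add: powr_numeral)
    also have "\<dots> \<le> x powr 1"
      using that by (intro powr_mono') auto
    finally show ?thesis using that by simp
  qed
  have "s powr (2*\<alpha> + 1) * c powr (2*\<beta> + 1) = s powr (2*\<alpha> + 1) * c powr (2*\<beta> + 1) * (s\<^sup>2 + c\<^sup>2)"
    by (simp add: s_def c_def)
  also have "\<dots> = s powr (2*\<alpha> + 1) * (c\<^sup>2 * c powr (2*\<beta> + 1)) + c powr (2*\<beta> + 1) * (s\<^sup>2 * s powr (2*\<alpha> + 1))"
    by (simp add: algebra_simps)
  also have "\<dots> \<le> s powr (2*\<alpha> + 1) * c + c powr (2*\<beta> + 1) * s"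
    using pos le1 ab by (intro add_mono mult_left_mono *) auto
  finally show ?thesis by (simp add: jweight_def s_def c_def)
qed

lemma set_integrable_jweight:
  assumes ab: "\<alpha> > -1" "\<beta> > -1"
  shows "set_integrable lborel {0<..<pi} (jweight \<alpha> \<beta>)"
proof (rule set_integrable_bound[OF set_integral_add(1)[OF
      set_integrable_powr_sin[OF ab(1)] set_integrable_powr_cos[OF ab(2)]]])
  show "set_borel_measurable lborel {0<..<pi} (jweight \<alpha> \<beta>)"
    unfolding set_borel_measurable_def by measurable
  show "AE \<theta> in lborel. \<theta> \<in> {0<..<pi} \<longrightarrow> norm (jweight \<alpha> \<beta> \<theta>)
      \<le> norm (sin (\<theta>/2) powr (2*\<alpha> + 1) * cos (\<theta>/2) + cos (\<theta>/2) powr (2*\<beta> + 1) * sin (\<theta>/2))"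
  proof (rule AE_I2, rule impI)
    fix \<theta> :: real assume "\<theta> \<in> {0<..<pi}"
    then have "jweight \<alpha> \<beta> \<theta> > 0"
      "jweight \<alpha> \<beta> \<theta> \<le> sin (\<theta>/2) powr (2*\<alpha> + 1) * cos (\<theta>/2) + cos (\<theta>/2) powr (2*\<beta> + 1) * sin (\<theta>/2)"
      by (auto intro!: jweight_pos jweight_le ab)
    then show "norm (jweight \<alpha> \<beta> \<theta>)
      \<le> norm (sin (\<theta>/2) powr (2*\<alpha> + 1) * cos (\<theta>/2) + cos (\<theta>/2) powr (2*\<beta> + 1) * sin (\<theta>/2))"
      unfolding real_norm_def by linarith
  qed
qed

lemma finite_measure_jacobi:
  assumes ab: "\<alpha> > -1" "\<beta> > -1"
  shows "finite_measure (jacobi_measure \<alpha> \<beta>)"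
proof (rule finite_measureI)
  have "integrable (jacobi_measure \<alpha> \<beta>) (\<lambda>_. 1::real)"
    using set_integrable_jweight[OF ab] by (subst integrable_jacobi) auto
  then show "emeasure (jacobi_measure \<alpha> \<beta>) (space (jacobi_measure \<alpha> \<beta>)) \<noteq> \<infinity>"
    by (simp add: integrable_iff_bounded)
qed

section \<open>Integrals of polynomials in the cosine: symmetry and orthogonality\<close>

lemma poly_yvar_bounded: "\<exists>B. \<forall>\<theta>. \<bar>poly q (yvar \<theta>)\<bar> \<le> B"
proof -
  have "bounded (poly q ` {-1..0})"
    by (intro compact_imp_bounded compact_continuous_image continuous_intros) auto
  then obtain B where "\<forall>x\<in>poly q ` {-1..0}. norm x \<le> B"
    unfolding bounded_iff by blast
  with yvar_range show ?thesis by (auto intro!: exI[of _ B])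
qed

lemma poly_yvar_integrable:
  assumes ab: "\<alpha> > -1" "\<beta> > -1"
  shows "integrable (jacobi_measure \<alpha> \<beta>) (\<lambda>\<theta>. poly q (yvar \<theta>))"
proof -
  interpret finite_measure "jacobi_measure \<alpha> \<beta>" by (rule finite_measure_jacobi[OF ab])
  obtain B where "\<forall>\<theta>. \<bar>poly q (yvar \<theta>)\<bar> \<le> B" using poly_yvar_bounded by blast
  then show ?thesis
    by (intro integrable_const_bound[where B=B]) (auto intro!: borel_jacobi)
qed

text \<open>The Wronskian identity \<open>(W (p' q - p q'))' = w (jop p \<cdot> q - p \<cdot> jop q)\<close> with
  \<open>W = sin\<^bsup>2\<alpha>+2\<^esup> cos\<^bsup>2\<beta>+2\<^esup>\<close>, which vanishes at both endpoints.\<close>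

lemma jop_symmetric:
  assumes ab: "\<alpha> > -1" "\<beta> > -1"
  shows "(\<integral>\<theta>. poly (jop \<alpha> \<beta> p * q) (yvar \<theta>) \<partial>jacobi_measure \<alpha> \<beta>)
    = (\<integral>\<theta>. poly (p * jop \<alpha> \<beta> q) (yvar \<theta>) \<partial>jacobi_measure \<alpha> \<beta>)"
proof -
  define r where "r = jop \<alpha> \<beta> p * q - p * jop \<alpha> \<beta> q"
  define v where "v = pderiv p * q - p * pderiv q"
  \<comment> \<open>In the Wronskian identity the inner derivatives are in y and the outer one is in
    \<theta>. With s, c the half-angle sine and cosine, dy/d\<theta> = -s c and the surplus s c of W
    over w together supply y (1 + y). The positive exponents make F continuous and 0 at both
    ends.\<close>
  define F where "F \<theta> = sin (\<theta>/2) powr (2*\<alpha> + 2) * cos (\<theta>/2) powr (2*\<beta> + 2) * poly v (yvar \<theta>)" for \<theta>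
  have rv: "poly r y = y * (1 + y) * poly (pderiv v) y + ((\<alpha> + 1) * (1 + y) + (\<beta> + 1) * y) * poly v y" for y
    by (simp add: r_def v_def poly_jop pderiv_diff pderiv_mult algebra_simps)
  have cont: "continuous_on {0..pi} F"
    unfolding F_def using ab half_angle_nonneg
    by (intro continuous_on_mult continuous_on_powr' continuous_intros continuous_on_poly continuous_yvar) auto
  have int: "set_integrable lborel {0<..<pi} (\<lambda>\<theta>. jweight \<alpha> \<beta> \<theta> * poly r (yvar \<theta>))"
    using poly_yvar_integrable[OF ab, of r] by (subst (asm) integrable_jacobi) (auto intro!: borel_leb_0_pi)
  have "(LBINT \<theta>=ereal 0..ereal pi. jweight \<alpha> \<beta> \<theta> * poly r (yvar \<theta>)) = F pi - F 0"
  proof (rule interval_integral_FTC_integrable)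
    show "((F \<circ> real_of_ereal) \<longlongrightarrow> F 0) (at_right (ereal 0))"
      unfolding ereal_tendsto_simps using cont by (rule continuous_on_Icc_at_rightD) simp
    show "((F \<circ> real_of_ereal) \<longlongrightarrow> F pi) (at_left (ereal pi))"
      unfolding ereal_tendsto_simps using cont by (rule continuous_on_Icc_at_leftD) simp
    fix \<theta> assume "ereal 0 < ereal \<theta>" "ereal \<theta> < ereal pi"
    then have \<theta>: "sin (\<theta>/2) > 0" "cos (\<theta>/2) > 0" using half_angle_pos[of \<theta>] by auto
    define s c where "s = sin (\<theta>/2)" and "c = cos (\<theta>/2)"
    have pos: "s > 0" "c > 0" using \<theta> by (auto simp: s_def c_def)
    have "((\<lambda>\<theta>. sin (\<theta>/2) powr (2*\<alpha> + 2)) has_real_derivative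
        (2*\<alpha> + 2) * s powr (2*\<alpha> + 2 - of_nat 1) * (c * (1/2))) (at \<theta>)"
      unfolding s_def c_def by (rule DERIV_fun_powr) (auto intro!: derivative_eq_intros \<theta>)
    moreover have "((\<lambda>\<theta>. cos (\<theta>/2) powr (2*\<beta> + 2)) has_real_derivative
        (2*\<beta> + 2) * c powr (2*\<beta> + 2 - of_nat 1) * (- s * (1/2))) (at \<theta>)"
      unfolding s_def c_def by (rule DERIV_fun_powr) (auto intro!: derivative_eq_intros \<theta>)
    moreover have "((\<lambda>\<theta>. poly v (yvar \<theta>)) has_real_derivative poly (pderiv v) (yvar \<theta>) * (- (s * c))) (at \<theta>)"
      unfolding s_def c_def by (rule DERIV_chain2[OF poly_DERIV yvar_has_derivative])
    ultimately have D: "(F has_real_derivative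
        ((2*\<alpha> + 2) * s powr (2*\<alpha> + 2 - of_nat 1) * (c * (1/2)) * cos (\<theta>/2) powr (2*\<beta> + 2)
         + (2*\<beta> + 2) * c powr (2*\<beta> + 2 - of_nat 1) * (- s * (1/2)) * sin (\<theta>/2) powr (2*\<alpha> + 2)) * poly v (yvar \<theta>)
        + poly (pderiv v) (yvar \<theta>) * (- (s * c)) * (sin (\<theta>/2) powr (2*\<alpha> + 2) * cos (\<theta>/2) powr (2*\<beta> + 2))) (at \<theta>)"
      unfolding F_def by (intro DERIV_mult)
    define S K where "S = s powr (2*\<alpha> + 1)" and "K = c powr (2*\<beta> + 1)"
    have S: "s powr (2*\<alpha> + 2 - of_nat 1) = S" "sin (\<theta>/2) powr (2*\<alpha> + 2) = S * s"
      using pos powr_add[of s "2*\<alpha> + 1" 1] by (auto simp: S_def s_def[symmetric] algebra_simps)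
    have K: "c powr (2*\<beta> + 2 - of_nat 1) = K" "cos (\<theta>/2) powr (2*\<beta> + 2) = K * c"
      using pos powr_add[of c "2*\<beta> + 1" 1] by (auto simp: K_def c_def[symmetric] algebra_simps)
    have y: "yvar \<theta> = - s\<^sup>2" "1 - s\<^sup>2 = c\<^sup>2"
      using yvar_sin[of \<theta>] yvar_cos[of \<theta>] by (auto simp: s_def c_def)
    have w: "jweight \<alpha> \<beta> \<theta> = S * K" by (simp add: jweight_def S_def K_def s_def c_def)
    have "jweight \<alpha> \<beta> \<theta> * poly r (yvar \<theta>) = S * K * (- s\<^sup>2 * c\<^sup>2 * poly (pderiv v) (- s\<^sup>2)
        + ((\<alpha> + 1) * c\<^sup>2 - (\<beta> + 1) * s\<^sup>2) * poly v (- s\<^sup>2))"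
      unfolding w rv y(1) by (simp add: y(2))
    also have "\<dots> = ((2*\<alpha> + 2) * S * (c * (1/2)) * (K * c)
         + (2*\<beta> + 2) * K * (- s * (1/2)) * (S * s)) * poly v (- s\<^sup>2)
        + poly (pderiv v) (- s\<^sup>2) * (- (s * c)) * ((S * s) * (K * c))"
      by (simp add: algebra_simps power2_eq_square)
    finally show "(F has_vector_derivative jweight \<alpha> \<beta> \<theta> * poly r (yvar \<theta>)) (at \<theta>)"
      using D unfolding S K y(1) by (simp add: has_real_derivative_iff_has_vector_derivative)
    show "isCont (\<lambda>\<theta>. jweight \<alpha> \<beta> \<theta> * poly r (yvar \<theta>)) \<theta>"
      unfolding jweight_def yvar_def using \<theta> by (intro continuous_intros) auto
  qed (use int in auto)
  moreover have "F pi = 0" "F 0 = 0" using ab by (auto simp: F_def)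
  ultimately have "(LINT \<theta>:{0<..<pi}|lborel. jweight \<alpha> \<beta> \<theta> * poly r (yvar \<theta>)) = 0"
    by (simp add: interval_lebesgue_integral_def)
  then have "(\<integral>\<theta>. poly r (yvar \<theta>) \<partial>jacobi_measure \<alpha> \<beta>) = 0"
    by (subst integral_jacobi) (auto intro!: borel_leb_0_pi)
  moreover have "(\<integral>\<theta>. poly r (yvar \<theta>) \<partial>jacobi_measure \<alpha> \<beta>)
     = (\<integral>\<theta>. poly (jop \<alpha> \<beta> p * q) (yvar \<theta>) \<partial>jacobi_measure \<alpha> \<beta>)
     - (\<integral>\<theta>. poly (p * jop \<alpha> \<beta> q) (yvar \<theta>) \<partial>jacobi_measure \<alpha> \<beta>)"
    unfolding r_def poly_diff
    by (rule Bochner_Integration.integral_diff[OF poly_yvar_integrable[OF ab] poly_yvar_integrable[OF ab]])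
  ultimately show ?thesis by simp
qed

text \<open>Eigenvectors of a symmetric operator for distinct eigenvalues. For i \<noteq> j at least
  one index is positive, so i + j + \<alpha> + \<beta> + 1 > 0 and the eigenvalues do
  differ.\<close>

lemma jpoly_orthogonal:
  assumes ab: "\<alpha> > -1" "\<beta> > -1" and "i \<noteq> j"
  shows "(\<integral>\<theta>. poly (jpoly \<alpha> \<beta> i * jpoly \<alpha> \<beta> j) (yvar \<theta>) \<partial>jacobi_measure \<alpha> \<beta>) = 0"
proof -
  let ?I = "\<integral>\<theta>. poly (jpoly \<alpha> \<beta> i * jpoly \<alpha> \<beta> j) (yvar \<theta>) \<partial>jacobi_measure \<alpha> \<beta>"
  let ?l = "jacobi_eigenvalue \<alpha> \<beta>"
  have "?l i * ?I = ?l j * ?I"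
    using jop_symmetric[OF ab, of "jpoly \<alpha> \<beta> i" "jpoly \<alpha> \<beta> j"]
    by (simp only: jop_jpoly mult_smult_left mult_smult_right poly_smult integral_mult_right_zero)
  then have "(?l i - ?l j) * ?I = 0" by (simp only: left_diff_distrib diff_self)
  moreover have "?l i - ?l j = (real i - real j) * (real i + real j + \<alpha> + \<beta> + 1)"
    by (simp add: algebra_simps)
  moreover have "real i + real j + \<alpha> + \<beta> + 1 > 0"
    using ab \<open>i \<noteq> j\<close> by (cases "i = 0"; cases "j = 0") auto
  ultimately show ?thesis using \<open>i \<noteq> j\<close> by auto
qed

lemma yvar_inj: "inj_on yvar {0<..<pi}"
  unfolding yvar_def inj_on_def by (auto intro: cos_inj_pi)

lemma emeasure_leb_0_pi: "emeasure leb_0_pi (space leb_0_pi) \<noteq> 0"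
  by (simp add: leb_0_pi_def emeasure_restrict_space space_restrict_space)

text \<open>A zero integral would force q to vanish almost everywhere on the interval, but its
  finitely many roots have finitely many preimages, since the cosine is injective there.\<close>

lemma poly_square_integral_pos:
  assumes ab: "\<alpha> > -1" "\<beta> > -1" and "q \<noteq> 0"
  shows "(\<integral>\<theta>. poly (q * q) (yvar \<theta>) \<partial>jacobi_measure \<alpha> \<beta>) > 0"
proof -
  let ?I = "\<integral>\<theta>. poly (q * q) (yvar \<theta>) \<partial>jacobi_measure \<alpha> \<beta>"
  have "?I \<ge> 0" by (intro integral_nonneg_AE) simp
  moreover have "?I \<noteq> 0"
  proof
    assume "?I = 0"
    then have "AE \<theta> in jacobi_measure \<alpha> \<beta>. poly (q * q) (yvar \<theta>) = 0"
      by (subst (asm) integral_nonneg_eq_0_iff_AE[OF poly_yvar_integrable[OF ab]]) auto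
    then have "AE \<theta> in leb_0_pi. poly q (yvar \<theta>) = 0" by (simp add: AE_jacobi)
    moreover have "AE \<theta> in leb_0_pi. poly q (yvar \<theta>) \<noteq> 0"
    proof -
      have "finite {\<theta> \<in> {0<..<pi}. poly q (yvar \<theta>) = 0}"
      proof (rule finite_imageD)
        show "finite (yvar ` {\<theta> \<in> {0<..<pi}. poly q (yvar \<theta>) = 0})"
          by (rule finite_subset[OF _ poly_roots_finite[OF \<open>q \<noteq> 0\<close>]]) auto
        show "inj_on yvar {\<theta> \<in> {0<..<pi}. poly q (yvar \<theta>) = 0}"
          by (rule inj_on_subset[OF yvar_inj]) auto
      qed
      from AE_not_in[OF finite_imp_null_set_lborel[OF this]]
      show ?thesis unfolding AE_leb_0_pi by eventually_elim auto
    qed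
    ultimately have "AE \<theta> in leb_0_pi. False" by eventually_elim auto
    then have "emeasure leb_0_pi (space leb_0_pi) = 0"
      by (simp only: eventually_False ae_filter_eq_bot_iff)
    with emeasure_leb_0_pi show False by simp
  qed
  ultimately show ?thesis by linarith
qed

section \<open>Polynomial approximation\<close>

lemma real_polynomial_function_poly:
  assumes "real_polynomial_function (r :: real \<Rightarrow> real)"
  obtains q where "r = poly q"
proof -
  from assms obtain a n where "r = (\<lambda>x. \<Sum>i\<le>n. a i * x ^ i)"
    unfolding real_polynomial_function_iff_sum by blast
  then have "r = poly (\<Sum>i\<le>n. monom (a i) i)"
    by (simp add: fun_eq_iff poly_sum poly_monom)
  then show ?thesis using that by blast
qed

text \<open>Lebesgue measurability yields continuous functions converging almost everywhere;
  clamping them to [-B, B] keeps continuity and does not change the limit, because f takes almost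
  all its values there.\<close>

lemma bounded_continuous_approx:
  fixes f :: "real \<Rightarrow> real"
  assumes f: "f \<in> borel_measurable leb_0_pi" and B: "AE \<theta> in leb_0_pi. \<bar>f \<theta>\<bar> \<le> B" "0 \<le> B"
  obtains g where "\<And>n. continuous_on UNIV (g n)" "\<And>n \<theta>. \<bar>g n \<theta>\<bar> \<le> B"
    "AE \<theta> in leb_0_pi. (\<lambda>n. g n \<theta>) \<longlonglongrightarrow> f \<theta>"
proof -
  define F where "F \<theta> = indicator {0<..<pi} \<theta> *\<^sub>R f \<theta>" for \<theta>
  have "F \<in> borel_measurable lborel"
    using f unfolding leb_0_pi_def F_def by (subst (asm) borel_measurable_restrict_space_iff) auto
  then have "F \<in> borel_measurable lebesgue" by (rule measurable_completion)
  then have "F measurable_on UNIV" by (intro lebesgue_measurable_imp_measurable_on) auto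
  then obtain N h where N: "negligible N" "\<And>n. continuous_on UNIV (h n)"
    "\<And>\<theta>. \<theta> \<notin> N \<Longrightarrow> (\<lambda>n. h n \<theta>) \<longlonglongrightarrow> F \<theta>"
    unfolding measurable_on_def by auto
  show ?thesis
  proof (rule that[of "\<lambda>n \<theta>. max (- B) (min B (h n \<theta>))"])
    show "continuous_on UNIV (\<lambda>\<theta>. max (- B) (min B (h n \<theta>)))" for n
      using N(2) by (intro continuous_intros)
    show "\<bar>max (- B) (min B (h n \<theta>))\<bar> \<le> B" for n \<theta> using B(2) by auto
    have "AE \<theta> in lebesgue. \<theta> \<notin> N"
      using N(1) by (intro AE_not_in) (simp add: negligible_iff_null_sets)
    then have "AE \<theta> in lborel. \<theta> \<notin> N" by (simp add: AE_completion_iff)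
    then have "AE \<theta> in leb_0_pi. \<theta> \<notin> N" unfolding AE_leb_0_pi by eventually_elim auto
    with B(1) AE_space[of leb_0_pi]
    show "AE \<theta> in leb_0_pi. (\<lambda>n. max (- B) (min B (h n \<theta>))) \<longlonglongrightarrow> f \<theta>"
    proof eventually_elim
      case (elim \<theta>)
      have "(\<lambda>n. max (- B) (min B (h n \<theta>))) \<longlonglongrightarrow> max (- B) (min B (F \<theta>))"
        by (intro tendsto_intros N(3) elim)
      moreover have "max (- B) (min B (F \<theta>)) = f \<theta>" using elim by (auto simp: F_def)
      ultimately show ?case by simp
    qed
  qed
qed

text \<open>Dominated convergence brings a continuous g close to f in L2; with \<theta> = arccos (1
  + 2y), g becomes continuous on [-1, 0], where Weierstrass approximates it uniformly.\<close>

lemma bounded_poly_approx_real: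
  fixes f :: "real \<Rightarrow> real"
  assumes ab: "\<alpha> > -1" "\<beta> > -1"
    and f: "f \<in> borel_measurable leb_0_pi" and B: "AE \<theta> in leb_0_pi. \<bar>f \<theta>\<bar> \<le> B" "0 \<le> B"
    and \<epsilon>: "\<epsilon> > 0"
  shows "\<exists>q. (\<forall>y\<in>{-1..0}. \<bar>poly q y\<bar> \<le> B + \<epsilon>) \<and>
    (\<integral>\<theta>. (poly q (yvar \<theta>) - f \<theta>)\<^sup>2 \<partial>jacobi_measure \<alpha> \<beta>) \<le> \<epsilon>"
proof -
  let ?M = "jacobi_measure \<alpha> \<beta>"
  interpret finite_measure ?M by (rule finite_measure_jacobi[OF ab])
  obtain g where g: "\<And>n. continuous_on UNIV (g n)" "\<And>n \<theta>. \<bar>g n \<theta>\<bar> \<le> B"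
    "AE \<theta> in leb_0_pi. (\<lambda>n. g n \<theta>) \<longlonglongrightarrow> f \<theta>"
    using bounded_continuous_approx[OF f B] by blast
  have [measurable]: "f \<in> borel_measurable ?M" using f by (simp add: measurable_jacobi)
  have [measurable]: "g n \<in> borel_measurable ?M" for n
    by (intro borel_jacobi borel_measurable_continuous_onI g)
  have bound: "AE \<theta> in ?M. norm ((g n \<theta> - f \<theta>)\<^sup>2) \<le> (2 * B)\<^sup>2" for n
    unfolding AE_jacobi using B(1)
  proof eventually_elim
    case (elim \<theta>)
    have "\<bar>g n \<theta> - f \<theta>\<bar> \<le> 2 * B" using elim g(2)[of n \<theta>] by linarith
    then have "\<bar>g n \<theta> - f \<theta>\<bar>\<^sup>2 \<le> (2 * B)\<^sup>2" by (intro power_mono) auto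
    then show ?case by simp
  qed
  have "(\<lambda>n. \<integral>\<theta>. (g n \<theta> - f \<theta>)\<^sup>2 \<partial>?M) \<longlonglongrightarrow> (\<integral>\<theta>. 0 \<partial>?M)"
  proof (rule integral_dominated_convergence[OF _ _ _ _ bound])
    show "AE \<theta> in ?M. (\<lambda>n. (g n \<theta> - f \<theta>)\<^sup>2) \<longlonglongrightarrow> 0"
      unfolding AE_jacobi using g(3)
    proof eventually_elim
      case (elim \<theta>)
      from tendsto_power[OF LIM_zero[OF elim], of 2] show ?case by simp
    qed
  qed auto
  then have "(\<lambda>n. \<integral>\<theta>. (g n \<theta> - f \<theta>)\<^sup>2 \<partial>?M) \<longlonglongrightarrow> 0" by simp
  \<comment> \<open>A quarter, because (a + b)^2 <= 2a^2 + 2b^2 doubles this error below.\<close>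
  from order_tendstoD(2)[OF this, of "\<epsilon> / 4"] \<epsilon>
  have "\<forall>\<^sub>F n in sequentially. (\<integral>\<theta>. (g n \<theta> - f \<theta>)\<^sup>2 \<partial>?M) < \<epsilon> / 4" by simp
  then obtain n where n: "(\<integral>\<theta>. (g n \<theta> - f \<theta>)\<^sup>2 \<partial>?M) < \<epsilon> / 4"
    by (auto simp: eventually_sequentially)
  define \<mu> where "\<mu> = measure ?M (space ?M)"
  have \<mu>: "\<mu> \<ge> 0" by (simp add: \<mu>_def)
  \<comment> \<open>At most \<epsilon> for the supremum bound, at most 1 so that \<eta>^2 <= \<eta>,
    and at most the quotient so that 2 \<eta>^2 \<mu> <= \<epsilon> / 2; \<mu> + 1 keeps the
    denominator positive.\<close>
  define \<eta> where "\<eta> = min \<epsilon> (min 1 (\<epsilon> / (4 * (\<mu> + 1))))"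
  have \<eta>: "0 < \<eta>" "\<eta> \<le> \<epsilon>" "\<eta> \<le> 1" "\<eta> \<le> \<epsilon> / (4 * (\<mu> + 1))"
    using \<epsilon> \<mu> by (auto simp: \<eta>_def)
  have "continuous_on {-1..0} (\<lambda>y. g n (arccos (1 + 2 * y)))"
    by (rule continuous_on_compose2[OF g(1)[of n]]) (auto intro!: continuous_intros)
  then obtain r where r: "real_polynomial_function r"
    "\<And>y. y \<in> {-1..0} \<Longrightarrow> \<bar>g n (arccos (1 + 2 * y)) - r y\<bar> < \<eta>"
    using Stone_Weierstrass_real_polynomial_function[of "{-1..0::real}"] \<eta>(1) by (metis compact_Icc)
  from r(1) obtain q where q: "r = poly q" by (rule real_polynomial_function_poly)
  show ?thesis
  proof (intro exI[of _ q] conjI ballI)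
    fix y :: real assume y: "y \<in> {-1..0}"
    show "\<bar>poly q y\<bar> \<le> B + \<epsilon>"
      using r(2)[OF y] g(2)[of n "arccos (1 + 2 * y)"] \<eta>(2) unfolding q by linarith
  next
    have "(\<integral>\<theta>. (poly q (yvar \<theta>) - f \<theta>)\<^sup>2 \<partial>?M) \<le> (\<integral>\<theta>. 2 * \<eta>\<^sup>2 + 2 * (g n \<theta> - f \<theta>)\<^sup>2 \<partial>?M)"
    proof (rule integral_mono_AE')
      show "integrable ?M (\<lambda>\<theta>. 2 * \<eta>\<^sup>2 + 2 * (g n \<theta> - f \<theta>)\<^sup>2)"
        using integrable_const_bound[OF bound] by auto
      show "AE \<theta> in ?M. (poly q (yvar \<theta>) - f \<theta>)\<^sup>2 \<le> 2 * \<eta>\<^sup>2 + 2 * (g n \<theta> - f \<theta>)\<^sup>2"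
      proof (rule AE_I2)
        fix \<theta> assume "\<theta> \<in> space ?M"
        moreover have "1 + 2 * yvar \<theta> = cos \<theta>" by (simp add: yvar_def field_simps)
        ultimately have "arccos (1 + 2 * yvar \<theta>) = \<theta>" by (simp add: arccos_cos)
        with r(2)[OF yvar_range[of \<theta>]] have "\<bar>poly q (yvar \<theta>) - g n \<theta>\<bar> \<le> \<eta>" by (simp add: q)
        then have "\<bar>poly q (yvar \<theta>) - g n \<theta>\<bar>\<^sup>2 \<le> \<eta>\<^sup>2" by (intro power_mono) auto
        moreover have "(a + b)\<^sup>2 \<le> 2 * a\<^sup>2 + 2 * b\<^sup>2" for a b :: real
          using two_mult_le[of a b] by (simp add: power2_sum)
        note this[of "poly q (yvar \<theta>) - g n \<theta>" "g n \<theta> - f \<theta>"]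
        ultimately show "(poly q (yvar \<theta>) - f \<theta>)\<^sup>2 \<le> 2 * \<eta>\<^sup>2 + 2 * (g n \<theta> - f \<theta>)\<^sup>2"
          by simp
      qed
    qed simp
    also have "\<dots> = 2 * \<eta>\<^sup>2 * \<mu> + 2 * (\<integral>\<theta>. (g n \<theta> - f \<theta>)\<^sup>2 \<partial>?M)"
      using integrable_const_bound[OF bound] by (simp add: \<mu>_def)
    also have "\<dots> \<le> \<epsilon> / 2 + \<epsilon> / 2"
    proof (rule add_mono)
      have "\<eta>\<^sup>2 \<le> \<eta>" using \<eta> by (simp add: power2_eq_square mult_left_le)
      then have "2 * \<eta>\<^sup>2 * \<mu> \<le> 2 * \<eta> * (\<mu> + 1)" using \<mu> \<eta>(1) by (intro mult_mono) auto
      also have "\<dots> \<le> 2 * (\<epsilon> / (4 * (\<mu> + 1))) * (\<mu> + 1)"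
        using \<eta>(4) \<mu> by (intro mult_right_mono mult_left_mono) auto
      also have "\<dots> = \<epsilon> / 2" using \<mu> by (simp add: field_simps)
      finally show "2 * \<eta>\<^sup>2 * \<mu> \<le> \<epsilon> / 2" .
    qed (use n in linarith)
    finally show "(\<integral>\<theta>. (poly q (yvar \<theta>) - f \<theta>)\<^sup>2 \<partial>?M) \<le> \<epsilon>" by simp
  qed
qed

section \<open>Jacobi functions\<close>

lemma deriv_poly_yvar:
  "((\<lambda>\<theta>. poly q (yvar \<theta>)) has_real_derivative - (sin (\<theta>/2) * cos (\<theta>/2)) * poly (pderiv q) (yvar \<theta>)) (at \<theta>)"
  using DERIV_chain2[OF poly_DERIV[of q "yvar \<theta>"] yvar_has_derivative[of \<theta>]] by (simp add: mult_ac)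

text \<open>Derivatives are local: the iterated derivatives are known in closed form on the open
  interval only, and this is enough to compute the next one there.\<close>

lemma has_real_derivative_cong_open:
  assumes "(g has_real_derivative D) (at x)" "open S" "x \<in> S" "\<And>t. t \<in> S \<Longrightarrow> f t = g t"
  shows "deriv f x = D"
  using assms by (intro DERIV_imp_deriv) (metis has_field_derivative_transform_within_open)

text \<open>Agreement with the polynomial is required on the open interval only, which is all that
  iterating the operator provides: at each endpoint one of cot and tan divides by zero.\<close>

lemma delta_star_delta:
  assumes f: "\<And>t. t \<in> {0<..<pi} \<Longrightarrow> f t = poly q (yvar t)" and \<theta>: "\<theta> \<in> {0<..<pi}"
  shows "jacobi_delta_star \<alpha> \<beta> (jacobi_delta f) \<theta> = poly (jop \<alpha> \<beta> q) (yvar \<theta>)"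
proof -
  define h where "h \<theta> = - (sin (\<theta>/2) * cos (\<theta>/2)) * poly (pderiv q) (yvar \<theta>)" for \<theta>
  define s c where "s = sin (\<theta>/2)" and "c = cos (\<theta>/2)"
  have pos: "s > 0" "c > 0" using half_angle_pos[of \<theta>] \<theta> by (auto simp: s_def c_def)
  have df: "jacobi_delta f t = h t" if "t \<in> {0<..<pi}" for t
    unfolding jacobi_delta_def h_def
    by (rule has_real_derivative_cong_open[OF deriv_poly_yvar _ that f]) auto
  have "((\<lambda>\<theta>. sin (\<theta>/2) * cos (\<theta>/2)) has_real_derivative (c\<^sup>2 - s\<^sup>2) / 2) (at \<theta>)"
    unfolding s_def c_def
    by (auto intro!: derivative_eq_intros simp: power2_eq_square field_simps)
  from DERIV_mult[OF DERIV_minus[OF this] deriv_poly_yvar[of "pderiv q" \<theta>]]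
  have "(h has_real_derivative - ((c\<^sup>2 - s\<^sup>2) / 2) * poly (pderiv q) (yvar \<theta>)
      + - (s * c) * poly (pderiv (pderiv q)) (yvar \<theta>) * - (s * c)) (at \<theta>)"
    unfolding h_def s_def c_def .
  then have dh: "deriv (jacobi_delta f) \<theta> = - ((c\<^sup>2 - s\<^sup>2) / 2) * poly (pderiv q) (yvar \<theta>)
      + - (s * c) * poly (pderiv (pderiv q)) (yvar \<theta>) * - (s * c)"
    by (rule has_real_derivative_cong_open[OF _ _ \<theta> df]) auto
  have h: "h \<theta> = - (s * c) * poly (pderiv q) (yvar \<theta>)" by (simp add: h_def s_def c_def)
  have ct: "cot (\<theta>/2) = c / s" "tan (\<theta>/2) = s / c"
    by (auto simp: cot_def tan_def s_def c_def)
  have y: "yvar \<theta> = - s\<^sup>2" "c\<^sup>2 = 1 - s\<^sup>2"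
    using yvar_sin[of \<theta>] yvar_cos[of \<theta>] by (auto simp: s_def c_def)
  define Q1 Q2 where "Q1 = poly (pderiv q) (yvar \<theta>)" and "Q2 = poly (pderiv (pderiv q)) (yvar \<theta>)"
  have "jacobi_delta_star \<alpha> \<beta> (jacobi_delta f) \<theta>
      = (c\<^sup>2 - s\<^sup>2) / 2 * Q1 - (s * c)\<^sup>2 * Q2
        + (\<alpha> + 1/2) * (c / s) * (s * c) * Q1 - (\<beta> + 1/2) * (s / c) * (s * c) * Q1"
    unfolding jacobi_delta_star_def dh df[OF \<theta>] h ct Q1_def[symmetric] Q2_def[symmetric]
    by (simp add: power2_eq_square algebra_simps)
  also have "\<dots> = (c\<^sup>2 - s\<^sup>2) / 2 * Q1 - (s * c)\<^sup>2 * Q2 + (\<alpha> + 1/2) * c\<^sup>2 * Q1 - (\<beta> + 1/2) * s\<^sup>2 * Q1"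
    using pos by (simp add: power2_eq_square)
  \<comment> \<open>The halves of c^2 and s^2 coming from the derivative of the product turn
    \<alpha> + 1/2 and \<beta> + 1/2 into \<alpha> + 1 and \<beta> + 1.\<close>
  also have "\<dots> = - s\<^sup>2 * (1 - s\<^sup>2) * Q2 + (\<alpha> + 1 + (\<alpha> + \<beta> + 2) * (- s\<^sup>2)) * Q1"
    unfolding power_mult_distrib y(2) by (simp add: field_simps)
  also have "\<dots> = poly (jop \<alpha> \<beta> q) (yvar \<theta>)"
    by (simp add: poly_jop Q1_def Q2_def y(1))
  finally show ?thesis .
qed

lemma jacobi_D_even:
  assumes "\<theta> \<in> {0<..<pi}"
  shows "jacobi_D \<alpha> \<beta> (2 * k) (\<lambda>\<theta>. poly q (yvar \<theta>)) \<theta> = poly ((jop \<alpha> \<beta> ^^ k) q) (yvar \<theta>)"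
  using assms
proof (induction k arbitrary: \<theta>)
  case (Suc k)
  have "jacobi_D \<alpha> \<beta> (2 * Suc k) (\<lambda>\<theta>. poly q (yvar \<theta>))
      = jacobi_delta_star \<alpha> \<beta> (jacobi_delta (jacobi_D \<alpha> \<beta> (2 * k) (\<lambda>\<theta>. poly q (yvar \<theta>))))"
    by (simp add: fun_eq_iff)
  with delta_star_delta[OF Suc.IH Suc.prems] show ?case by simp
qed simp

lemma jacobi_poly_yvar: "jacobi_poly \<alpha> \<beta> n (cos \<theta>) = poly (jpoly \<alpha> \<beta> n) (yvar \<theta>)"
  by (simp add: yvar_def poly_jpoly)

lemma jacobi_fun_eq: "jacobi_fun \<alpha> \<beta> n = (\<lambda>\<theta>. jacobi_const \<alpha> \<beta> n * poly (jpoly \<alpha> \<beta> n) (yvar \<theta>))"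
  by (simp add: jacobi_fun_def jacobi_poly_yvar fun_eq_iff)

lemma jacobi_const_pos:
  assumes ab: "\<alpha> > -1" "\<beta> > -1"
  shows "jacobi_const \<alpha> \<beta> n > 0"
proof -
  have "jpoly \<alpha> \<beta> n \<noteq> 0" using degree_jpoly(2)[OF ab, of n] by auto
  from poly_square_integral_pos[OF ab this] show ?thesis
    by (simp add: jacobi_const_def jacobi_poly_yvar power2_eq_square)
qed

lemma jacobi_fun_orthonormal:
  assumes ab: "\<alpha> > -1" "\<beta> > -1"
  shows "(\<integral>\<theta>. jacobi_fun \<alpha> \<beta> i \<theta> * jacobi_fun \<alpha> \<beta> j \<theta> \<partial>jacobi_measure \<alpha> \<beta>) = (if i = j then 1 else 0)"
proof -
  let ?I = "\<integral>\<theta>. poly (jpoly \<alpha> \<beta> i * jpoly \<alpha> \<beta> j) (yvar \<theta>) \<partial>jacobi_measure \<alpha> \<beta>"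
  have "(\<integral>\<theta>. jacobi_fun \<alpha> \<beta> i \<theta> * jacobi_fun \<alpha> \<beta> j \<theta> \<partial>jacobi_measure \<alpha> \<beta>)
      = (\<integral>\<theta>. (jacobi_const \<alpha> \<beta> i * jacobi_const \<alpha> \<beta> j) * poly (jpoly \<alpha> \<beta> i * jpoly \<alpha> \<beta> j) (yvar \<theta>) \<partial>jacobi_measure \<alpha> \<beta>)"
    by (simp add: jacobi_fun_eq mult_ac)
  also have "\<dots> = jacobi_const \<alpha> \<beta> i * jacobi_const \<alpha> \<beta> j * ?I" by (rule integral_mult_right_zero)
  also have "\<dots> = (if i = j then 1 else 0)"
  proof (cases "i = j")
    case True
    have "jpoly \<alpha> \<beta> i \<noteq> 0" using degree_jpoly(2)[OF ab, of i] by auto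
    from poly_square_integral_pos[OF ab this] have "?I > 0" by (simp add: True)
    moreover have "jacobi_const \<alpha> \<beta> i = 1 / sqrt ?I"
      by (simp add: True jacobi_const_def jacobi_poly_yvar power2_eq_square)
    ultimately show ?thesis using True by simp
  next
    case False
    then show ?thesis by (simp only: jpoly_orthogonal[OF ab False] mult_zero_right if_False)
  qed
  finally show ?thesis .
qed

lemma jacobi_D_jacobi_fun:
  assumes "\<theta> \<in> {0<..<pi}"
  shows "jacobi_D \<alpha> \<beta> (2 * k) (jacobi_fun \<alpha> \<beta> n) \<theta> = jacobi_eigenvalue \<alpha> \<beta> n ^ k * jacobi_fun \<alpha> \<beta> n \<theta>"
proof -
  let ?q = "smult (jacobi_const \<alpha> \<beta> n) (jpoly \<alpha> \<beta> n)"
  have "(jop \<alpha> \<beta> ^^ k) ?q = smult (jacobi_eigenvalue \<alpha> \<beta> n ^ k) ?q"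
    by (induction k) (simp_all add: jop_smult jop_jpoly mult_ac)
  moreover have "jacobi_fun \<alpha> \<beta> n = (\<lambda>\<theta>. poly ?q (yvar \<theta>))" by (simp add: jacobi_fun_eq)
  ultimately show ?thesis using jacobi_D_even[OF assms, of \<alpha> \<beta> k ?q] by simp
qed

text \<open>Real and imaginary parts are approximated separately and expanded in Jacobi polynomials
  up to a common degree; adding the two bounds gives the factor 2, which becomes part of the
  operator bound.\<close>

lemma bounded_expansion_approx:
  fixes f :: "real \<Rightarrow> complex"
  assumes ab: "\<alpha> > -1" "\<beta> > -1"
    and f: "f \<in> borel_measurable leb_0_pi" and B: "AE \<theta> in leb_0_pi. norm (f \<theta>) \<le> B" "0 \<le> B"
    and \<epsilon>: "\<epsilon> > 0"
  shows "\<exists>d c. (\<forall>y\<in>{-1..0}. norm (\<Sum>i\<le>d. c i * of_real (poly (jpoly \<alpha> \<beta> i) y)) \<le> 2 * (B + \<epsilon>)) \<and>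
    L2_norm (jacobi_measure \<alpha> \<beta>)
      (\<lambda>\<theta>. (\<Sum>i\<le>d. c i * of_real (poly (jpoly \<alpha> \<beta> i) (yvar \<theta>))) - f \<theta>) \<le> \<epsilon>"
proof -
  let ?M = "jacobi_measure \<alpha> \<beta>"
  interpret finite_measure ?M by (rule finite_measure_jacobi[OF ab])
  \<comment> \<open>Both squared errors are at most \<eta> and their sum has to be at most
    \<epsilon>^2; \<eta> <= \<epsilon> serves the supremum bound.\<close>
  define \<eta> where "\<eta> = min \<epsilon> (\<epsilon>\<^sup>2 / 2)"
  have \<eta>: "\<eta> > 0" "\<eta> \<le> \<epsilon>" "2 * \<eta> \<le> \<epsilon>\<^sup>2" using \<epsilon> by (auto simp: \<eta>_def)
  have m: "(\<lambda>\<theta>. Re (f \<theta>)) \<in> borel_measurable leb_0_pi" "(\<lambda>\<theta>. Im (f \<theta>)) \<in> borel_measurable leb_0_pi"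
    using f by measurable
  have *: "AE \<theta> in leb_0_pi. \<bar>Re (f \<theta>)\<bar> \<le> B" "AE \<theta> in leb_0_pi. \<bar>Im (f \<theta>)\<bar> \<le> B"
    using B(1) by (eventually_elim; use abs_Re_le_cmod abs_Im_le_cmod order_trans in blast)+
  obtain p where p: "\<forall>y\<in>{-1..0}. \<bar>poly p y\<bar> \<le> B + \<eta>"
    "(\<integral>\<theta>. (poly p (yvar \<theta>) - Re (f \<theta>))\<^sup>2 \<partial>?M) \<le> \<eta>"
    using bounded_poly_approx_real[OF ab m(1) *(1) B(2) \<eta>(1)] by blast
  obtain q where q: "\<forall>y\<in>{-1..0}. \<bar>poly q y\<bar> \<le> B + \<eta>"
    "(\<integral>\<theta>. (poly q (yvar \<theta>) - Im (f \<theta>))\<^sup>2 \<partial>?M) \<le> \<eta>"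
    using bounded_poly_approx_real[OF ab m(2) *(2) B(2) \<eta>(1)] by blast
  define d where "d = max (degree p) (degree q)"
  obtain a where a: "p = (\<Sum>i\<le>d. smult (a i) (jpoly \<alpha> \<beta> i))"
    using jpoly_span[OF ab, of p d] by (auto simp: d_def)
  obtain b where b: "q = (\<Sum>i\<le>d. smult (b i) (jpoly \<alpha> \<beta> i))"
    using jpoly_span[OF ab, of q d] by (auto simp: d_def)
  have sum: "(\<Sum>i\<le>d. Complex (a i) (b i) * of_real (poly (jpoly \<alpha> \<beta> i) y)) = Complex (poly p y) (poly q y)" for y
    by (simp add: complex_eq_iff a b poly_sum)
  show ?thesis
  proof (intro exI[of _ d] exI[of _ "\<lambda>i. Complex (a i) (b i)"] conjI ballI)
    fix y :: real assume y: "y \<in> {-1..0}"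
    have "norm (Complex (poly p y) (poly q y)) \<le> \<bar>poly p y\<bar> + \<bar>poly q y\<bar>"
      using cmod_le[of "Complex (poly p y) (poly q y)"] by simp
    also have "\<dots> \<le> (B + \<epsilon>) + (B + \<epsilon>)"
      using p(1) q(1) y \<eta>(2) by (intro add_mono) force+
    finally show "norm (\<Sum>i\<le>d. Complex (a i) (b i) * of_real (poly (jpoly \<alpha> \<beta> i) y)) \<le> 2 * (B + \<epsilon>)"
      unfolding sum by simp
  next
    have int: "integrable ?M (\<lambda>\<theta>. (poly r (yvar \<theta>) - g \<theta>)\<^sup>2)"
      if g: "g \<in> borel_measurable leb_0_pi" "AE \<theta> in leb_0_pi. \<bar>g \<theta>\<bar> \<le> B" for r and g :: "real \<Rightarrow> real"
    proof -
      have [measurable]: "g \<in> borel_measurable ?M" using g by (simp add: measurable_jacobi)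
      have [measurable]: "(\<lambda>\<theta>. poly r (yvar \<theta>)) \<in> borel_measurable ?M"
        by (rule borel_jacobi) measurable
      obtain K where K: "\<And>\<theta>. \<bar>poly r (yvar \<theta>)\<bar> \<le> K" using poly_yvar_bounded by blast
      have "AE \<theta> in ?M. norm ((poly r (yvar \<theta>) - g \<theta>)\<^sup>2) \<le> (K + B)\<^sup>2"
        unfolding AE_jacobi using g(2)
      proof eventually_elim
        case (elim \<theta>)
        have "\<bar>poly r (yvar \<theta>) - g \<theta>\<bar> \<le> K + B" using elim K[of \<theta>] by linarith
        then have "\<bar>poly r (yvar \<theta>) - g \<theta>\<bar>\<^sup>2 \<le> (K + B)\<^sup>2" by (intro power_mono) auto
        then show ?case by simp
      qed
      then show ?thesis by (rule integrable_const_bound) measurable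
    qed
    have "(\<integral>\<theta>. (norm (Complex (poly p (yvar \<theta>)) (poly q (yvar \<theta>)) - f \<theta>))\<^sup>2 \<partial>?M)
       = (\<integral>\<theta>. (poly p (yvar \<theta>) - Re (f \<theta>))\<^sup>2 + (poly q (yvar \<theta>) - Im (f \<theta>))\<^sup>2 \<partial>?M)"
      by (simp add: cmod_power2)
    also have "\<dots> = (\<integral>\<theta>. (poly p (yvar \<theta>) - Re (f \<theta>))\<^sup>2 \<partial>?M) + (\<integral>\<theta>. (poly q (yvar \<theta>) - Im (f \<theta>))\<^sup>2 \<partial>?M)"
      using int[OF m(1) *(1)] int[OF m(2) *(2)] by (rule Bochner_Integration.integral_add)
    also have "\<dots> \<le> \<epsilon>\<^sup>2" using p(2) q(2) \<eta>(3) by linarith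
    finally show "L2_norm ?M (\<lambda>\<theta>. (\<Sum>i\<le>d. Complex (a i) (b i) * of_real (poly (jpoly \<alpha> \<beta> i) (yvar \<theta>))) - f \<theta>) \<le> \<epsilon>"
      unfolding L2_norm_def sum using \<epsilon> by (intro real_le_lsqrt) auto
  qed
qed

section \<open>Boundedness of the Riesz transform\<close>

lemma L2_space_cong:
  assumes "\<And>x. x \<in> space M \<Longrightarrow> f x = g x"
  shows "f \<in> L2_space M \<longleftrightarrow> g \<in> L2_space M"
  unfolding L2_space_def using assms measurable_cong[of M f g]
  by (auto simp: cong: Bochner_Integration.integrable_cong)

text \<open>Allows for the fact that the terms of the Riesz series are matched with the multiplier
  terms on the open interval only.\<close>

lemma L2_sums_cong:
  assumes "\<And>n x. x \<in> space M \<Longrightarrow> u n x = v n x"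
  shows "L2_sums M u g \<longleftrightarrow> L2_sums M v g"
proof -
  have "u n \<in> L2_space M \<longleftrightarrow> v n \<in> L2_space M" for n
    by (rule L2_space_cong) (rule assms)
  moreover have "L2_norm M (\<lambda>x. (\<Sum>n=1..k. u n x) - g x) = L2_norm M (\<lambda>x. (\<Sum>n=1..k. v n x) - g x)" for k
    unfolding L2_norm_def using assms
    by (intro arg_cong[where f=sqrt] Bochner_Integration.integral_cong) simp_all
  ultimately show ?thesis by (simp add: L2_sums_def)
qed

lemma jacobi_orthonormal_multiplier:
  assumes ab: "\<alpha> > -1" "\<beta> > -1"
  shows "orthonormal_multiplier (jacobi_measure \<alpha> \<beta>) (jacobi_fun \<alpha> \<beta>) (\<lambda>n. (1 - inv_mult \<alpha> \<beta> n) ^ k)"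
proof -
  interpret finite_measure "jacobi_measure \<alpha> \<beta>" by (rule finite_measure_jacobi[OF ab])
  show ?thesis
  proof
    show "jacobi_fun \<alpha> \<beta> n \<in> borel_measurable (jacobi_measure \<alpha> \<beta>)" for n
      unfolding jacobi_fun_eq by (rule borel_jacobi) measurable
    show "\<exists>B. \<forall>\<theta>\<in>space (jacobi_measure \<alpha> \<beta>). \<bar>jacobi_fun \<alpha> \<beta> n \<theta>\<bar> \<le> B" for n
      using poly_yvar_bounded[of "smult (jacobi_const \<alpha> \<beta> n) (jpoly \<alpha> \<beta> n)"]
      by (auto simp: jacobi_fun_eq)
    show "\<bar>(1 - inv_mult \<alpha> \<beta> n) ^ k\<bar> \<le> 1" for n
      using inv_mult_range[OF ab, of n] by (simp add: power_abs power_le_one)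
  qed (rule jacobi_fun_orthonormal[OF ab])
qed

text \<open>Identifies the Riesz transform with the abstract multiplier operator.
  \<open>SOME\<close> returns a genuine sum because \<open>L2_sums_exist\<close> provides a
  witness.\<close>

lemma riesz_sup_bounded_multiplier:
  assumes ab: "\<alpha> > -1" "\<beta> > -1" and k: "k > 0"
  shows "sup_bounded_multiplier (jacobi_measure \<alpha> \<beta>) (jacobi_fun \<alpha> \<beta>)
    (\<lambda>n. (1 - inv_mult \<alpha> \<beta> n) ^ k) (riesz \<alpha> \<beta> (2 * k)) (2 ^ k * 2)"
proof -
  let ?M = "jacobi_measure \<alpha> \<beta>" and ?m = "\<lambda>n. (1 - inv_mult \<alpha> \<beta> n) ^ k"
  interpret orthonormal_multiplier ?M "jacobi_fun \<alpha> \<beta>" ?m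
    by (rule jacobi_orthonormal_multiplier[OF ab])
  have comb: "comb {..d} c \<theta>
      = (\<Sum>i\<le>d. c i * of_real (jacobi_const \<alpha> \<beta> i) * of_real (poly (jpoly \<alpha> \<beta> i) (yvar \<theta>)))" for d c \<theta>
    by (simp add: comb_def E_def jacobi_fun_eq mult.assoc)
  show ?thesis
  proof
    fix f :: "real \<Rightarrow> complex" assume f: "f \<in> L2_space ?M"
    have "riesz_term \<alpha> \<beta> (2 * k) f n \<theta> = mterm f n \<theta>" if "\<theta> \<in> space ?M" for n \<theta>
    proof -
      have "riesz_term \<alpha> \<beta> (2 * k) f n \<theta>
        = of_real (\<bar>real n + jacobi_tau \<alpha> \<beta>\<bar> powi (- int (2 * k)) * jacobi_eigenvalue \<alpha> \<beta> n ^ k)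
          * coef f n * E n \<theta>"
        using that unfolding riesz_term_def E_def[abs_def]
        by (subst jacobi_D_jacobi_fun) (simp_all only: space_jacobi of_real_mult mult_ac)
      then show ?thesis unfolding riesz_multiplier[OF ab k] mterm_def .
    qed
    then have eq: "L2_sums ?M (riesz_term \<alpha> \<beta> (2 * k) f) g \<longleftrightarrow> L2_sums ?M (mterm f) g" for g
      by (rule L2_sums_cong)
    then have "\<exists>g. L2_sums ?M (riesz_term \<alpha> \<beta> (2 * k) f) g"
      using L2_sums_exist[OF f] by blast
    then have "L2_sums ?M (riesz_term \<alpha> \<beta> (2 * k) f) (riesz \<alpha> \<beta> (2 * k) f)"
      unfolding riesz_def by (rule someI_ex)
    then show "L2_sums ?M (mterm f) (riesz \<alpha> \<beta> (2 * k) f)"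
      by (simp only: eq)
  next
    show "(1 - inv_mult \<alpha> \<beta> 0) ^ k = 0" using k by (simp add: inv_mult_def)
    show "0 \<le> (2 ^ k * 2 :: real)" by simp
  next
    fix f :: "real \<Rightarrow> complex" and B \<epsilon> :: real
    assume f: "f \<in> borel_measurable ?M" "AE \<theta> in ?M. norm (f \<theta>) \<le> B" and B: "0 \<le> B" "0 < \<epsilon>"
    obtain d c where dc: "\<forall>y\<in>{-1..0}. norm (\<Sum>i\<le>d. c i * of_real (poly (jpoly \<alpha> \<beta> i) y)) \<le> 2 * (B + \<epsilon>)"
      "L2_norm ?M (\<lambda>\<theta>. (\<Sum>i\<le>d. c i * of_real (poly (jpoly \<alpha> \<beta> i) (yvar \<theta>))) - f \<theta>) \<le> \<epsilon>"
      using bounded_expansion_approx[OF ab f[unfolded measurable_jacobi AE_jacobi] B] by blast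
    \<comment> \<open>Passes from expansions in the polynomials to expansions in the normalized
      functions, whose constants are positive.\<close>
    define c' where "c' i = c i / of_real (jacobi_const \<alpha> \<beta> i)" for i
    have c': "c' i * of_real (jacobi_const \<alpha> \<beta> i) = c i" for i
      using jacobi_const_pos[OF ab, of i] by (simp add: c'_def)
    show "\<exists>d c. L2_norm ?M (\<lambda>x. comb {..d} c x - f x) \<le> \<epsilon> \<and>
        (AE x in ?M. norm (comb {..d} (\<lambda>i. of_real (?m i) * c i) x) \<le> 2 ^ k * 2 * (B + \<epsilon>))"
    proof (intro exI[of _ d] exI[of _ c'] conjI AE_I2)
      show "L2_norm ?M (\<lambda>x. comb {..d} c' x - f x) \<le> \<epsilon>" unfolding comb c' by (rule dc(2))
      show "norm (comb {..d} (\<lambda>i. of_real (?m i) * c' i) \<theta>) \<le> 2 ^ k * 2 * (B + \<epsilon>)" for \<theta>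
        using riesz_mult_bound[OF ab dc(1)[rule_format] yvar_range, of k \<theta>]
        by (simp only: comb mult.assoc c')
    qed
  qed
qed

section \<open>Essential suprema on the interval\<close>

lemma esssup_norm_nonneg: "0 \<le> esssup leb_0_pi (\<lambda>\<theta>. ereal (norm (f \<theta>)))"
proof -
  have "esssup leb_0_pi (\<lambda>_. 0 :: ereal) \<le> esssup leb_0_pi (\<lambda>\<theta>. ereal (norm (f \<theta>)))"
    by (rule esssup_mono) auto
  \<comment> \<open>On a null measure the essential supremum of 0 would be minus infinity; the
    positive length of the interval excludes this.\<close>
  then show ?thesis by (simp only: esssup_const[OF emeasure_leb_0_pi])
qed

lemma Linf_norm_nonneg: "0 \<le> Linf_norm leb_0_pi f"
  unfolding Linf_norm_def by (intro real_of_ereal_pos esssup_norm_nonneg)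

lemma AE_le_Linf_norm:
  assumes "f \<in> Linf_space leb_0_pi"
  shows "AE \<theta> in leb_0_pi. norm (f \<theta>) \<le> Linf_norm leb_0_pi f"
proof -
  have "esssup leb_0_pi (\<lambda>\<theta>. ereal (norm (f \<theta>))) = ereal (Linf_norm leb_0_pi f)"
    using assms esssup_norm_nonneg[of f] unfolding Linf_norm_def Linf_space_def
    by (auto simp: ereal_real)
  then show ?thesis
    using esssup_AE[where M=leb_0_pi and f="\<lambda>\<theta>. ereal (norm (f \<theta>))"] by simp
qed

lemma Linf_norm_leI:
  assumes f: "f \<in> borel_measurable leb_0_pi" and K: "AE \<theta> in leb_0_pi. norm (f \<theta>) \<le> K"
  shows "f \<in> Linf_space leb_0_pi" "Linf_norm leb_0_pi f \<le> K"
proof -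
  have le: "esssup leb_0_pi (\<lambda>\<theta>. ereal (norm (f \<theta>))) \<le> ereal K"
    using f K by (intro esssup_I) auto
  then have "esssup leb_0_pi (\<lambda>\<theta>. ereal (norm (f \<theta>))) < \<infinity>" by (rule le_less_trans) simp
  with f show "f \<in> Linf_space leb_0_pi" by (simp add: Linf_space_def)
  from le esssup_norm_nonneg[of f] show "Linf_norm leb_0_pi f \<le> K"
    unfolding Linf_norm_def
    by (cases "esssup leb_0_pi (\<lambda>\<theta>. ereal (norm (f \<theta>)))") auto
qed

theorem mainTheorem5:
  fixes \<alpha> \<beta> :: real and N :: nat
  assumes "\<alpha> > -1" and "\<beta> > -1" and "N \<ge> 2" and "even N"
  shows "(\<exists>T. bounded_operator_on (jacobi_measure \<alpha> \<beta>)
              (L1_space (jacobi_measure \<alpha> \<beta>)) (L1_norm (jacobi_measure \<alpha> \<beta>)) T \<and>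
            (\<forall>f\<in>L2_space (jacobi_measure \<alpha> \<beta>).
               AE \<theta> in jacobi_measure \<alpha> \<beta>. T f \<theta> = riesz \<alpha> \<beta> N f \<theta>)) \<and>
         bounded_operator_on leb_0_pi (Linf_space leb_0_pi) (Linf_norm leb_0_pi) (riesz \<alpha> \<beta> N)"
proof -
  \<comment> \<open>Positivity of k is what makes the multiplier vanish at n = 0.\<close>
  obtain k where k: "N = 2 * k" "k > 0" using assms(3,4) by (auto elim!: evenE)
  interpret sup_bounded_multiplier "jacobi_measure \<alpha> \<beta>" "jacobi_fun \<alpha> \<beta>"
    "\<lambda>n. (1 - inv_mult \<alpha> \<beta> n) ^ k" "riesz \<alpha> \<beta> N" "2 ^ k * 2"
    unfolding k(1) by (rule riesz_sup_bounded_multiplier[OF assms(1,2) k(2)])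
  \<comment> \<open>The supremum norm refers to Lebesgue measure and the expansion to the weighted
    one; common null sets and finiteness of the weighted measure put bounded functions into its
    L2.\<close>
  have L2: "f \<in> L2_space (jacobi_measure \<alpha> \<beta>)" if "f \<in> Linf_space leb_0_pi" for f
    using that AE_le_Linf_norm[OF that]
    by (intro bounded_L2) (auto simp: measurable_jacobi AE_jacobi Linf_space_def)
  have meas: "riesz \<alpha> \<beta> N f \<in> borel_measurable leb_0_pi" if "f \<in> Linf_space leb_0_pi" for f
    using L2_space_measurable[OF R_L2[OF L2[OF that]]] by (simp add: measurable_jacobi)
  have bound: "AE \<theta> in leb_0_pi. norm (riesz \<alpha> \<beta> N f \<theta>) \<le> 2 ^ k * 2 * Linf_norm leb_0_pi f"
    if "f \<in> Linf_space leb_0_pi" for f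
    using R_sup_le[of f "Linf_norm leb_0_pi f"] AE_le_Linf_norm[OF that] Linf_norm_nonneg that
    by (simp add: measurable_jacobi AE_jacobi Linf_space_def)
  have "bounded_operator_on leb_0_pi (Linf_space leb_0_pi) (Linf_norm leb_0_pi) (riesz \<alpha> \<beta> N)"
    unfolding bounded_operator_on_def
  proof (intro conjI ballI allI exI)
    show "riesz \<alpha> \<beta> N f \<in> Linf_space leb_0_pi" if "f \<in> Linf_space leb_0_pi" for f
      by (rule Linf_norm_leI(1)[OF meas bound]) (fact that)+
    show "Linf_norm leb_0_pi (riesz \<alpha> \<beta> N f) \<le> 2 ^ k * 2 * Linf_norm leb_0_pi f"
      if "f \<in> Linf_space leb_0_pi" for f
      by (rule Linf_norm_leI(2)[OF meas bound]) (fact that)+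
    show "AE \<theta> in leb_0_pi. riesz \<alpha> \<beta> N (\<lambda>y. a * f y + b * g y) \<theta> = a * riesz \<alpha> \<beta> N f \<theta> + b * riesz \<alpha> \<beta> N g \<theta>"
      if "f \<in> Linf_space leb_0_pi" "g \<in> Linf_space leb_0_pi" for f g a b
      using R_linear[OF L2 L2, OF that, of a b] by (simp add: AE_jacobi)
  qed
  \<comment> \<open>The L1 half is inherited through the sublocale of
    \<open>sup_bounded_multiplier\<close>, whose L1 bound came from duality.\<close>
  with bounded_L1_extension show ?thesis by blast
qed

end
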